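(* Let $\gamma_1,\gamma_2,\gamma_3$ be nonzero real numbers with $\gamma_1+\gamma_2=2$, $\gamma_2>0$ and $\gamma_3>0$, and consider the Davey–Stewartson equations $$\mathrm{i} A_t + A_{xx} + A_{yy} +(\gamma_1 |A|^2 +\gamma_2 \phi_x)A=0, \qquad \gamma_3\phi_{xx} + \phi_{yy} -\gamma_3 (|A|^2)_x = 0$$ for $A=A(x,y,t)\in\mathbb{C}$ and $\phi=\phi(x,y,t)\in\mathbb{R}$. For each sufficiently small positive value of $\lambda$ (i.e. there exists $\lambda_0>0$ such that for every $\lambda\in(0,\lambda_0)$) the linearisation of these equations at the line soliton $A^\star(x,t)=\mathrm{e}^{\mathrm{i}t}\operatorname{sech}(x)$, $\phi^\star(x)=\tanh(x)$ has a nontrivial solution whose $A$-component is $\mathrm{e}^{\lambda t+\mathrm{i}t}A(x,y)$ and whose $\phi$-component is $\mathrm{e}^{\lambda t}\phi(x,y)$, where $(A(x,y),\phi(x,y))$ (with $A$ complex-valued and $\phi$ real-valued) is periodic in $y$ and satisfies $(A(x,y),\phi(x,y))\to(0,0)$ as $x\to\pm\infty$.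
   Context: The linearisation of the Davey–Stewartson equations at $(A^\star,\phi^\star)$ is the real-linear system for a perturbation $(B,\varphi)$, with $B=B(x,y,t)\in\mathbb{C}$ and $\varphi=\varphi(x,y,t)\in\mathbb{R}$, given by $$\mathrm{i}B_t+B_{xx}+B_{yy}+2\operatorname{sech}^2(x)B+2\gamma_1\operatorname{sech}^2(x)\,\mathrm{e}^{\mathrm{i}t}\,\mathrm{Re}(\mathrm{e}^{-\mathrm{i}t}B)+\gamma_2\,\mathrm{e}^{\mathrm{i}t}\operatorname{sech}(x)\,\varphi_x=0,$$ $$\gamma_3\varphi_{xx}+\varphi_{yy}-2\gamma_3\big(\operatorname{sech}(x)\,\mathrm{Re}(\mathrm{e}^{-\mathrm{i}t}B)\big)_x=0.$$ *)

theory Defs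
  imports "HOL-Analysis.Analysis"
begin

section \<open>Partial derivatives of functions of $(x,y,t)$\<close>

definition partial_x :: "(real \<Rightarrow> real \<Rightarrow> real \<Rightarrow> 'a::real_normed_vector) \<Rightarrow> real \<Rightarrow> real \<Rightarrow> real \<Rightarrow> 'a"
  where "partial_x f x y t = vector_derivative (\<lambda>s. f s y t) (at x)"

definition partial_y :: "(real \<Rightarrow> real \<Rightarrow> real \<Rightarrow> 'a::real_normed_vector) \<Rightarrow> real \<Rightarrow> real \<Rightarrow> real \<Rightarrow> 'a"
  where "partial_y f x y t = vector_derivative (\<lambda>s. f x s t) (at y)"

definition partial_t :: "(real \<Rightarrow> real \<Rightarrow> real \<Rightarrow> 'a::real_normed_vector) \<Rightarrow> real \<Rightarrow> real \<Rightarrow> real \<Rightarrow> 'a"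
  where "partial_t f x y t = vector_derivative (\<lambda>s. f x y s) (at t)"

text \<open>The operators above return a junk value where the derivative does not exist.
  Solutions are therefore required to be classical, of class $C^2$ on the whole of $(x,y,t)$-space.\<close>

definition partially_differentiable :: "(real \<Rightarrow> real \<Rightarrow> real \<Rightarrow> 'a::real_normed_vector) \<Rightarrow> bool"
  where "partially_differentiable f \<longleftrightarrow>
    (\<forall>x y t. (\<lambda>s. f s y t) differentiable at x \<and>
             (\<lambda>s. f x s t) differentiable at y \<and>
             (\<lambda>s. f x y s) differentiable at t)"

definition class_C1 :: "(real \<Rightarrow> real \<Rightarrow> real \<Rightarrow> 'a::real_normed_vector) \<Rightarrow> bool"
  where "class_C1 f \<longleftrightarrow> partially_differentiable f \<and>
    continuous_on UNIV (\<lambda>(x, y, t). partial_x f x y t) \<and>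
    continuous_on UNIV (\<lambda>(x, y, t). partial_y f x y t) \<and>
    continuous_on UNIV (\<lambda>(x, y, t). partial_t f x y t)"

definition class_C2 :: "(real \<Rightarrow> real \<Rightarrow> real \<Rightarrow> 'a::real_normed_vector) \<Rightarrow> bool"
  where "class_C2 f \<longleftrightarrow> class_C1 f \<and>
    class_C1 (partial_x f) \<and> class_C1 (partial_y f) \<and> class_C1 (partial_t f)"


section \<open>The Davey--Stewartson equations and the line soliton\<close>

definition sech :: "real \<Rightarrow> real"
  where "sech x = 1 / cosh x"

text \<open>Left-hand sides of the two equations.\<close>

definition DS1 :: "real \<Rightarrow> real \<Rightarrow> (real \<Rightarrow> real \<Rightarrow> real \<Rightarrow> complex) \<Rightarrow> (real \<Rightarrow> real \<Rightarrow> real \<Rightarrow> real) \<Rightarrow>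
    real \<Rightarrow> real \<Rightarrow> real \<Rightarrow> complex"
  where "DS1 \<gamma>\<^sub>1 \<gamma>\<^sub>2 A \<phi> x y t =
    \<i> * partial_t A x y t + partial_x (partial_x A) x y t + partial_y (partial_y A) x y t
    + of_real (\<gamma>\<^sub>1 * (cmod (A x y t))\<^sup>2 + \<gamma>\<^sub>2 * partial_x \<phi> x y t) * A x y t"

definition DS2 :: "real \<Rightarrow> (real \<Rightarrow> real \<Rightarrow> real \<Rightarrow> complex) \<Rightarrow> (real \<Rightarrow> real \<Rightarrow> real \<Rightarrow> real) \<Rightarrow>
    real \<Rightarrow> real \<Rightarrow> real \<Rightarrow> real"
  where "DS2 \<gamma>\<^sub>3 A \<phi> x y t =
    \<gamma>\<^sub>3 * partial_x (partial_x \<phi>) x y t + partial_y (partial_y \<phi>) x y t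
    - \<gamma>\<^sub>3 * partial_x (\<lambda>x y t. (cmod (A x y t))\<^sup>2) x y t"

definition A_star :: "real \<Rightarrow> real \<Rightarrow> real \<Rightarrow> complex"
  where "A_star x y t = exp (\<i> * of_real t) * of_real (sech x)"

definition \<phi>_star :: "real \<Rightarrow> real \<Rightarrow> real \<Rightarrow> real"
  where "\<phi>_star x y t = tanh x"


section \<open>The linearisation at the line soliton\<close>

text \<open>The explicit form below uses \<open>\<gamma>\<^sub>1 + \<gamma>\<^sub>2 = 2\<close>. The lemmas \<open>DS1_linearisation\<close> and
  \<open>DS2_linearisation\<close> confirm that under this condition it is the directional derivative of
  \<open>(DS1, DS2)\<close> at \<open>(A_star, \<phi>_star)\<close>.\<close>

definition linDS1 :: "real \<Rightarrow> real \<Rightarrow> (real \<Rightarrow> real \<Rightarrow> real \<Rightarrow> complex) \<Rightarrow> (real \<Rightarrow> real \<Rightarrow> real \<Rightarrow> real) \<Rightarrow>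
    real \<Rightarrow> real \<Rightarrow> real \<Rightarrow> complex"
  where "linDS1 \<gamma>\<^sub>1 \<gamma>\<^sub>2 B \<phi> x y t =
    \<i> * partial_t B x y t + partial_x (partial_x B) x y t + partial_y (partial_y B) x y t
    + 2 * of_real ((sech x)\<^sup>2) * B x y t
    + 2 * of_real \<gamma>\<^sub>1 * of_real ((sech x)\<^sup>2) * exp (\<i> * of_real t)
        * of_real (Re (exp (- \<i> * of_real t) * B x y t))
    + of_real \<gamma>\<^sub>2 * exp (\<i> * of_real t) * of_real (sech x) * of_real (partial_x \<phi> x y t)"

definition linDS2 :: "real \<Rightarrow> (real \<Rightarrow> real \<Rightarrow> real \<Rightarrow> complex) \<Rightarrow> (real \<Rightarrow> real \<Rightarrow> real \<Rightarrow> real) \<Rightarrow>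
    real \<Rightarrow> real \<Rightarrow> real \<Rightarrow> real"
  where "linDS2 \<gamma>\<^sub>3 B \<phi> x y t =
    \<gamma>\<^sub>3 * partial_x (partial_x \<phi>) x y t + partial_y (partial_y \<phi>) x y t
    - 2 * \<gamma>\<^sub>3 * partial_x (\<lambda>x y t. sech x * Re (exp (- \<i> * of_real t) * B x y t)) x y t"

definition linDS_solution :: "real \<Rightarrow> real \<Rightarrow> real \<Rightarrow> (real \<Rightarrow> real \<Rightarrow> real \<Rightarrow> complex) \<Rightarrow>
    (real \<Rightarrow> real \<Rightarrow> real \<Rightarrow> real) \<Rightarrow> bool"
  where "linDS_solution \<gamma>\<^sub>1 \<gamma>\<^sub>2 \<gamma>\<^sub>3 B \<phi> \<longleftrightarrow> class_C2 B \<and> class_C2 \<phi> \<and>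
    (\<forall>x y t. linDS1 \<gamma>\<^sub>1 \<gamma>\<^sub>2 B \<phi> x y t = 0 \<and> linDS2 \<gamma>\<^sub>3 B \<phi> x y t = 0)"


section \<open>Profiles in $(x,y)$\<close>

definition periodic_in_y :: "(real \<Rightarrow> real \<Rightarrow> complex) \<Rightarrow> (real \<Rightarrow> real \<Rightarrow> real) \<Rightarrow> bool"
  where "periodic_in_y A \<phi> \<longleftrightarrow>
    (\<exists>P>0. \<forall>x y. A x (y + P) = A x y \<and> \<phi> x (y + P) = \<phi> x y)"

text \<open>Decay as \<open>x \<rightarrow> \<plusminus>\<infinity>\<close> is taken to be uniform in \<open>y\<close>.\<close>

definition decays_in_x :: "(real \<Rightarrow> real \<Rightarrow> 'a::real_normed_vector) \<Rightarrow> bool"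
  where "decays_in_x f \<longleftrightarrow>
    uniform_limit UNIV f (\<lambda>y. 0) at_top \<and> uniform_limit UNIV f (\<lambda>y. 0) at_bot"


section \<open>Consistency of the explicit linearisation\<close>

lemma partial_x_eq: "((\<lambda>s. f s y t) has_vector_derivative d) (at x) \<Longrightarrow> partial_x f x y t = d"
  and partial_y_eq: "((\<lambda>s. f x s t) has_vector_derivative d) (at y) \<Longrightarrow> partial_y f x y t = d"
  and partial_t_eq: "((\<lambda>s. f x y s) has_vector_derivative d) (at t) \<Longrightarrow> partial_t f x y t = d"
  by (simp_all add: partial_x_def partial_y_def partial_t_def vector_derivative_at)

lemma partially_differentiableD:
  assumes "partially_differentiable f"
  shows "((\<lambda>s. f s y t) has_vector_derivative partial_x f x y t) (at x)"
    and "((\<lambda>s. f x s t) has_vector_derivative partial_y f x y t) (at y)"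
    and "((\<lambda>s. f x y s) has_vector_derivative partial_t f x y t) (at t)"
  using assms
  by (simp_all add: partially_differentiable_def partial_x_def partial_y_def partial_t_def
      vector_derivative_works)

lemma partial_add_scaleR:
  assumes "partially_differentiable f" "partially_differentiable g"
  shows "partial_x (\<lambda>x y t. f x y t + \<epsilon> *\<^sub>R g x y t) = (\<lambda>x y t. partial_x f x y t + \<epsilon> *\<^sub>R partial_x g x y t)"
    and "partial_y (\<lambda>x y t. f x y t + \<epsilon> *\<^sub>R g x y t) = (\<lambda>x y t. partial_y f x y t + \<epsilon> *\<^sub>R partial_y g x y t)"
    and "partial_t (\<lambda>x y t. f x y t + \<epsilon> *\<^sub>R g x y t) = (\<lambda>x y t. partial_t f x y t + \<epsilon> *\<^sub>R partial_t g x y t)"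
  by (auto intro!: ext partial_x_eq partial_y_eq partial_t_eq derivative_eq_intros
      partially_differentiableD assms)

lemma class_C2_imp:
  assumes "class_C2 f"
  shows "partially_differentiable f" "partially_differentiable (partial_x f)"
    "partially_differentiable (partial_y f)"
  using assms by (simp_all add: class_C2_def class_C1_def)

lemma sech_deriv: "(sech has_real_derivative - sech x * tanh x) (at x within S)"
proof -
  have "((\<lambda>x. 1 / cosh x) has_real_derivative - sech x * tanh x) (at x within S)"
    by (auto intro!: derivative_eq_intros simp: sech_def tanh_def)
  then show ?thesis by (simp add: sech_def[abs_def])
qed

lemma sech_sq: "(sech x)\<^sup>2 = 1 - (tanh x)\<^sup>2"
proof -
  have "(sech x)\<^sup>2 = ((cosh x)\<^sup>2 - (sinh x)\<^sup>2) / (cosh x)\<^sup>2"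
    by (simp add: sech_def power_divide cosh_square_eq)
  also have "\<dots> = (cosh x)\<^sup>2 / (cosh x)\<^sup>2 - (tanh x)\<^sup>2"
    by (simp only: tanh_def power_divide diff_divide_distrib)
  also have "(cosh x)\<^sup>2 / (cosh x)\<^sup>2 = 1"
    by (rule divide_self) simp
  finally show ?thesis .
qed

lemma tanh_deriv: "(tanh has_real_derivative (sech x)\<^sup>2) (at x within S)" for x :: real
  by (auto intro!: derivative_eq_intros simp: sech_sq)

lemma sech_tanh_deriv:
  "((\<lambda>x. - sech x * tanh x) has_real_derivative sech x * (1 - 2 * (sech x)\<^sup>2)) (at x within S)"
proof -
  have "((\<lambda>x. - sech x * tanh x) has_real_derivative
      - (- sech x * tanh x) * tanh x + (sech x)\<^sup>2 * (- sech x)) (at x within S)"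
    by (intro DERIV_mult DERIV_minus sech_deriv tanh_deriv)
  also have "- (- sech x * tanh x) * tanh x + (sech x)\<^sup>2 * (- sech x) = sech x * ((tanh x)\<^sup>2 - (sech x)\<^sup>2)"
    by (simp add: algebra_simps power2_eq_square)
  also have "\<dots> = sech x * (1 - 2 * (sech x)\<^sup>2)"
    by (simp add: sech_sq)
  finally show ?thesis .
qed

lemma has_vector_derivative_cis_mult:
  assumes "(g has_real_derivative d) (at x)"
  shows "((\<lambda>s. c * complex_of_real (g s)) has_vector_derivative c * of_real d) (at x)"
  using assms
  by (auto intro!: derivative_eq_intros simp: has_real_derivative_iff_has_vector_derivative)

lemma A_star_partials:
  "partial_x A_star = (\<lambda>x y t. exp (\<i> * of_real t) * of_real (- sech x * tanh x))"
  "partial_x (partial_x A_star) =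
     (\<lambda>x y t. exp (\<i> * of_real t) * of_real (sech x * (1 - 2 * (sech x)\<^sup>2)))"
  "partial_y A_star = (\<lambda>x y t. 0)"
  "partial_y (partial_y A_star) = (\<lambda>x y t. 0)"
  "partial_t A_star = (\<lambda>x y t. \<i> * A_star x y t)"
proof -
  show 1: "partial_x A_star = (\<lambda>x y t. exp (\<i> * of_real t) * of_real (- sech x * tanh x))"
    unfolding A_star_def[abs_def]
    by (intro ext partial_x_eq has_vector_derivative_cis_mult sech_deriv)
  show "partial_x (partial_x A_star) =
     (\<lambda>x y t. exp (\<i> * of_real t) * of_real (sech x * (1 - 2 * (sech x)\<^sup>2)))"
    unfolding 1 by (intro ext partial_x_eq has_vector_derivative_cis_mult sech_tanh_deriv)
  show 2: "partial_y A_star = (\<lambda>x y t. 0)"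
    unfolding A_star_def[abs_def] by (intro ext partial_y_eq) simp
  show "partial_y (partial_y A_star) = (\<lambda>x y t. 0)"
    unfolding 2 by (intro ext partial_y_eq) simp
  show "partial_t A_star = (\<lambda>x y t. \<i> * A_star x y t)"
    unfolding A_star_def[abs_def]
    by (intro ext partial_t_eq)
       (auto intro!: derivative_eq_intros has_vector_derivative_real_field)
qed

lemma \<phi>_star_partials:
  "partial_x \<phi>_star = (\<lambda>x y t. (sech x)\<^sup>2)"
  "partial_x (partial_x \<phi>_star) = (\<lambda>x y t. - 2 * (sech x)\<^sup>2 * tanh x)"
  "partial_y \<phi>_star = (\<lambda>x y t. 0)"
  "partial_y (partial_y \<phi>_star) = (\<lambda>x y t. 0)"
proof -
  show 1: "partial_x \<phi>_star = (\<lambda>x y t. (sech x)\<^sup>2)"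
    unfolding \<phi>_star_def[abs_def]
    by (intro ext partial_x_eq)
       (use tanh_deriv in \<open>auto simp: has_real_derivative_iff_has_vector_derivative\<close>)
  have "((\<lambda>x. (sech x)\<^sup>2) has_real_derivative - 2 * (sech x)\<^sup>2 * tanh x) (at x)" for x
    by (auto intro!: derivative_eq_intros sech_deriv simp: power2_eq_square)
  then show "partial_x (partial_x \<phi>_star) = (\<lambda>x y t. - 2 * (sech x)\<^sup>2 * tanh x)"
    unfolding 1 by (intro ext partial_x_eq) (auto simp: has_real_derivative_iff_has_vector_derivative)
  show 2: "partial_y \<phi>_star = (\<lambda>x y t. 0)"
    unfolding \<phi>_star_def[abs_def] by (intro ext partial_y_eq) simp
  show "partial_y (partial_y \<phi>_star) = (\<lambda>x y t. 0)"
    unfolding 2 by (intro ext partial_y_eq) simp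
qed

lemma star_partially_differentiable:
  "partially_differentiable A_star" "partially_differentiable (partial_x A_star)"
  "partially_differentiable (partial_y A_star)"
  "partially_differentiable \<phi>_star" "partially_differentiable (partial_x \<phi>_star)"
  "partially_differentiable (partial_y \<phi>_star)"
proof -
  have s: "sech differentiable at x" and th: "tanh differentiable at x"
    and st: "(\<lambda>x. - sech x * tanh x) differentiable at x" for x :: real
    using sech_deriv tanh_deriv sech_tanh_deriv real_differentiable_def by blast+
  have c: "(\<lambda>s. c * complex_of_real (g s)) differentiable at x"
    if "g differentiable at x" for c g and x :: real
    using that has_vector_derivative_cis_mult real_differentiable_def differentiableI_vector by blast
  have e: "(\<lambda>t. exp (\<i> * complex_of_real t)) differentiable at t" for t
    by (rule differentiableI_vector[OF has_vector_derivative_real_field])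
       (auto intro!: derivative_eq_intros)
  have e': "(\<lambda>t. exp (\<i> * complex_of_real t) * c) differentiable at t" for c t
    by (intro differentiable_mult e differentiable_const)
  show "partially_differentiable A_star"
    unfolding partially_differentiable_def A_star_def by (intro allI conjI c s e' differentiable_const)
  show "partially_differentiable (partial_x A_star)"
    unfolding partially_differentiable_def A_star_partials(1)
    by (intro allI conjI c st e' differentiable_const)
  show "partially_differentiable (partial_y A_star)" "partially_differentiable (partial_y \<phi>_star)"
    by (simp_all add: partially_differentiable_def A_star_partials(3) \<phi>_star_partials(3))
  show "partially_differentiable \<phi>_star"
    unfolding partially_differentiable_def \<phi>_star_def by (intro allI conjI th differentiable_const)
  show "partially_differentiable (partial_x \<phi>_star)"
    unfolding partially_differentiable_def \<phi>_star_partials(1)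
    by (intro allI conjI differentiable_power s differentiable_const)
qed

lemma cmod_A_star: "cmod (A_star x y t) = sech x"
  unfolding A_star_def norm_mult norm_exp_i_times norm_of_real by (simp add: sech_def)

lemma line_soliton_solves_DS:
  assumes "\<gamma>\<^sub>1 + \<gamma>\<^sub>2 = 2"
  shows "DS1 \<gamma>\<^sub>1 \<gamma>\<^sub>2 A_star \<phi>_star x y t = 0" and "DS2 \<gamma>\<^sub>3 A_star \<phi>_star x y t = 0"
proof -
  have "\<gamma>\<^sub>1 * (cmod (A_star x y t))\<^sup>2 + \<gamma>\<^sub>2 * partial_x \<phi>_star x y t = 2 * (sech x)\<^sup>2"
    by (simp add: cmod_A_star \<phi>_star_partials assms flip: distrib_right)
  then show "DS1 \<gamma>\<^sub>1 \<gamma>\<^sub>2 A_star \<phi>_star x y t = 0"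
    unfolding DS1_def A_star_partials(2,4,5) by (simp add: A_star_def algebra_simps)
  have "partial_x (\<lambda>x y t. (cmod (A_star x y t))\<^sup>2) = partial_x (partial_x \<phi>_star)"
    by (simp add: cmod_A_star \<phi>_star_partials(1))
  then show "DS2 \<gamma>\<^sub>3 A_star \<phi>_star x y t = 0"
    unfolding DS2_def by (simp add: \<phi>_star_partials(4))
qed

lemma cmod_sq_perturbation:
  "(cmod (A_star x y t + \<epsilon> *\<^sub>R b))\<^sup>2
    = (sech x)\<^sup>2 + 2 * \<epsilon> * (sech x * Re (exp (- \<i> * of_real t) * b)) + \<epsilon>\<^sup>2 * (cmod b)\<^sup>2"
proof -
  have "(cmod (a + \<epsilon> *\<^sub>R b))\<^sup>2 = (cmod a)\<^sup>2 + 2 * \<epsilon> * Re (cnj a * b) + \<epsilon>\<^sup>2 * (cmod b)\<^sup>2" for a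
    unfolding cmod_power2 by (simp add: algebra_simps power2_eq_square)
  moreover have "cnj (A_star x y t) * b = of_real (sech x) * (exp (- \<i> * of_real t) * b)"
    by (simp add: A_star_def exp_cnj mult_ac)
  then have "Re (cnj (A_star x y t) * b) = sech x * Re (exp (- \<i> * of_real t) * b)"
    by (simp only: scaleR_conv_of_real[symmetric] scaleR_complex.sel)
  ultimately show ?thesis by (simp add: cmod_A_star)
qed

lemma cubic_derivative_at_0:
  assumes "\<And>\<epsilon>. f \<epsilon> = a + \<epsilon> *\<^sub>R b + \<epsilon>\<^sup>2 *\<^sub>R c + \<epsilon> ^ 3 *\<^sub>R d"
  shows "(f has_vector_derivative b) (at 0)"
proof -
  have "((\<lambda>\<epsilon>. a + \<epsilon> *\<^sub>R b + \<epsilon>\<^sup>2 *\<^sub>R c + \<epsilon> ^ 3 *\<^sub>R d) has_vector_derivative b) (at 0)"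
    by (auto intro!: derivative_eq_intros simp: power2_eq_square power3_eq_cube)
  moreover have "f = (\<lambda>\<epsilon>. a + \<epsilon> *\<^sub>R b + \<epsilon>\<^sup>2 *\<^sub>R c + \<epsilon> ^ 3 *\<^sub>R d)"
    using assms by blast
  ultimately show ?thesis by simp
qed

lemma DS1_linearisation:
  assumes "\<gamma>\<^sub>1 + \<gamma>\<^sub>2 = 2" "class_C2 B" "class_C2 \<phi>"
  shows "((\<lambda>\<epsilon>. DS1 \<gamma>\<^sub>1 \<gamma>\<^sub>2 (\<lambda>x y t. A_star x y t + \<epsilon> *\<^sub>R B x y t) (\<lambda>x y t. \<phi>_star x y t + \<epsilon> *\<^sub>R \<phi> x y t) x y t)
    has_vector_derivative linDS1 \<gamma>\<^sub>1 \<gamma>\<^sub>2 B \<phi> x y t) (at 0)"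
proof -
  define r where "r = Re (exp (- \<i> * of_real t) * B x y t)"
  define A where "A = A_star x y t"
  define b where "b = B x y t"
  define m where "m = cmod b"
  have A: "cmod A = sech x" unfolding A_def by (rule cmod_A_star)
  define p where "p = 2 * \<gamma>\<^sub>1 * (sech x * r) + \<gamma>\<^sub>2 * partial_x \<phi> x y t"
  have g: "\<gamma>\<^sub>1 = 2 - \<gamma>\<^sub>2" using assms(1) by simp
  have L: "linDS1 \<gamma>\<^sub>1 \<gamma>\<^sub>2 B \<phi> x y t = \<i> * partial_t B x y t + partial_x (partial_x B) x y t
      + partial_y (partial_y B) x y t + of_real (2 * (sech x)\<^sup>2) * b + of_real p * A"
    unfolding linDS1_def r_def[symmetric] p_def A_def b_def A_star_def
    by (simp add: algebra_simps power2_eq_square)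
  show ?thesis
  proof (rule cubic_derivative_at_0)
    fix \<epsilon> :: real
    have q: "\<gamma>\<^sub>1 * (cmod (A + \<epsilon> *\<^sub>R b))\<^sup>2 + \<gamma>\<^sub>2 * (partial_x \<phi>_star x y t + \<epsilon> *\<^sub>R partial_x \<phi> x y t)
      = 2 * (sech x)\<^sup>2 + \<epsilon> * p + \<epsilon>\<^sup>2 * (\<gamma>\<^sub>1 * m\<^sup>2)"
      unfolding A_def b_def cmod_sq_perturbation r_def[symmetric] p_def m_def \<phi>_star_partials g
      by (simp add: algebra_simps)
    show "DS1 \<gamma>\<^sub>1 \<gamma>\<^sub>2 (\<lambda>x y t. A_star x y t + \<epsilon> *\<^sub>R B x y t) (\<lambda>x y t. \<phi>_star x y t + \<epsilon> *\<^sub>R \<phi> x y t) x y t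
      = DS1 \<gamma>\<^sub>1 \<gamma>\<^sub>2 A_star \<phi>_star x y t + \<epsilon> *\<^sub>R linDS1 \<gamma>\<^sub>1 \<gamma>\<^sub>2 B \<phi> x y t
        + \<epsilon>\<^sup>2 *\<^sub>R (of_real p * b + of_real (\<gamma>\<^sub>1 * m\<^sup>2) * A) + \<epsilon> ^ 3 *\<^sub>R (of_real (\<gamma>\<^sub>1 * m\<^sup>2) * b)"
      unfolding L DS1_def
      by (simp only: partial_add_scaleR class_C2_imp[OF assms(2)] class_C2_imp[OF assms(3)]
          star_partially_differentiable q flip: A_def b_def)
         (simp add: A \<phi>_star_partials(1) g scaleR_conv_of_real algebra_simps
          power2_eq_square power3_eq_cube)
  qed
qed

lemma DS2_linearisation:
  assumes "class_C2 B" "class_C2 \<phi>"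
  shows "((\<lambda>\<epsilon>. DS2 \<gamma>\<^sub>3 (\<lambda>x y t. A_star x y t + \<epsilon> *\<^sub>R B x y t) (\<lambda>x y t. \<phi>_star x y t + \<epsilon> *\<^sub>R \<phi> x y t) x y t)
    has_vector_derivative linDS2 \<gamma>\<^sub>3 B \<phi> x y t) (at 0)"
proof -
  define u where "u x y t = sech x * Re (exp (- \<i> * of_real t) * B x y t)" for x y t
  define v where "v x y t = (cmod (B x y t))\<^sup>2" for x y t
  have B: "((\<lambda>s. B s y t) has_vector_derivative partial_x B x y t) (at x)"
    using assms(1) by (intro partially_differentiableD class_C2_imp)
  have lin: "((\<lambda>s. h (B s y t)) has_real_derivative h (partial_x B x y t)) (at x)"
    if "bounded_linear h" for h
    using bounded_linear.has_vector_derivative[OF that B]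
    by (simp add: has_real_derivative_iff_has_vector_derivative)
  have "bounded_linear (\<lambda>z. Re (exp (- \<i> * of_real t) * z))"
    by (intro bounded_linear_compose[OF bounded_linear_Re] bounded_linear_mult_right)
  from lin[OF this] have "(\<lambda>s. u s y t) differentiable at x"
    unfolding u_def using sech_deriv real_differentiable_def differentiable_mult by blast
  then have u: "((\<lambda>s. u s y t) has_real_derivative partial_x u x y t) (at x)"
    by (simp add: partial_x_def vector_derivative_works has_real_derivative_iff_has_vector_derivative)
  have "(\<lambda>s. v s y t) differentiable at x"
    unfolding v_def cmod_power2
    using lin[OF bounded_linear_Re] lin[OF bounded_linear_Im] real_differentiable_def
    by (intro differentiable_add differentiable_power) blast+
  then have v: "((\<lambda>s. v s y t) has_real_derivative partial_x v x y t) (at x)"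
    by (simp add: partial_x_def vector_derivative_works has_real_derivative_iff_has_vector_derivative)
  have s: "((\<lambda>x. (sech x)\<^sup>2) has_real_derivative - 2 * (sech x)\<^sup>2 * tanh x) (at x)"
    by (auto intro!: derivative_eq_intros sech_deriv simp: power2_eq_square)
  have m: "partial_x (\<lambda>x y t. (cmod (A_star x y t + \<epsilon> *\<^sub>R B x y t))\<^sup>2) x y t
      = - 2 * (sech x)\<^sup>2 * tanh x + 2 * \<epsilon> * partial_x u x y t + \<epsilon>\<^sup>2 * partial_x v x y t" for \<epsilon>
  proof (rule partial_x_eq)
    have "((\<lambda>x. (sech x)\<^sup>2 + 2 * \<epsilon> * u x y t + \<epsilon>\<^sup>2 * v x y t) has_real_derivative
        - 2 * (sech x)\<^sup>2 * tanh x + 2 * \<epsilon> * partial_x u x y t + \<epsilon>\<^sup>2 * partial_x v x y t) (at x)"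
      by (intro DERIV_add DERIV_cmult s u v)
    then show "((\<lambda>s. (cmod (A_star s y t + \<epsilon> *\<^sub>R B s y t))\<^sup>2) has_vector_derivative
        - 2 * (sech x)\<^sup>2 * tanh x + 2 * \<epsilon> * partial_x u x y t + \<epsilon>\<^sup>2 * partial_x v x y t) (at x)"
      unfolding cmod_sq_perturbation u_def v_def has_real_derivative_iff_has_vector_derivative .
  qed
  have L: "linDS2 \<gamma>\<^sub>3 B \<phi> x y t = \<gamma>\<^sub>3 * partial_x (partial_x \<phi>) x y t + partial_y (partial_y \<phi>) x y t
    - 2 * \<gamma>\<^sub>3 * partial_x u x y t"
    unfolding linDS2_def u_def[abs_def] ..
  show ?thesis
  proof (rule cubic_derivative_at_0)
    fix \<epsilon> :: real
    show "DS2 \<gamma>\<^sub>3 (\<lambda>x y t. A_star x y t + \<epsilon> *\<^sub>R B x y t) (\<lambda>x y t. \<phi>_star x y t + \<epsilon> *\<^sub>R \<phi> x y t) x y t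
      = 0 + \<epsilon> *\<^sub>R linDS2 \<gamma>\<^sub>3 B \<phi> x y t + \<epsilon>\<^sup>2 *\<^sub>R (- \<gamma>\<^sub>3 * partial_x v x y t) + \<epsilon> ^ 3 *\<^sub>R 0"
      unfolding L DS2_def m
      by (simp only: partial_add_scaleR class_C2_imp[OF assms(2)] star_partially_differentiable)
         (simp add: \<phi>_star_partials(2,4) algebra_simps)
  qed
qed

end

theory Submission
  imports Defs "HOL-Real_Asymp.Real_Asymp"
begin

text \<open>The growing mode is even in \<open>x\<close> and bifurcates from the phase mode \<open>sech\<close>. With transverse wave number
  \<open>\<omega> = lam \<sigma>\<close> and \<open>\<kappa> = \<omega> / sqrt \<gamma>\<^sub>3\<close> the second equation is solved for \<open>\<phi>\<^sub>x\<close> by convolution with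
  \<open>exp (- \<kappa> \<bar>x\<bar>)\<close>, and \<open>A = (lam U + \<i> (sech + lam Z)) cos (\<omega> y)\<close> leads to
  \<open>U'' - U + 6 sech\<^sup>2 U = sech + O(lam)\<close> and \<open>Z'' - Z + 2 sech\<^sup>2 Z = lam (- U + \<sigma>\<^sup>2 (sech + lam Z))\<close>.
  On even decaying functions the first operator is invertible, while the second requires its right-hand side to
  be orthogonal to \<open>sech\<close>. Both are inverted by variation of constants on the half-line, the system is solved by
  contraction for each \<open>\<sigma>\<close>, and the intermediate value theorem provides a \<open>\<sigma>\<close> near \<open>1/2\<close> at which the
  orthogonality condition holds.\<close>

section \<open>Variation of constants on the half-line\<close>

text \<open>The Green function of the equation for \<phi> has size \<open>1 / \<kappa>\<close> with
  \<kappa> of order \<open>lam\<close>, and \<phi> decays only at rate \<kappa>; neither fits a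
  contraction in one fixed weighted space. But only \<open>\<phi>\<^sub>x\<close> enters the other
  equations, and its profile is \<open>2 lam sech U - lam \<kappa> N\<close>, where \<open>N\<close>
  is the convolution of \<open>exp (- \<kappa> \<bar>x\<bar>)\<close> with \<open>sech U\<close>.
  The singular factor has cancelled. The local part completes \<open>2 + 2 \<gamma>\<^sub>1\<close>
  to \<open>2 + 2 \<gamma>\<^sub>1 + 2 \<gamma>\<^sub>2 = 6\<close>; the rest is of relative order
  \<open>lam\<close> and occurs only as \<open>sech N\<close>, whose decay is uniform in \<kappa>.
  Orthogonality is not what makes the second operator invertible on the half-line: variation of
  constants always gives a decaying function there. It says that the derivative of this function
  vanishes at 0, so that the even reflection is differentiable. Hence the contraction can be run
  before \<sigma> is fixed. For \<open>lam = 0\<close> the function \<open>U\<close> is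
  \<open>profile\<^sub>0\<close>, and the condition equates \<sigma> squared times the half-line
  integral of \<open>sech\<^sup>2\<close>, which is 1, with that of
  \<open>sech profile\<^sub>0\<close>, which is 1/4. This is the origin of 1/2.\<close>

lemma exp_dominated_tail:
  fixes g :: "real \<Rightarrow> real"
  assumes "0 \<le> x" "0 < c" "continuous_on {0..} g" "\<And>y. y \<ge> 0 \<Longrightarrow> \<bar>g y\<bar> \<le> K * exp (- c * y)"
  shows "g integrable_on {x..}" "\<bar>integral {x..} g\<bar> \<le> K / c * exp (- c * x)"
proof -
  have e: "((\<lambda>y. K * exp (- c * y)) has_integral K * (exp (- c * x) / c)) {x..}"
    using has_integral_exp_minus_to_infinity[OF assms(2), of x]
    by (intro has_integral_mult_right) auto
  have "g absolutely_integrable_on {x..}"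
  proof (rule measurable_bounded_by_integrable_imp_absolutely_integrable)
    show "g \<in> borel_measurable (lebesgue_on {x..})"
      using assms(1,3) by (intro continuous_imp_measurable_on_sets_lebesgue)
        (auto intro: continuous_on_subset)
    show "(\<lambda>y. K * exp (- c * y)) integrable_on {x..}" using e by blast
  qed (use assms in auto)
  then show i: "g integrable_on {x..}" by (rule absolutely_integrable_on_def[THEN iffD1, THEN conjunct1])
  have "norm (integral {x..} g) \<le> integral {x..} (\<lambda>y. K * exp (- c * y))"
    using i e assms by (intro integral_norm_bound_integral) auto
  also have "\<dots> = K / c * exp (- c * x)" by (subst integral_unique[OF e]) simp
  finally show "\<bar>integral {x..} g\<bar> \<le> K / c * exp (- c * x)" by simp
qed

text \<open>The rate may have either sign: a growing integrand (\<open>c = 1 / 2\<close>) gives a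
  growing bound, a decaying one (\<open>c = - 1\<close>) a bound uniform in
  \<open>x\<close>.\<close>

lemma exp_dominated_head:
  fixes g :: "real \<Rightarrow> real"
  assumes "0 \<le> x" "c \<noteq> 0" "continuous_on {0..} g" "\<And>y. y \<ge> 0 \<Longrightarrow> \<bar>g y\<bar> \<le> K * exp (c * y)"
  shows "\<bar>integral {0..x} g\<bar> \<le> K * (exp (c * x) - 1) / c"
proof -
  have "((\<lambda>y. K * exp (c * y)) has_integral K * exp (c * x) / c - K * exp (c * 0) / c) {0..x}"
    using assms(1,2) by (intro fundamental_theorem_of_calculus)
      (auto intro!: derivative_eq_intros simp flip: has_real_derivative_iff_has_vector_derivative)
  then have e: "((\<lambda>y. K * exp (c * y)) has_integral K * (exp (c * x) - 1) / c) {0..x}"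
    by (simp add: diff_divide_distrib right_diff_distrib)
  have "norm (integral {0..x} g) \<le> integral {0..x} (\<lambda>y. K * exp (c * y))"
    using e assms by (intro integral_norm_bound_integral integrable_continuous_real continuous_intros)
      (auto intro: continuous_on_subset)
  then show ?thesis using integral_unique[OF e] by simp
qed

lemma integral_tail_eq:
  fixes g :: "real \<Rightarrow> real"
  assumes "0 \<le> x" "continuous_on {0..} g" "\<And>y. 0 \<le> y \<Longrightarrow> g integrable_on {y..}"
  shows "integral {x..} g = integral {0..} g - integral {0..x} g"
proof -
  have "{0..} = {0..x} \<union> {x..}" using assms(1) by auto
  moreover have "{0..x} \<inter> {x..} = {x}" using assms(1) by auto
  moreover have "g integrable_on {0..x}"
    using assms(2) by (intro integrable_continuous_real) (auto intro: continuous_on_subset)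
  ultimately show ?thesis using assms(1,3) by simp
qed

lemma head_has_derivative:
  fixes g :: "real \<Rightarrow> real"
  assumes "0 \<le> x" "continuous_on {0..} g"
  shows "((\<lambda>x. integral {0..x} g) has_real_derivative g x) (at x within {0..})"
proof -
  have "((\<lambda>x. integral {0..x} g) has_real_derivative g x) (at x within {0..x + 1})"
    using assms by (intro integral_has_real_derivative) (auto intro: continuous_on_subset)
  moreover have "at x within {0..x + 1} = at x within {0..}"
    by (rule at_within_nhd[of _ "{..<x + 1}"]) auto
  ultimately show ?thesis by simp
qed

lemma tail_has_derivative:
  fixes g :: "real \<Rightarrow> real"
  assumes "0 \<le> x" "continuous_on {0..} g" "\<And>y. 0 \<le> y \<Longrightarrow> g integrable_on {y..}"
  shows "((\<lambda>x. integral {x..} g) has_real_derivative - g x) (at x within {0..})"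
proof -
  have "((\<lambda>x. integral {0..} g - integral {0..x} g) has_real_derivative - g x) (at x within {0..})"
    using head_has_derivative[OF assms(1,2)] by (auto intro!: derivative_eq_intros)
  then show ?thesis
  proof (rule has_field_derivative_transform_within[where d = 1])
    show "integral {0..} g - integral {0..y} g = integral {y..} g" if "y \<in> {0..}" for y
      using that by (intro integral_tail_eq[symmetric] assms) auto
  qed (use assms(1) in simp_all)
qed

text \<open>The tail integral tends to 0, so the fundamental theorem on \<open>{0..x}\<close> passes
  to the limit. It serves to evaluate the pairings with \<open>sech\<close> from explicit
  primitives.\<close>

lemma improper_ftc:
  fixes g G :: "real \<Rightarrow> real"
  assumes "0 < c" "continuous_on {0..} g" "\<And>y. y \<ge> 0 \<Longrightarrow> \<bar>g y\<bar> \<le> K * exp (- c * y)"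
    "\<And>y. (G has_real_derivative g y) (at y)" "(G \<longlongrightarrow> l) at_top"
  shows "integral {0..} g = l - G 0"
proof -
  note i = exp_dominated_tail[OF _ assms(1-3)]
  have G: "integral {0..} g = G x - G 0 + integral {x..} g" if "0 \<le> x" for x
  proof -
    have "(g has_integral G x - G 0) {0..x}"
      using that assms(4) by (intro fundamental_theorem_of_calculus)
        (auto intro: has_field_derivative_at_within simp flip: has_real_derivative_iff_has_vector_derivative)
    then show ?thesis using integral_tail_eq[OF that assms(2) i(1)] by (simp add: integral_unique)
  qed
  have "((\<lambda>x. K / c * exp (- c * x)) \<longlongrightarrow> 0) at_top"
    using assms(1) by real_asymp
  then have "((\<lambda>x. integral {x..} g) \<longlongrightarrow> 0) at_top"
    by (rule Lim_null_comparison[rotated]) (use i(2) in \<open>auto intro: eventually_at_top_linorderI[of 0]\<close>)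
  then have "((\<lambda>x. G x - G 0 + integral {x..} g) \<longlongrightarrow> l - G 0 + 0) at_top"
    using assms(5) by (intro tendsto_intros)
  then have "((\<lambda>x::real. integral {0..} g) \<longlongrightarrow> l - G 0 + 0) at_top"
    by (rule Lim_transform_eventually) (rule eventually_at_top_linorderI[of 0], simp add: G)
  then show ?thesis by (simp add: tendsto_const_iff)
qed

text \<open>With \<open>r = p\<close> and \<open>s = q\<close> this is variation of constants on the half-line, \<open>p\<close> being the
  homogeneous solution that decays. The derivative is again of this form, with \<open>p'\<close> and \<open>q'\<close> in the place of
  \<open>r\<close> and \<open>s\<close>.\<close>

definition green :: "(real \<Rightarrow> real) \<Rightarrow> (real \<Rightarrow> real) \<Rightarrow> (real \<Rightarrow> real) \<Rightarrow> (real \<Rightarrow> real) \<Rightarrow> (real \<Rightarrow> real) \<Rightarrow> real \<Rightarrow> real"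
  where "green r s p q f x =
    r x * integral {0..x} (\<lambda>y. q y * f y) + s x * integral {x..} (\<lambda>y. p y * f y)"

text \<open>The moving endpoints contribute \<open>(r q - s p) f\<close>. This vanishes for
  \<open>(r, s) = (p, q)\<close> and is minus the Wronskian times \<open>f\<close> for
  \<open>(r, s) = (p', q')\<close>, so one statement yields both the first and the second
  derivative.\<close>

lemma green_has_derivative:
  assumes "0 \<le> x" "continuous_on {0..} f" "continuous_on {0..} p" "continuous_on {0..} q"
    and "\<And>y. 0 \<le> y \<Longrightarrow> (\<lambda>y. p y * f y) integrable_on {y..}"
    and "(r has_real_derivative r' x) (at x)" "(s has_real_derivative s' x) (at x)"
  shows "(green r s p q f has_real_derivative green r' s' p q f x + (r x * q x - s x * p x) * f x)
    (at x within {0..})"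
proof -
  note d = has_field_derivative_at_within
  have qf: "((\<lambda>x. integral {0..x} (\<lambda>y. q y * f y)) has_real_derivative q x * f x) (at x within {0..})"
    using assms by (intro head_has_derivative continuous_intros)
  have pf: "((\<lambda>x. integral {x..} (\<lambda>y. p y * f y)) has_real_derivative - (p x * f x)) (at x within {0..})"
    using assms by (intro tail_has_derivative continuous_intros)
  show ?thesis
    unfolding green_def[abs_def]
    by (rule DERIV_cong[OF DERIV_add[OF DERIV_mult[OF d[OF assms(6)] qf] DERIV_mult[OF d[OF assms(7)] pf]]])
      (simp add: algebra_simps)
qed

lemma green_add:
  assumes "0 \<le> x" "continuous_on {0..} f" "continuous_on {0..} g" "continuous_on {0..} q"
    and "(\<lambda>y. p y * f y) integrable_on {x..}" "(\<lambda>y. p y * g y) integrable_on {x..}"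
  shows "green r s p q (\<lambda>x. a * f x + b * g x) x = a * green r s p q f x + b * green r s p q g x"
proof -
  have 1: "integral {x..} (\<lambda>y. p y * (a * f y + b * g y))
      = a * integral {x..} (\<lambda>y. p y * f y) + b * integral {x..} (\<lambda>y. p y * g y)"
    using assms by (simp add: integral_add integrable_on_mult_right distrib_left mult.left_commute)
  have "(\<lambda>y. q y * h y) integrable_on {0..x}" if "continuous_on {0..} h" for h
    using that assms by (intro integrable_continuous_real continuous_intros)
      (auto intro: continuous_on_subset)
  then have 2: "integral {0..x} (\<lambda>y. q y * (a * f y + b * g y))
      = a * integral {0..x} (\<lambda>y. q y * f y) + b * integral {0..x} (\<lambda>y. q y * g y)"
    using assms by (simp add: integral_add integrable_on_mult_right distrib_left mult.left_commute)
  show ?thesis unfolding green_def 1 2 by (simp add: algebra_simps)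
qed

text \<open>Even reflection turns \<open>F'\<close> into an odd function and \<open>F''\<close> into
  an even one. The two halves match at 0 exactly because \<open>F' 0 = 0\<close>; for the second
  operator this is where the solvability condition is spent.\<close>

lemma has_derivative_even_extension:
  fixes F F' F'' :: "real \<Rightarrow> real"
  assumes 1: "\<And>x. 0 \<le> x \<Longrightarrow> (F has_real_derivative F' x) (at x within {0..})"
    and 2: "\<And>x. 0 \<le> x \<Longrightarrow> (F' has_real_derivative F'' x) (at x within {0..})"
    and 0: "F' 0 = 0"
  shows "((\<lambda>x. F \<bar>x\<bar>) has_real_derivative sgn x * F' \<bar>x\<bar>) (at x)"
    "((\<lambda>x. sgn x * F' \<bar>x\<bar>) has_real_derivative F'' \<bar>x\<bar>) (at x)"
proof -
  have pos: "(H has_real_derivative D) (at x)"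
    if "(h has_real_derivative D) (at x within {0..})" "0 < x" "\<And>y. 0 < y \<Longrightarrow> h y = H y" for h H D x
  proof -
    have "at x within {0..} = at x" using that(2) by (intro at_within_interior) simp
    with that(1) have "(h has_real_derivative D) (at x)" by simp
    then show ?thesis
      by (rule has_field_derivative_transform_within_open[of _ _ _ "{0<..}"]) (use that in auto)
  qed
  have neg: "(H has_real_derivative - D) (at x)"
    if "(h has_real_derivative D) (at (- x) within {0..})" "x < 0" "\<And>y. y < 0 \<Longrightarrow> h (- y) = H y" for h H D x
  proof -
    have "(h has_real_derivative D) (at (- x))" using that(1,2) by (intro pos) auto
    then have "((\<lambda>x. h (- x)) has_real_derivative - D) (at x)"
      by (simp add: DERIV_mirror)
    then show ?thesis
      by (rule has_field_derivative_transform_within_open[of _ _ _ "{..<0}"]) (use that in auto)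
  qed
  \<comment> \<open>Here \<open>c\<close> is the parity of the reflected function. The derivative
    from the left is \<open>- c * D\<close>, so \<open>c * D = - D\<close> is the matching
    condition: it forces \<open>D = 0\<close> for \<open>c = 1\<close> and is automatic for
    \<open>c = - 1\<close>, where the hypotheses at \<open>y = 0\<close> force
    \<open>h 0 = 0\<close> instead.\<close>
  have zero: "(H has_real_derivative D) (at 0)"
    if "(h has_real_derivative D) (at 0 within {0..})" "\<And>y. 0 \<le> y \<Longrightarrow> H y = h y"
      "\<And>y. y \<le> 0 \<Longrightarrow> H y = c * h (- y)" "c * D = - D" for h H D c
  proof -
    have r: "(H has_real_derivative D) (at 0 within {0..})"
      by (rule has_field_derivative_transform_within[OF that(1), of 1]) (use that in auto)
    have "((\<lambda>x. c * h (- x)) has_real_derivative D) (at 0 within {..0})"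
    proof -
      have "(h \<circ> uminus has_real_derivative D * - 1) (at 0 within {..0})"
        by (rule DERIV_image_chain) (use that(1) in \<open>auto intro!: derivative_eq_intros\<close>)
      then have "((\<lambda>x. c * (h \<circ> uminus) x) has_real_derivative c * (D * -1)) (at 0 within {..0})"
        by (rule DERIV_cmult)
      then show ?thesis using that(4) by (simp add: o_def)
    qed
    then have l: "(H has_real_derivative D) (at 0 within {..0})"
      by (rule has_field_derivative_transform_within[of _ _ _ _ 1]) (use that in auto)
    have "(H has_real_derivative D) (at 0 within {..0} \<union> {0..})"
      using l r unfolding has_field_derivative_iff by (simp add: Lim_Un)
    moreover have "{..0} \<union> {0..} = (UNIV::real set)" by auto
    ultimately show ?thesis by simp
  qed
  consider "0 < x" | "x < 0" | "x = 0" by linarith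
  then show "((\<lambda>x. F \<bar>x\<bar>) has_real_derivative sgn x * F' \<bar>x\<bar>) (at x)"
  proof cases
    case 1 show ?thesis using pos[OF assms(1)[of x], of "\<lambda>x. F \<bar>x\<bar>"] 1 by simp
  next
    case 2 show ?thesis using neg[OF assms(1)[of "- x"], of "\<lambda>x. F \<bar>x\<bar>"] 2 by simp
  next
    case 3 show ?thesis using zero[OF assms(1)[of 0], of "\<lambda>x. F \<bar>x\<bar>" 1] 0 3 by simp
  qed
  consider "0 < x" | "x < 0" | "x = 0" by linarith
  then show "((\<lambda>x. sgn x * F' \<bar>x\<bar>) has_real_derivative F'' \<bar>x\<bar>) (at x)"
  proof cases
    case 1 show ?thesis using pos[OF assms(2)[of x], of "\<lambda>x. sgn x * F' \<bar>x\<bar>"] 1 by simp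
  next
    case 2
    then show ?thesis using neg[OF DERIV_minus[OF assms(2)[of "- x"]], of "\<lambda>x. sgn x * F' \<bar>x\<bar>"] by simp
  next
    case 3
    show ?thesis using zero[OF assms(2)[of 0], of "\<lambda>x. sgn x * F' \<bar>x\<bar>" "- 1"] 0 3
      by (auto simp: sgn_if)
  qed
qed

section \<open>A coupled linear system with a solvability condition\<close>

text \<open>The factor 2 is \<open>1 / (1 - 1/2)\<close>. The last estimate has two uses: with
  \<open>v\<close> a fixed point for another parameter it gives continuity, and with
  \<open>v\<close> the unperturbed solution it measures the effect of the perturbation.\<close>

lemma param_fixed_point:
  fixes \<Phi> :: "real \<Rightarrow> 'a::{real_normed_vector, complete_space} \<Rightarrow> 'a"
  assumes contr: "\<And>s v w. s \<in> S \<Longrightarrow> norm (\<Phi> s v - \<Phi> s w) \<le> norm (v - w) / 2"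
    and cont: "\<And>w. continuous_on S (\<lambda>s. \<Phi> s w)"
  obtains w where "\<And>s. s \<in> S \<Longrightarrow> \<Phi> s (w s) = w s" "continuous_on S w"
    "\<And>s v. s \<in> S \<Longrightarrow> norm (w s - v) \<le> 2 * norm (\<Phi> s v - v)"
proof -
  have "\<exists>!w. \<Phi> s w = w" if "s \<in> S" for s
    using contr[OF that] by (intro banach_fix_type[of "1/2"]) (auto simp: dist_norm)
  then obtain w where w: "\<And>s. s \<in> S \<Longrightarrow> \<Phi> s (w s) = w s" by metis
  have near: "norm (w s - v) \<le> 2 * norm (\<Phi> s v - v)" if "s \<in> S" for s v
  proof -
    have "norm (w s - v) \<le> norm (\<Phi> s (w s) - \<Phi> s v) + norm (\<Phi> s v - v)"
      using norm_triangle_ineq[of "\<Phi> s (w s) - \<Phi> s v" "\<Phi> s v - v"] w[OF that] by simp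
    then show ?thesis using contr[OF that, of "w s" v] by simp
  qed
  moreover have "continuous_on S w"
    unfolding continuous_on_def
  proof
    fix s assume s: "s \<in> S"
    have "((\<lambda>t. \<Phi> t (w s)) \<longlongrightarrow> \<Phi> s (w s)) (at s within S)"
      using cont s by (simp add: continuous_on_def)
    then have "((\<lambda>t. 2 * norm (\<Phi> t (w s) - w s)) \<longlongrightarrow> 2 * norm (\<Phi> s (w s) - w s)) (at s within S)"
      by (intro tendsto_intros)
    then have "((\<lambda>t. 2 * norm (\<Phi> t (w s) - w s)) \<longlongrightarrow> 0) (at s within S)"
      using w[OF s] by simp
    then have "((\<lambda>t. w t - w s) \<longlongrightarrow> 0) (at s within S)"
      by (rule Lim_null_comparison[rotated]) (auto simp: eventually_at_filter near)
    then show "(w \<longlongrightarrow> w s) (at s within S)" by (rule LIM_zero_cancel)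
  qed
  ultimately show thesis using w that by blast
qed

text \<open>The abstract form of the bifurcation argument: the coupled linear equations are solved by
  contraction for every \<open>\<sigma>\<close> in an interval around \<open>1/2\<close>, and \<open>\<sigma>\<close> is then determined from the scalar
  solvability condition, which for \<open>\<lambda> = 0\<close> reads \<open>\<sigma>\<^sup>2 = 1/4\<close>.\<close>

lemma coupled_system_solvable:
  fixes G H :: "'a::{real_normed_vector, complete_space} \<Rightarrow> 'a" and M :: "real \<Rightarrow> 'a \<Rightarrow> 'a"
    and L :: "'a \<Rightarrow> real"
  assumes G: "bounded_linear G" and H: "bounded_linear H" and l: "bounded_linear L"
    and M: "\<And>\<kappa>. 0 \<le> \<kappa> \<Longrightarrow> \<kappa> \<le> \<kappa>\<^sub>0 \<Longrightarrow> linear (M \<kappa>)"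
    and M_bound: "\<And>\<kappa> w. 0 \<le> \<kappa> \<Longrightarrow> \<kappa> \<le> \<kappa>\<^sub>0 \<Longrightarrow> norm (M \<kappa> w) \<le> C * norm w"
    and M_cont: "\<And>w. continuous_on {0..\<kappa>\<^sub>0} (\<lambda>\<kappa>. M \<kappa> w)"
    and "0 < \<kappa>\<^sub>0" "0 < d" "L s = 1" "L u\<^sub>0 = 1 / 4"
  shows "\<exists>lam\<^sub>0>0. \<forall>lam. 0 < lam \<and> lam < lam\<^sub>0 \<longrightarrow> (\<exists>\<sigma> u z. 1 / 4 \<le> \<sigma> \<and> \<sigma> \<le> 1 \<and> lam * \<sigma> * d \<le> \<kappa>\<^sub>0 \<and>
      u = u\<^sub>0 - lam *\<^sub>R G (z + (lam * \<sigma>\<^sup>2) *\<^sub>R u + (c * \<sigma>) *\<^sub>R M (lam * \<sigma> * d) u) \<and>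
      z = - lam *\<^sub>R H (- u + \<sigma>\<^sup>2 *\<^sub>R (s + lam *\<^sub>R z)) \<and>
      L (- u + \<sigma>\<^sup>2 *\<^sub>R (s + lam *\<^sub>R z)) = 0)"
proof -
  obtain KG where KG: "0 \<le> KG" "\<And>x. norm (G x) \<le> KG * norm x"
    using bounded_linear.nonneg_bounded[OF G] by (auto simp: mult.commute)
  obtain KH where KH: "0 \<le> KH" "\<And>x. norm (H x) \<le> KH * norm x"
    using bounded_linear.nonneg_bounded[OF H] by (auto simp: mult.commute)
  obtain Kl where Kl: "0 \<le> Kl" "\<And>x. \<bar>L x\<bar> \<le> Kl * norm x"
    using bounded_linear.nonneg_bounded[OF l] by (auto simp: mult.commute)
  define C' where "C' = max C 0"
  have C': "0 \<le> C'" and M_bound': "0 \<le> \<kappa> \<Longrightarrow> \<kappa> \<le> \<kappa>\<^sub>0 \<Longrightarrow> norm (M \<kappa> w) \<le> C' * norm w" for \<kappa> w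
    using M_bound[of \<kappa> w] mult_right_mono[of C C' "norm w"] by (auto simp: C'_def)
  \<comment> \<open>Each constant is a bound with one factor \<open>lam\<close> removed:
    \<open>lam * K\<close> is a Lipschitz constant of the fixed-point map, \<open>lam * B\<close>
    bounds how far the map moves \<open>(u\<^sub>0, 0)\<close>, and \<open>lam * D\<close> the
    resulting error in the scalar condition. The entries of \<open>lam\<^sub>0\<close> give, in
    turn, \<open>lam \<le> 1\<close>, an admissible \<kappa>, the contraction factor 1/2 and the
    error 1/8; adding 1 avoids division by zero.\<close>
  define K where "K = KG * (2 + \<bar>c\<bar> * C') + 2 * KH"
  define B where "B = KG * (1 + 1 + \<bar>c\<bar> * C') * norm u\<^sub>0 + KH * (norm u\<^sub>0 + norm s)"
  define D where "D = Kl * (2 * B) + Kl * (2 * B)"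
  have K: "0 \<le> K" unfolding K_def using KG KH C' by simp
  have B: "0 \<le> B" unfolding B_def using KG KH C' by simp
  have D: "0 \<le> D" unfolding D_def using Kl B by simp
  define lam\<^sub>0 where "lam\<^sub>0 = Min {1, \<kappa>\<^sub>0 / d, 1 / (2 * (K + 1)), 1 / (8 * (D + 1))}"
  have "0 < lam\<^sub>0" using K D assms unfolding lam\<^sub>0_def by simp
  moreover {
    fix lam :: real assume lam: "0 < lam" "lam < lam\<^sub>0"
    then have lam1: "lam \<le> 1" and "lam \<le> \<kappa>\<^sub>0 / d" "lam \<le> 1 / (2 * (K + 1))" "lam \<le> 1 / (8 * (D + 1))"
      unfolding lam\<^sub>0_def by auto
    then have lamd: "lam * d \<le> \<kappa>\<^sub>0" and "lam * (2 * (K + 1)) \<le> 1" and "lam * (8 * (D + 1)) \<le> 1"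
      using K D \<open>0 < d\<close> by (simp_all add: field_simps)
    then have lamK: "lam * K \<le> 1 / 2" and lamD: "lam * D \<le> 1 / 8"
      using lam by (simp_all add: algebra_simps)
    define f where "f \<sigma> w = snd w + (lam * \<sigma>\<^sup>2) *\<^sub>R fst w + (c * \<sigma>) *\<^sub>R M (lam * \<sigma> * d) (fst w)" for \<sigma> and w :: "'a \<times> 'a"
    define g where "g \<sigma> w = - fst w + \<sigma>\<^sup>2 *\<^sub>R (s + lam *\<^sub>R snd w)" for \<sigma> and w :: "'a \<times> 'a"
    define \<Phi> where "\<Phi> \<sigma> w = (u\<^sub>0 - lam *\<^sub>R G (f \<sigma> w), - lam *\<^sub>R H (g \<sigma> w))" for \<sigma> w
    have kap: "0 \<le> lam * \<sigma> * d" "lam * \<sigma> * d \<le> \<kappa>\<^sub>0" if "\<sigma> \<in> {1/4..1}" for \<sigma>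
    proof -
      have "\<sigma> * (lam * d) \<le> 1 * (lam * d)" using that lam \<open>0 < d\<close> by (intro mult_right_mono) auto
      then show "lam * \<sigma> * d \<le> \<kappa>\<^sub>0" using lamd by (simp add: mult_ac)
      show "0 \<le> lam * \<sigma> * d" using that lam \<open>0 < d\<close> by simp
    qed
    have sq: "0 \<le> \<sigma>\<^sup>2" "\<sigma>\<^sup>2 \<le> 1" if "\<sigma> \<in> {1/4..1}" for \<sigma> :: real
      using that by (auto intro: power_le_one)
    have norm_f: "norm (z + (lam * \<sigma>\<^sup>2) *\<^sub>R u + (c * \<sigma>) *\<^sub>R M (lam * \<sigma> * d) u) \<le> norm z + (1 + \<bar>c\<bar> * C') * norm u"
      if "\<sigma> \<in> {1/4..1}" for \<sigma> u z
    proof -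
      have "norm ((lam * \<sigma>\<^sup>2) *\<^sub>R u) \<le> 1 * norm u"
        unfolding norm_scaleR using mult_mono[OF lam1 sq(2)[OF that] _ sq(1)[OF that]] lam sq(1)[OF that]
        by (intro mult_right_mono) auto
      moreover have "norm ((c * \<sigma>) *\<^sub>R M (lam * \<sigma> * d) u) \<le> (\<bar>c\<bar> * 1) * (C' * norm u)"
        using that M_bound'[OF kap[OF that], of u] unfolding norm_scaleR abs_mult
        by (intro mult_mono) auto
      ultimately show ?thesis
        using norm_triangle_ineq[of "z + (lam * \<sigma>\<^sup>2) *\<^sub>R u" "(c * \<sigma>) *\<^sub>R M (lam * \<sigma> * d) u"]
          norm_triangle_ineq[of z "(lam * \<sigma>\<^sup>2) *\<^sub>R u"] by (simp add: distrib_right mult.assoc)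
    qed
    obtain w where w: "\<And>\<sigma>. \<sigma> \<in> {1/4..1} \<Longrightarrow> \<Phi> \<sigma> (w \<sigma>) = w \<sigma>" "continuous_on {1/4..1} w"
      "\<And>\<sigma> v. \<sigma> \<in> {1/4..1} \<Longrightarrow> norm (w \<sigma> - v) \<le> 2 * norm (\<Phi> \<sigma> v - v)"
    proof (rule param_fixed_point[of "{1/4..1}" \<Phi>])
      fix \<sigma> :: real and v w :: "'a \<times> 'a"
      assume \<sigma>: "\<sigma> \<in> {1/4..1}"
      have fst: "norm (fst (v - w)) \<le> norm (v - w)" and snd: "norm (snd (v - w)) \<le> norm (v - w)"
        using norm_fst_le[of "fst (v - w)" "snd (v - w)"] norm_snd_le[of "snd (v - w)" "fst (v - w)"]
        unfolding prod.collapse .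
      have "norm (f \<sigma> v - f \<sigma> w) \<le> norm (snd (v - w)) + (1 + \<bar>c\<bar> * C') * norm (fst (v - w))"
      proof -
        have "f \<sigma> v - f \<sigma> w = snd (v - w) + (lam * \<sigma>\<^sup>2) *\<^sub>R fst (v - w) + (c * \<sigma>) *\<^sub>R M (lam * \<sigma> * d) (fst (v - w))"
          unfolding f_def fst_diff snd_diff linear_diff[OF M[OF kap[OF \<sigma>]]]
          by (simp only: scaleR_diff_right) simp
        then show ?thesis using norm_f[OF \<sigma>, of "snd (v - w)" "fst (v - w)"] by simp
      qed
      also have "\<dots> \<le> norm (v - w) + (1 + \<bar>c\<bar> * C') * norm (v - w)"
        using fst snd C' by (intro add_mono mult_left_mono) auto
      finally have f: "norm (f \<sigma> v - f \<sigma> w) \<le> (2 + \<bar>c\<bar> * C') * norm (v - w)"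
        by (simp add: algebra_simps)
      have "norm ((\<sigma>\<^sup>2 * lam) *\<^sub>R snd (v - w)) \<le> 1 * norm (snd (v - w))"
        using mult_mono[OF sq(2)[OF \<sigma>] lam1] lam sq[OF \<sigma>] unfolding norm_scaleR by (intro mult_right_mono) auto
      then have "norm (- fst (v - w) + (\<sigma>\<^sup>2 * lam) *\<^sub>R snd (v - w)) \<le> 2 * norm (v - w)"
        using norm_triangle_ineq[of "- fst (v - w)" "(\<sigma>\<^sup>2 * lam) *\<^sub>R snd (v - w)"] fst snd
        unfolding norm_minus_cancel by linarith
      moreover have "g \<sigma> v - g \<sigma> w = - fst (v - w) + (\<sigma>\<^sup>2 * lam) *\<^sub>R snd (v - w)"
        by (simp add: g_def algebra_simps)
      ultimately have g: "norm (g \<sigma> v - g \<sigma> w) \<le> 2 * norm (v - w)" by simp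
      have "\<Phi> \<sigma> v - \<Phi> \<sigma> w = (- (lam *\<^sub>R G (f \<sigma> v - f \<sigma> w)), - (lam *\<^sub>R H (g \<sigma> v - g \<sigma> w)))"
        by (simp add: \<Phi>_def linear_diff bounded_linear.linear[OF G] bounded_linear.linear[OF H] scaleR_diff_right)
      then have "norm (\<Phi> \<sigma> v - \<Phi> \<sigma> w) \<le> lam * norm (G (f \<sigma> v - f \<sigma> w)) + lam * norm (H (g \<sigma> v - g \<sigma> w))"
        using norm_Pair_le[of "- (lam *\<^sub>R G (f \<sigma> v - f \<sigma> w))" "- (lam *\<^sub>R H (g \<sigma> v - g \<sigma> w))"] lam by simp
      also have "\<dots> \<le> lam * (KG * ((2 + \<bar>c\<bar> * C') * norm (v - w))) + lam * (KH * (2 * norm (v - w)))"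
        using lam f g KG(1) KH(1)
        by (intro add_mono mult_left_mono order_trans[OF KG(2)] order_trans[OF KH(2)]) auto
      also have "\<dots> = (lam * K) * norm (v - w)" by (simp add: K_def algebra_simps)
      also have "\<dots> \<le> 1 / 2 * norm (v - w)" using lamK by (intro mult_right_mono) auto
      finally show "norm (\<Phi> \<sigma> v - \<Phi> \<sigma> w) \<le> norm (v - w) / 2" by simp
    next
      fix w :: "'a \<times> 'a"
      have m: "continuous_on {1/4..1} (\<lambda>\<sigma>. M (lam * \<sigma> * d) (fst w))"
        by (rule continuous_on_compose2[OF M_cont]) (use kap in \<open>auto intro!: continuous_intros\<close>)
      show "continuous_on {1/4..1} (\<lambda>\<sigma>. \<Phi> \<sigma> w)"
        unfolding \<Phi>_def f_def g_def
        by (intro continuous_intros bounded_linear.continuous_on[OF G] bounded_linear.continuous_on[OF H] m)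
    qed (use that in blast)
    \<comment> \<open>The solvability condition as a function of \<sigma>. For
      \<open>lam = 0\<close> the fixed point would be \<open>(u\<^sub>0, 0)\<close> and the value
      \<open>\<sigma>\<^sup>2 - 1 / 4\<close>.\<close>
    define F where "F \<sigma> = L (g \<sigma> (w \<sigma>))" for \<sigma>
    have F_cont: "continuous_on {1/4..1} F"
      unfolding F_def g_def by (intro continuous_intros bounded_linear.continuous_on[OF l] w(2))
    have F_close: "\<bar>F \<sigma> - (\<sigma>\<^sup>2 - 1 / 4)\<bar> \<le> 1 / 8" if \<sigma>: "\<sigma> \<in> {1/4..1}" for \<sigma>
    proof -
      have "\<Phi> \<sigma> (u\<^sub>0, 0) - (u\<^sub>0, 0) = (- (lam *\<^sub>R G (f \<sigma> (u\<^sub>0, 0))), - (lam *\<^sub>R H (g \<sigma> (u\<^sub>0, 0))))"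
        by (simp add: \<Phi>_def)
      then have "norm (\<Phi> \<sigma> (u\<^sub>0, 0) - (u\<^sub>0, 0)) \<le> lam * norm (G (f \<sigma> (u\<^sub>0, 0))) + lam * norm (H (g \<sigma> (u\<^sub>0, 0)))"
        using norm_Pair_le[of "- (lam *\<^sub>R G (f \<sigma> (u\<^sub>0, 0)))" "- (lam *\<^sub>R H (g \<sigma> (u\<^sub>0, 0)))"] lam by simp
      also have "\<dots> \<le> lam * (KG * ((1 + 1 + \<bar>c\<bar> * C') * norm u\<^sub>0)) + lam * (KH * (norm u\<^sub>0 + norm s))"
      proof -
        have "norm (f \<sigma> (u\<^sub>0, 0)) \<le> (1 + \<bar>c\<bar> * C') * norm u\<^sub>0"
          using norm_f[OF \<sigma>, of 0 u\<^sub>0] by (simp add: f_def)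
        also have "\<dots> \<le> (1 + 1 + \<bar>c\<bar> * C') * norm u\<^sub>0" by (intro mult_right_mono) auto
        finally have "norm (f \<sigma> (u\<^sub>0, 0)) \<le> (1 + 1 + \<bar>c\<bar> * C') * norm u\<^sub>0" .
        moreover have "norm (g \<sigma> (u\<^sub>0, 0)) \<le> norm u\<^sub>0 + norm s"
          using norm_triangle_ineq[of "- u\<^sub>0" "\<sigma>\<^sup>2 *\<^sub>R s"] sq[OF \<sigma>] mult_right_mono[of "\<sigma>\<^sup>2" 1 "norm s"]
          by (simp add: g_def)
        ultimately show ?thesis using lam KG(1) KH(1)
          by (intro add_mono mult_left_mono order_trans[OF KG(2)] order_trans[OF KH(2)]) auto
      qed
      also have "\<dots> = lam * B" by (simp add: B_def algebra_simps)
      finally have "norm (w \<sigma> - (u\<^sub>0, 0)) \<le> lam * (2 * B)" using w(3)[OF \<sigma>, of "(u\<^sub>0, 0)"] by simp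
      then have fst: "norm (fst (w \<sigma>) - u\<^sub>0) \<le> lam * (2 * B)" and snd: "norm (snd (w \<sigma>)) \<le> lam * (2 * B)"
        using norm_fst_le[of "fst (w \<sigma>) - u\<^sub>0" "snd (w \<sigma>)"] norm_snd_le[of "snd (w \<sigma>)" "fst (w \<sigma>) - u\<^sub>0"]
        by (simp_all add: minus_prod_def)
      have "F \<sigma> - (\<sigma>\<^sup>2 - 1 / 4) = - L (fst (w \<sigma>) - u\<^sub>0) + \<sigma>\<^sup>2 * (lam * L (snd (w \<sigma>)))"
        using bounded_linear.linear[OF l] \<open>L s = 1\<close> \<open>L u\<^sub>0 = 1 / 4\<close>
        by (simp add: F_def g_def linear_diff linear_add linear_neg linear_scale algebra_simps)
      then have "\<bar>F \<sigma> - (\<sigma>\<^sup>2 - 1 / 4)\<bar> \<le> \<bar>L (fst (w \<sigma>) - u\<^sub>0)\<bar> + \<sigma>\<^sup>2 * lam * \<bar>L (snd (w \<sigma>))\<bar>"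
        using lam abs_triangle_ineq[of "- L (fst (w \<sigma>) - u\<^sub>0)" "\<sigma>\<^sup>2 * (lam * L (snd (w \<sigma>)))"]
        by (simp add: abs_mult)
      also have "\<dots> \<le> Kl * (lam * (2 * B)) + 1 * (Kl * (lam * (2 * B)))"
        using mult_mono[OF sq(2)[OF \<sigma>] lam1] lam Kl(1) fst snd
        by (intro add_mono mult_mono order_trans[OF Kl(2)] mult_left_mono) auto
      also have "\<dots> = lam * D" by (simp add: D_def algebra_simps)
      finally show ?thesis using lamD by simp
    qed
    \<comment> \<open>At the endpoints the unperturbed condition takes the values -3/16 and 3/4.
      Both exceed the error 1/8 in modulus, so the sign change survives.\<close>
    have "\<bar>F (1/4) - (1/16 - 1/4)\<bar> \<le> 1/8" "\<bar>F 1 - (1 - 1/4)\<bar> \<le> 1/8"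
      using F_close[of "1/4"] F_close[of 1] by (simp_all add: power2_eq_square)
    then have "F (1/4) \<le> 0" "0 \<le> F 1" unfolding abs_le_iff by linarith+
    then obtain \<sigma> where \<sigma>: "1/4 \<le> \<sigma>" "\<sigma> \<le> 1" "F \<sigma> = 0"
      using IVT'[of F "1/4" 0 1] F_cont by auto
    have "\<Phi> \<sigma> (w \<sigma>) = w \<sigma>" using w(1) \<sigma> by simp
    then have "fst (w \<sigma>) = u\<^sub>0 - lam *\<^sub>R G (f \<sigma> (w \<sigma>))" "snd (w \<sigma>) = - lam *\<^sub>R H (g \<sigma> (w \<sigma>))"
      unfolding \<Phi>_def by (metis fst_conv, metis snd_conv)
    then have "\<exists>\<sigma> u z. 1 / 4 \<le> \<sigma> \<and> \<sigma> \<le> 1 \<and> lam * \<sigma> * d \<le> \<kappa>\<^sub>0 \<and>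
      u = u\<^sub>0 - lam *\<^sub>R G (z + (lam * \<sigma>\<^sup>2) *\<^sub>R u + (c * \<sigma>) *\<^sub>R M (lam * \<sigma> * d) u) \<and>
      z = - lam *\<^sub>R H (- u + \<sigma>\<^sup>2 *\<^sub>R (s + lam *\<^sub>R z)) \<and>
      L (- u + \<sigma>\<^sup>2 *\<^sub>R (s + lam *\<^sub>R z)) = 0"
      using \<sigma> kap[of \<sigma>] unfolding F_def f_def g_def
      by (intro exI[of _ \<sigma>] exI[of _ "fst (w \<sigma>)"] exI[of _ "snd (w \<sigma>)"]) auto
  }
  ultimately show ?thesis by blast
qed

section \<open>Exponentially decaying functions\<close>

text \<open>The rate 1/2 stays below the rate 1 of the homogeneous solutions, which avoids resonant
  factors \<open>x\<close> and absorbs the one in \<open>profile\<^sub>0\<close>. It also leaves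
  room for the growth of \<open>cosh (\<kappa> * x)\<close> with \<kappa> at most 1/4.\<close>

definition half_decay :: "real \<Rightarrow> (real \<Rightarrow> real) \<Rightarrow> bool"
  where "half_decay K f \<longleftrightarrow> continuous_on {0..} f \<and> (\<forall>x\<ge>0. \<bar>f x\<bar> \<le> K * exp (- (1 / 2) * x))"

lemma half_decay_cont: "half_decay K f \<Longrightarrow> continuous_on {0..} f"
  and half_decay_bound: "half_decay K f \<Longrightarrow> 0 \<le> x \<Longrightarrow> \<bar>f x\<bar> \<le> K * exp (- (1 / 2) * x)"
  by (auto simp: half_decay_def)

lemma half_decay_nonneg: "half_decay K f \<Longrightarrow> 0 \<le> K"
  using order_trans[OF abs_ge_zero half_decay_bound[of K f 0]] by simp

lemma abs_sum_prod_le: "\<bar>a * b + c * d\<bar> \<le> \<bar>a\<bar> * \<bar>b\<bar> + \<bar>c\<bar> * \<bar>d\<bar>" for a b c d :: real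
  using abs_triangle_ineq[of "a * b" "c * d"] by (simp add: abs_mult)

lemma exp_merge: "s + t = u \<Longrightarrow> (a * exp s) * (b * exp t) = a * b * exp u" for a b s t u :: real
  by (auto simp: exp_add)

lemma half_decay_add:
  assumes "half_decay K f" "half_decay L g"
  shows "half_decay (\<bar>a\<bar> * K + \<bar>b\<bar> * L) (\<lambda>x. a * f x + b * g x)"
  unfolding half_decay_def
proof (intro conjI allI impI)
  show "continuous_on {0..} (\<lambda>x. a * f x + b * g x)"
    using assms by (intro continuous_intros half_decay_cont)
  fix x :: real assume x: "0 \<le> x"
  have "\<bar>a * f x + b * g x\<bar> \<le> \<bar>a\<bar> * \<bar>f x\<bar> + \<bar>b\<bar> * \<bar>g x\<bar>"
    by (rule abs_sum_prod_le)
  also have "\<dots> \<le> \<bar>a\<bar> * (K * exp (- (1 / 2) * x)) + \<bar>b\<bar> * (L * exp (- (1 / 2) * x))"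
    using assms x by (intro add_mono mult_left_mono half_decay_bound) auto
  finally show "\<bar>a * f x + b * g x\<bar> \<le> (\<bar>a\<bar> * K + \<bar>b\<bar> * L) * exp (- (1 / 2) * x)"
    by (simp add: algebra_simps)
qed

text \<open>Only the growth rates are assumed here, which is all that the mapping properties need;
  the differential equation enters in \<open>green_solves\<close>.\<close>

locale green_kernel =
  fixes p q :: "real \<Rightarrow> real" and P Q :: real
  assumes p_cont: "continuous_on {0..} p" and q_cont: "continuous_on {0..} q"
    and p_bound: "0 \<le> x \<Longrightarrow> \<bar>p x\<bar> \<le> P * exp (- x)" and q_bound: "0 \<le> x \<Longrightarrow> \<bar>q x\<bar> \<le> Q * exp x"
begin

lemma nonneg: "0 \<le> P" "0 \<le> Q"
  using p_bound[of 0] q_bound[of 0] by auto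

lemma pf_integrable:
  assumes "half_decay K f" "0 \<le> x"
  shows "(\<lambda>y. p y * f y) integrable_on {x..}" "\<bar>integral {x..} (\<lambda>y. p y * f y)\<bar> \<le> P * K * exp (- (3 / 2) * x)"
proof -
  have c: "continuous_on {0..} (\<lambda>y. p y * f y)"
    by (intro continuous_intros p_cont half_decay_cont[OF assms(1)])
  have b: "\<bar>p y * f y\<bar> \<le> P * K * exp (- (3 / 2) * y)" if "0 \<le> y" for y
  proof -
    have "\<bar>p y * f y\<bar> \<le> (P * exp (- y)) * (K * exp (- (1 / 2) * y))"
      unfolding abs_mult using that assms nonneg
      by (intro mult_mono p_bound half_decay_bound) auto
    also have "\<dots> = P * K * exp (- (3 / 2) * y)"
      by (rule exp_merge) simp
    finally show ?thesis .
  qed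
  show "(\<lambda>y. p y * f y) integrable_on {x..}"
    by (rule exp_dominated_tail(1)[OF assms(2) _ c b]) simp
  have "\<bar>integral {x..} (\<lambda>y. p y * f y)\<bar> \<le> P * K / (3 / 2) * exp (- (3 / 2) * x)"
    by (rule exp_dominated_tail(2)[OF assms(2) _ c b]) simp
  also have "\<dots> \<le> P * K * exp (- (3 / 2) * x)"
    using nonneg half_decay_nonneg[OF assms(1)] by (intro mult_right_mono) auto
  finally show "\<bar>integral {x..} (\<lambda>y. p y * f y)\<bar> \<le> P * K * exp (- (3 / 2) * x)" .
qed

lemma qf_bound:
  assumes "half_decay K f" "0 \<le> x"
  shows "\<bar>integral {0..x} (\<lambda>y. q y * f y)\<bar> \<le> 2 * Q * K * exp ((1 / 2) * x)"
proof -
  have c: "continuous_on {0..} (\<lambda>y. q y * f y)"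
    by (intro continuous_intros q_cont half_decay_cont[OF assms(1)])
  have b: "\<bar>q y * f y\<bar> \<le> Q * K * exp ((1 / 2) * y)" if "0 \<le> y" for y
  proof -
    have "\<bar>q y * f y\<bar> \<le> (Q * exp y) * (K * exp (- (1 / 2) * y))"
      unfolding abs_mult using that assms nonneg
      by (intro mult_mono q_bound half_decay_bound) auto
    also have "\<dots> = Q * K * exp ((1 / 2) * y)"
      by (rule exp_merge) simp
    finally show ?thesis .
  qed
  have "\<bar>integral {0..x} (\<lambda>y. q y * f y)\<bar> \<le> Q * K * (exp ((1 / 2) * x) - 1) / (1 / 2)"
    by (rule exp_dominated_head[OF assms(2) _ c b]) simp
  also have "\<dots> \<le> 2 * Q * K * exp ((1 / 2) * x)"
    using nonneg half_decay_nonneg[OF assms(1)] by (simp add: algebra_simps)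
  finally show ?thesis .
qed

text \<open>The rates balance: \<open>exp (- x)\<close> against a head of size
  \<open>exp (x / 2)\<close>, and \<open>exp x\<close> against a tail of size
  \<open>exp (- 3 x / 2)\<close>, both leave \<open>exp (- x / 2)\<close>. The head contributes 2 to
  the factor 3, the tail 1. The derivatives of \<open>p\<close> and \<open>q\<close> give
  continuity.\<close>

lemma green_half_decay:
  assumes "half_decay K f"
    and "\<And>x. (p has_real_derivative p' x) (at x)" "\<And>x. (q has_real_derivative q' x) (at x)"
  shows "half_decay (3 * P * Q * K) (green p q p q f)"
  unfolding half_decay_def
proof (intro conjI allI impI)
  show "continuous_on {0..} (green p q p q f)"
    unfolding continuous_on_eq_continuous_within
  proof
    fix x :: real assume "x \<in> {0..}"
    then have "(green p q p q f has_real_derivative green p' q' p q f x + (p x * q x - q x * p x) * f x) (at x within {0..})"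
      by (intro green_has_derivative half_decay_cont[OF assms(1)] p_cont q_cont
        pf_integrable(1)[OF assms(1)] assms(2,3)) auto
    then show "continuous (at x within {0..}) (green p q p q f)" by (rule DERIV_continuous)
  qed
  fix x :: real assume x: "0 \<le> x"
  have "\<bar>green p q p q f x\<bar> \<le> \<bar>p x\<bar> * \<bar>integral {0..x} (\<lambda>y. q y * f y)\<bar> + \<bar>q x\<bar> * \<bar>integral {x..} (\<lambda>y. p y * f y)\<bar>"
    unfolding green_def by (rule abs_sum_prod_le)
  also have "\<dots> \<le> (P * exp (- x)) * (2 * Q * K * exp ((1 / 2) * x)) + (Q * exp x) * (P * K * exp (- (3 / 2) * x))"
    using x assms(1) nonneg
    by (intro add_mono mult_mono p_bound q_bound pf_integrable(2) qf_bound) auto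
  also have "(P * exp (- x)) * (2 * Q * K * exp ((1 / 2) * x)) = P * (2 * Q * K) * exp (- (1 / 2) * x)"
    by (rule exp_merge) simp
  also have "(Q * exp x) * (P * K * exp (- (3 / 2) * x)) = Q * (P * K) * exp (- (1 / 2) * x)"
    by (rule exp_merge) simp
  also have "P * (2 * Q * K) * exp (- (1 / 2) * x) + Q * (P * K) * exp (- (1 / 2) * x)
      = 3 * P * Q * K * exp (- (1 / 2) * x)"
    by (simp add: algebra_simps)
  finally show "\<bar>green p q p q f x\<bar> \<le> 3 * P * Q * K * exp (- (1 / 2) * x)" .
qed

lemma green_linear:
  assumes "half_decay K f" "half_decay L g" "0 \<le> x"
  shows "green p q p q (\<lambda>x. a * f x + b * g x) x = a * green p q p q f x + b * green p q p q g x"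
  using assms by (intro green_add half_decay_cont q_cont pf_integrable)

end

text \<open>Functions with half-exponential decay are represented by bounded continuous functions, and operators
  that act on them are read off on the half-line and extended evenly.\<close>

definition damp :: "(real \<Rightarrow>\<^sub>C real) \<Rightarrow> real \<Rightarrow> real"
  where "damp w x = exp (- (1 / 2) * \<bar>x\<bar>) * w x"

definition undamp :: "(real \<Rightarrow> real) \<Rightarrow> real \<Rightarrow>\<^sub>C real"
  where "undamp f = Bcontfun (\<lambda>x. exp ((1 / 2) * \<bar>x\<bar>) * f \<bar>x\<bar>)"

lemma damp_half_decay: "half_decay (norm w) (damp w)"
  unfolding half_decay_def damp_def
proof (intro conjI allI impI)
  show "continuous_on {0..} (\<lambda>x. exp (- (1 / 2) * \<bar>x\<bar>) * w x)"
    by (intro continuous_intros continuous_on_apply_bcontfun)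
  show "\<bar>exp (- (1 / 2) * \<bar>x\<bar>) * w x\<bar> \<le> norm w * exp (- (1 / 2) * x)" if "0 \<le> x" for x
    using norm_bounded[of w x] that by (simp add: abs_mult)
qed

lemma damp_linear: "damp (w + v) x = damp w x + damp v x" "damp (w - v) x = damp w x - damp v x"
  "damp (a *\<^sub>R w) x = a * damp w x" "damp (- w) x = - damp w x"
  by (simp_all add: damp_def algebra_simps)

lemma
  assumes "half_decay K f"
  shows damp_undamp: "damp (undamp f) x = f \<bar>x\<bar>" and norm_undamp: "norm (undamp f) \<le> K"
proof -
  have e: "exp ((1 / 2) * \<bar>x\<bar>) * (c * exp (- (1 / 2) * \<bar>x\<bar>)) = c"
    "exp (- (1 / 2) * \<bar>x\<bar>) * (exp ((1 / 2) * \<bar>x\<bar>) * c) = c" for c x :: real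
    by (simp_all add: exp_minus)
  have c: "continuous_on UNIV (\<lambda>x. exp ((1 / 2) * \<bar>x\<bar>) * f \<bar>x\<bar>)"
    by (intro continuous_intros continuous_on_compose2[OF half_decay_cont[OF assms]]) auto
  have b: "norm (exp ((1 / 2) * \<bar>x\<bar>) * f \<bar>x\<bar>) \<le> K" for x
  proof -
    have "norm (exp ((1 / 2) * \<bar>x\<bar>) * f \<bar>x\<bar>) \<le> exp ((1 / 2) * \<bar>x\<bar>) * (K * exp (- (1 / 2) * \<bar>x\<bar>))"
      using half_decay_bound[OF assms, of "\<bar>x\<bar>"] by (simp add: abs_mult)
    also have "\<dots> = K" using e by simp
    finally show ?thesis .
  qed
  have u: "undamp f x = exp ((1 / 2) * \<bar>x\<bar>) * f \<bar>x\<bar>" for x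
    unfolding undamp_def by (subst Bcontfun_inverse) (use bcontfun_normI[OF c b] in auto)
  show "damp (undamp f) x = f \<bar>x\<bar>"
    unfolding damp_def u using e by simp
  show "norm (undamp f) \<le> K" by (rule norm_bound) (use b u in simp)
qed

lemma undamp_linear:
  assumes "half_decay K f" "half_decay L g" "half_decay M h"
    and "\<And>x. 0 \<le> x \<Longrightarrow> h x = a * f x + b * g x"
  shows "undamp h = a *\<^sub>R undamp f + b *\<^sub>R undamp g"
proof (rule bcontfun_eqI)
  fix x
  have "damp (undamp h) x = damp (a *\<^sub>R undamp f + b *\<^sub>R undamp g) x"
    using assms by (simp add: damp_linear damp_undamp)
  then show "undamp h x = (a *\<^sub>R undamp f + b *\<^sub>R undamp g) x"
    by (simp add: damp_def)
qed

text \<open>Moves an operator on plain functions to the complete space of bounded continuous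
  functions, where the contraction takes place. Linearity at nonnegative \<open>x\<close> suffices
  because \<open>undamp\<close> reads its argument only at \<open>\<bar>x\<bar>\<close>.\<close>

lemma undamped_operator_linear:
  assumes "\<And>K f. half_decay K f \<Longrightarrow> half_decay (C * K) (T f)"
    and "\<And>K L f g a b x. half_decay K f \<Longrightarrow> half_decay L g \<Longrightarrow> 0 \<le> x \<Longrightarrow>
      T (\<lambda>x. a * f x + b * g x) x = a * T f x + b * T g x"
  shows "bounded_linear (\<lambda>w. undamp (T (damp w)))" "norm (undamp (T (damp w))) \<le> C * norm w"
    "damp (undamp (T (damp w))) x = T (damp w) \<bar>x\<bar>"
proof -
  note d = assms(1)[OF damp_half_decay]
  have comb: "undamp (T (damp (a *\<^sub>R w + b *\<^sub>R v))) = a *\<^sub>R undamp (T (damp w)) + b *\<^sub>R undamp (T (damp v))" for a b w v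
  proof (rule undamp_linear[OF d d d])
    have "damp (a *\<^sub>R w + b *\<^sub>R v) = (\<lambda>x. a * damp w x + b * damp v x)"
      by (rule ext) (simp add: damp_linear)
    then show "T (damp (a *\<^sub>R w + b *\<^sub>R v)) x = a * T (damp w) x + b * T (damp v) x" if "0 \<le> x" for x
      by (simp only:) (rule assms(2)[OF damp_half_decay damp_half_decay that])
  qed
  show n: "norm (undamp (T (damp w))) \<le> C * norm w" for w by (rule norm_undamp[OF d])
  show "bounded_linear (\<lambda>w. undamp (T (damp w)))"
  proof (rule bounded_linear_intro)
    show "undamp (T (damp (w + v))) = undamp (T (damp w)) + undamp (T (damp v))" for w v
      using comb[of 1 w 1 v] by simp
    show "undamp (T (damp (a *\<^sub>R w))) = a *\<^sub>R undamp (T (damp w))" for a w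
      using comb[of a w 0 w] by simp
    show "norm (undamp (T (damp w))) \<le> norm w * C" for w using n[of w] by (simp add: mult.commute)
  qed
  show "damp (undamp (T (damp w))) x = T (damp w) \<bar>x\<bar>" by (rule damp_undamp[OF d])
qed

section \<open>The linearised operators of the soliton\<close>

lemma has_derivative_sech [derivative_intros]:
  "(f has_real_derivative D) (at x within S) \<Longrightarrow>
    ((\<lambda>x. sech (f x)) has_real_derivative - sech (f x) * tanh (f x) * D) (at x within S)"
  by (rule DERIV_chain2[OF sech_deriv])

lemma has_derivative_tanh_sech:
  "(f has_real_derivative D) (at x within S) \<Longrightarrow>
    ((\<lambda>x. tanh (f x)) has_real_derivative (sech (f x))\<^sup>2 * D) (at x within S)" for f :: "real \<Rightarrow> real"
  by (rule DERIV_chain2[OF tanh_deriv])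

lemma continuous_on_sech [continuous_intros]: "continuous_on S f \<Longrightarrow> continuous_on S (\<lambda>x. sech (f x))"
  unfolding sech_def by (intro continuous_intros) auto

text \<open>Polynomial relations, kept in this form as hypotheses for \<open>algebra\<close> in the
  verification of the explicit solutions.\<close>

lemma sech_simps: "sech x * cosh x = 1" "tanh x * cosh x = sinh x" "(tanh x)\<^sup>2 = 1 - (sech x)\<^sup>2" for x :: real
  by (simp add: sech_def, simp add: tanh_def, simp add: sech_sq)

lemma sech_even [simp]: "sech \<bar>x\<bar> = sech x"
  by (simp add: sech_def abs_if)

lemma sech_pos [simp]: "0 < sech x"
  by (simp add: sech_def)

lemma abs_sech [simp]: "\<bar>sech x\<bar> = sech x"
  by (simp add: sech_def)

lemma sech_le: "sech x \<le> 2 * exp (- x)" "sech x \<le> 1"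
proof -
  have "exp x \<le> 2 * cosh x" by (simp add: cosh_field_def)
  then show "sech x \<le> 2 * exp (- x)" by (simp add: sech_def exp_minus field_simps)
  show "sech x \<le> 1" by (simp add: sech_def cosh_real_ge_1)
qed

lemma abs_tanh_le: "\<bar>tanh x\<bar> \<le> 1" for x :: real
  using tanh_real_bounds[of x] by auto

lemma x_sech_le: "0 \<le> x \<Longrightarrow> x * sech x \<le> 4 * exp (- (1 / 2) * x)"
proof -
  assume x: "0 \<le> x"
  have "x \<le> 2 * exp ((1 / 2) * x)" using exp_ge_add_one_self[of "(1 / 2) * x"] by linarith
  then have "x * sech x \<le> (2 * exp ((1 / 2) * x)) * (2 * exp (- x))"
    using x sech_le(1)[of x] by (intro mult_mono) (auto intro: less_imp_le)
  also have "\<dots> = 4 * exp (- (1 / 2) * x)" by (simp flip: exp_add)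
  finally show ?thesis .
qed

text \<open>Fundamental systems for \<open>u'' = (1 - 6 sech\<^sup>2) u\<close> and \<open>u'' = (1 - 2 sech\<^sup>2) u\<close>. The decaying solutions
  are the derivative of the soliton profile in \<open>x\<close>, up to sign, and the profile itself; the growing ones result from reduction of order.\<close>

definition "decaying1 x = sech x * tanh x"
definition "growing1 x = - (3 / 2) * sech x + (3 / 2) * x * sech x * tanh x + (1 / 2) * cosh x"
definition "decaying1' x = 2 * sech x * (sech x * sech x) - sech x"
definition "growing1' x = 3 * sech x * tanh x + (3 / 2) * x * (2 * sech x * (sech x * sech x) - sech x) + (1 / 2) * sinh x"
definition "growing2 x = (1 / 2) * (x * sech x + sinh x)"
definition "decaying2' x = - sech x * tanh x"
definition "growing2' x = (1 / 2) * (sech x - x * sech x * tanh x + cosh x)"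

text \<open>\<open>growing1\<close> is normalised to Wronskian 1 and, as \<open>decaying1\<close> is
  odd, can be taken even. Then \<open>growing1' 0 = 0\<close>, and the half-line solution has
  derivative 0 at 0 for every source: the first operator imposes no solvability condition.\<close>

lemma kernel1_derivatives:
  "(decaying1 has_real_derivative decaying1' x) (at x)" "(growing1 has_real_derivative growing1' x) (at x)"
  "(decaying1' has_real_derivative (1 - 6 * (sech x)\<^sup>2) * decaying1 x) (at x)"
  "(growing1' has_real_derivative (1 - 6 * (sech x)\<^sup>2) * growing1 x) (at x)"
  "growing1' x * decaying1 x - decaying1' x * growing1 x = 1" "growing1' 0 = 0"
proof -
  note r = sech_simps[of x]
  show "(decaying1 has_real_derivative decaying1' x) (at x)"
    unfolding decaying1_def[abs_def] decaying1'_def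
    by (rule derivative_eq_intros has_derivative_tanh_sech refl)+ (use r in algebra)
  show "(growing1 has_real_derivative growing1' x) (at x)"
    unfolding growing1_def[abs_def] growing1'_def
    by (rule derivative_eq_intros has_derivative_tanh_sech refl)+ (use r in algebra)
  show "(decaying1' has_real_derivative (1 - 6 * (sech x)\<^sup>2) * decaying1 x) (at x)"
    unfolding decaying1'_def[abs_def] decaying1_def
    by (rule derivative_eq_intros has_derivative_tanh_sech refl)+ (simp add: algebra_simps power2_eq_square)
  show "(growing1' has_real_derivative (1 - 6 * (sech x)\<^sup>2) * growing1 x) (at x)"
    unfolding growing1'_def[abs_def] growing1_def
    by (rule derivative_eq_intros has_derivative_tanh_sech refl)+ (use r in algebra)
  show "growing1' x * decaying1 x - decaying1' x * growing1 x = 1"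
    unfolding decaying1'_def decaying1_def growing1'_def growing1_def using r by algebra
  show "growing1' 0 = 0" by (simp add: growing1'_def)
qed

text \<open>Here the decaying solution is even, so the growing one is taken odd. Consequently
  \<open>green\<close> vanishes at 0, which fixes the free multiple of \<open>sech\<close>, while
  its derivative there is a pairing with \<open>sech\<close>.\<close>

lemma kernel2_derivatives:
  "(sech has_real_derivative decaying2' x) (at x)" "(growing2 has_real_derivative growing2' x) (at x)"
  "(decaying2' has_real_derivative (1 - 2 * (sech x)\<^sup>2) * sech x) (at x)"
  "(growing2' has_real_derivative (1 - 2 * (sech x)\<^sup>2) * growing2 x) (at x)"
  "growing2' x * sech x - decaying2' x * growing2 x = 1" "growing2 0 = 0"
proof -
  note r = sech_simps[of x]
  show "(sech has_real_derivative decaying2' x) (at x)"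
    unfolding decaying2'_def by (rule sech_deriv)
  show "(growing2 has_real_derivative growing2' x) (at x)"
    unfolding growing2_def[abs_def] growing2'_def
    by (rule derivative_eq_intros has_derivative_tanh_sech refl)+ (simp add: algebra_simps power2_eq_square)
  show "(decaying2' has_real_derivative (1 - 2 * (sech x)\<^sup>2) * sech x) (at x)"
    unfolding decaying2'_def[abs_def]
    by (rule derivative_eq_intros has_derivative_tanh_sech refl)+ (use r in algebra)
  show "(growing2' has_real_derivative (1 - 2 * (sech x)\<^sup>2) * growing2 x) (at x)"
    unfolding growing2'_def[abs_def] growing2_def
    by (rule derivative_eq_intros has_derivative_tanh_sech refl)+ (use r in algebra)
  show "growing2' x * sech x - decaying2' x * growing2 x = 1"
    unfolding decaying2'_def growing2'_def growing2_def using r by algebra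
  show "growing2 0 = 0" by (simp add: growing2_def)
qed

section \<open>Growth bounds for the two fundamental systems\<close>

lemma cosh_sinh_le: "cosh x \<le> exp x" "\<bar>sinh x\<bar> \<le> exp x" if "0 \<le> x" for x :: real
proof -
  have "exp (- x) \<le> exp x" using that by simp
  then show "cosh x \<le> exp x" by (simp add: cosh_field_def)
  show "\<bar>sinh x\<bar> \<le> exp x"
    using mult_mono[of 1 3 "exp (- x)" "exp x"] that exp_gt_zero[of "- x"] unfolding sinh_field_def abs_le_iff
    by (simp add: field_simps)
qed

interpretation k1: green_kernel decaying1 growing1 2 10
proof
  show "continuous_on {0..} decaying1" "continuous_on {0..} growing1"
    by (rule DERIV_continuous_on[OF has_field_derivative_at_within[OF kernel1_derivatives(1)]]
      DERIV_continuous_on[OF has_field_derivative_at_within[OF kernel1_derivatives(2)]])+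
  fix x :: real assume x: "0 \<le> x"
  show "\<bar>decaying1 x\<bar> \<le> 2 * exp (- x)"
    using mult_mono[OF sech_le(1) abs_tanh_le, of x x] by (simp add: decaying1_def abs_mult)
  have e: "1 \<le> exp x" "exp (- (1 / 2) * x) \<le> 1" using x by simp_all
  have growth: "(3 / 2) * 1 + (3 / 2) * 4 + t / 2 \<le> 10 * t" if "1 \<le> t" for t :: real
    using that by linarith
  have xs: "\<bar>x * sech x * tanh x\<bar> \<le> 4 * 1"
  proof -
    have "\<bar>x * sech x\<bar> \<le> 4" using x order_trans[OF x_sech_le[OF x], of 4] e(2) by (simp add: abs_mult)
    then show ?thesis
      unfolding abs_mult[of "x * sech x"] using abs_tanh_le[of x] by (intro mult_mono) auto
  qed
  have "\<bar>growing1 x\<bar> \<le> (3 / 2) * 1 + (3 / 2) * 4 + exp x / 2"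
    using sech_le(2)[of x] sech_pos[of x] xs cosh_sinh_le(1)[OF x] cosh_real_pos[of x] unfolding growing1_def by argo
  also have "\<dots> \<le> 10 * exp x" by (rule growth[OF e(1)])
  finally show "\<bar>growing1 x\<bar> \<le> 10 * exp x" .
qed

interpretation k2: green_kernel sech growing2 2 10
proof
  show "continuous_on {0..} sech" "continuous_on {0..} growing2"
    by (rule DERIV_continuous_on[OF has_field_derivative_at_within[OF kernel2_derivatives(1)]]
      DERIV_continuous_on[OF has_field_derivative_at_within[OF kernel2_derivatives(2)]])+
  fix x :: real assume x: "0 \<le> x"
  show "\<bar>sech x\<bar> \<le> 2 * exp (- x)" unfolding abs_sech by (rule sech_le)
  have e: "1 \<le> exp x" "exp (- (1 / 2) * x) \<le> 1" using x by simp_all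
  have growth: "(4 + t) / 2 \<le> 10 * t" if "1 \<le> t" for t :: real
    using that by (simp add: field_simps)
  have "0 \<le> x * sech x" using x less_imp_le[OF sech_pos] by (rule mult_nonneg_nonneg)
  then have "\<bar>growing2 x\<bar> \<le> (4 + exp x) / 2"
    using x_sech_le[OF x] cosh_sinh_le(2)[OF x] e unfolding growing2_def by argo
  also have "\<dots> \<le> 10 * exp x" by (rule growth[OF e(1)])
  finally show "\<bar>growing2 x\<bar> \<le> 10 * exp x" .
qed

lemma half_decay_sech: "half_decay 2 sech"
  unfolding half_decay_def
proof (intro conjI allI impI)
  fix x :: real assume "0 \<le> x"
  then have "exp (- x) \<le> exp (- (1 / 2) * x)" by simp
  then show "\<bar>sech x\<bar> \<le> 2 * exp (- (1 / 2) * x)" using sech_le(1)[of x] sech_pos[of x] by linarith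
qed (rule k2.p_cont)

text \<open>Half the derivative at \<open>c = 1\<close> of the family \<open>c sech (c x)\<close> of soliton profiles.\<close>

definition "profile\<^sub>0 x = (1 / 2) * (sech x - x * sech x * tanh x)"
definition "profile\<^sub>0' x = (1 / 2) * (- 2 * sech x * tanh x - x * (2 * sech x * (sech x * sech x) - sech x))"

text \<open>Differentiating the equation \<open>R'' = c\<^sup>2 R - 2 R\<^sup>3\<close> of
  \<open>R = c sech (c x)\<close> in \<open>c\<close> at \<open>c = 1\<close> gives twice the second
  statement.\<close>

lemma profile\<^sub>0_derivatives:
  "(profile\<^sub>0 has_real_derivative profile\<^sub>0' x) (at x)"
  "(profile\<^sub>0' has_real_derivative (1 - 6 * (sech x)\<^sup>2) * profile\<^sub>0 x + sech x) (at x)"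
  "profile\<^sub>0' 0 = 0"
proof -
  note r = sech_simps[of x]
  show "(profile\<^sub>0 has_real_derivative profile\<^sub>0' x) (at x)"
    unfolding profile\<^sub>0_def[abs_def] profile\<^sub>0'_def
    by (rule derivative_eq_intros has_derivative_tanh_sech refl)+ (use r in algebra)
  show "(profile\<^sub>0' has_real_derivative (1 - 6 * (sech x)\<^sup>2) * profile\<^sub>0 x + sech x) (at x)"
    unfolding profile\<^sub>0'_def[abs_def] profile\<^sub>0_def
    by (rule derivative_eq_intros has_derivative_tanh_sech refl)+ (use r in algebra)
  show "profile\<^sub>0' 0 = 0" by (simp add: profile\<^sub>0'_def)
qed

lemma half_decay_profile\<^sub>0: "half_decay 3 profile\<^sub>0"
  unfolding half_decay_def
proof (intro conjI allI impI)
  show "continuous_on {0..} profile\<^sub>0"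
    by (rule DERIV_continuous_on[OF has_field_derivative_at_within[OF profile\<^sub>0_derivatives(1)]])
  fix x :: real assume x: "0 \<le> x"
  have "\<bar>x * sech x * tanh x\<bar> \<le> 4 * exp (- (1 / 2) * x) * 1"
    unfolding abs_mult[of "x * sech x"] using x x_sech_le[OF x] abs_tanh_le[of x]
    by (intro mult_mono) (auto simp: abs_mult)
  then show "\<bar>profile\<^sub>0 x\<bar> \<le> 3 * exp (- (1 / 2) * x)"
    using half_decay_bound[OF half_decay_sech x] unfolding profile\<^sub>0_def by argo
qed

section \<open>Pairings with \<open>sech\<close> on the half-line\<close>

lemma sech_product_bound:
  assumes "half_decay K f" "0 \<le> x"
  shows "\<bar>sech x * f x\<bar> \<le> 2 * K * exp (- (3 / 2) * x)"
proof -
  have "\<bar>sech x * f x\<bar> \<le> (2 * exp (- x)) * (K * exp (- (1 / 2) * x))"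
    unfolding abs_mult using assms by (intro mult_mono k2.p_bound half_decay_bound) auto
  also have "\<dots> = 2 * K * exp (- (3 / 2) * x)" by (simp flip: exp_add)
  finally show ?thesis .
qed

text \<open>The value 1/4 is a quarter of the derivative in \<open>c\<close> of the half-line
  integral of \<open>(c sech (c x))\<^sup>2\<close>, which equals \<open>c\<close>. The primitives
  are \<open>tanh x\<close> and \<open>(tanh x + x sech\<^sup>2 x) / 4\<close>.\<close>

lemma sech_pairings:
  "integral {0..} (\<lambda>x. sech x * sech x) = 1"
  "integral {0..} (\<lambda>x. sech x * profile\<^sub>0 x) = 1 / 4"
proof -
  have t: "(tanh \<longlongrightarrow> (1::real)) at_top" by (rule tanh_real_at_top)
  have "integral {0..} (\<lambda>x. sech x * sech x) = 1 - tanh 0"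
  proof (rule improper_ftc)
    show "continuous_on {0..} (\<lambda>x. sech x * sech x)" by (intro continuous_intros)
    show "\<bar>sech y * sech y\<bar> \<le> 2 * 2 * exp (- (3 / 2) * y)" if "0 \<le> y" for y
      by (rule sech_product_bound[OF half_decay_sech that])
    show "(tanh has_real_derivative sech y * sech y) (at y)" for y :: real
      using tanh_deriv by (simp add: power2_eq_square)
  qed (use t in auto)
  then show "integral {0..} (\<lambda>x. sech x * sech x) = 1" by simp
  let ?G = "\<lambda>x. (1 / 4) * tanh x + (1 / 4) * (x * (sech x * sech x))"
  have "integral {0..} (\<lambda>x. sech x * profile\<^sub>0 x) = (1 / 4 + 0) - ?G 0"
  proof (rule improper_ftc)
    show "continuous_on {0..} (\<lambda>x. sech x * profile\<^sub>0 x)"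
      by (intro continuous_intros half_decay_cont[OF half_decay_profile\<^sub>0])
    show "\<bar>sech y * profile\<^sub>0 y\<bar> \<le> 2 * 3 * exp (- (3 / 2) * y)" if "0 \<le> y" for y
      by (rule sech_product_bound[OF half_decay_profile\<^sub>0 that])
    show "(?G has_real_derivative sech y * profile\<^sub>0 y) (at y)" for y :: real
      unfolding profile\<^sub>0_def
      by (rule has_derivative_tanh_sech derivative_eq_intros refl)+
        (simp add: algebra_simps power2_eq_square)
    have e: "((\<lambda>x. exp (- (1 / 2) * x)) \<longlongrightarrow> (0::real)) at_top" by real_asymp
    have "((\<lambda>x. (1 / 4) * (x * (sech x * sech x))) \<longlongrightarrow> 0) at_top"
    proof (rule Lim_null_comparison[OF _ e])
      show "\<forall>\<^sub>F x in at_top. norm ((1 / 4) * (x * (sech x * sech x))) \<le> exp (- (1 / 2) * x)"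
      proof (rule eventually_at_top_linorderI[of 0])
        fix x :: real assume x: "0 \<le> x"
        have "(x * sech x) * sech x \<le> (4 * exp (- (1 / 2) * x)) * 1"
          by (rule mult_mono[OF x_sech_le[OF x] sech_le(2)]) (auto intro: less_imp_le)
        moreover have "norm ((1 / 4) * (x * (sech x * sech x))) = (1 / 4) * ((x * sech x) * sech x)"
          using x by (simp add: abs_mult)
        ultimately show "norm ((1 / 4) * (x * (sech x * sech x))) \<le> exp (- (1 / 2) * x)"
          by linarith
      qed
    qed
    from tendsto_add[OF tendsto_mult_left[OF t, of "1 / 4"] this]
    show "(?G \<longlongrightarrow> 1 / 4 + 0) at_top" by simp
  qed simp
  then show "integral {0..} (\<lambda>x. sech x * profile\<^sub>0 x) = 1 / 4" by simp
qed

section \<open>The nonlocal term\<close>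

text \<open>With the factor \<open>sech\<close> the integrand beats a weight growing like
  \<open>exp (y / 2)\<close> and still decays like \<open>exp (- y)\<close>. The weights meant are
  \<open>exp (- \<kappa> y)\<close>, \<open>cosh (\<kappa> y)\<close> and their differences for two
  values of \<kappa>.\<close>

lemma sech_weighted:
  assumes f: "half_decay K f" and g: "continuous_on {0..} g" "\<And>y. 0 \<le> y \<Longrightarrow> \<bar>g y\<bar> \<le> A * exp ((1 / 2) * y)"
    and x: "0 \<le> x"
  shows "(\<lambda>y. g y * (sech y * f y)) integrable_on {x..}"
    "\<bar>integral {x..} (\<lambda>y. g y * (sech y * f y))\<bar> \<le> 2 * A * K * exp (- x)"
    "\<bar>integral {0..x} (\<lambda>y. g y * (sech y * f y))\<bar> \<le> 2 * A * K"
proof -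
  have c: "continuous_on {0..} (\<lambda>y. g y * (sech y * f y))"
    by (intro continuous_intros g half_decay_cont[OF f])
  have A: "0 \<le> A" using order_trans[OF abs_ge_zero g(2)[of 0]] by simp
  have K: "0 \<le> K" by (rule half_decay_nonneg[OF f])
  have b: "\<bar>g y * (sech y * f y)\<bar> \<le> 2 * A * K * exp (- 1 * y)" if "0 \<le> y" for y
  proof -
    have "\<bar>g y * (sech y * f y)\<bar> \<le> (A * exp ((1 / 2) * y)) * (2 * K * exp (- (3 / 2) * y))"
      unfolding abs_mult[of "g y"] using that A by (intro mult_mono g sech_product_bound[OF f]) auto
    also have "\<dots> = A * (2 * K) * exp (- 1 * y)" by (rule exp_merge) simp
    finally show ?thesis by (simp add: mult_ac)
  qed
  show "(\<lambda>y. g y * (sech y * f y)) integrable_on {x..}"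
    by (rule exp_dominated_tail(1)[OF x _ c b]) simp
  have "\<bar>integral {x..} (\<lambda>y. g y * (sech y * f y))\<bar> \<le> 2 * A * K / 1 * exp (- 1 * x)"
    by (rule exp_dominated_tail(2)[OF x _ c b]) simp
  then show "\<bar>integral {x..} (\<lambda>y. g y * (sech y * f y))\<bar> \<le> 2 * A * K * exp (- x)" by simp
  have "\<bar>integral {0..x} (\<lambda>y. g y * (sech y * f y))\<bar> \<le> 2 * A * K * (exp (- 1 * x) - 1) / - 1"
    by (rule exp_dominated_head[OF x _ c b]) simp
  also have "\<dots> = 2 * A * K * (1 - exp (- x))" by (simp add: algebra_simps)
  also have "\<dots> \<le> 2 * A * K * 1" using A K by (intro mult_left_mono) auto
  finally show "\<bar>integral {0..x} (\<lambda>y. g y * (sech y * f y))\<bar> \<le> 2 * A * K" by simp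
qed

text \<open>The constants for the functions under the integrals (\<open>A\<close>) and in front of
  them (\<open>B\<close>) are separate so that either pair can be replaced by a small
  difference.\<close>

lemma green_sech_bound:
  assumes f: "half_decay K f"
    and p: "continuous_on {0..} p" "\<And>y. 0 \<le> y \<Longrightarrow> \<bar>p y\<bar> \<le> A * exp ((1 / 2) * y)"
    and q: "continuous_on {0..} q" "\<And>y. 0 \<le> y \<Longrightarrow> \<bar>q y\<bar> \<le> A * exp ((1 / 2) * y)"
    and "\<bar>r x\<bar> \<le> B * exp ((1 / 2) * x)" "\<bar>s x\<bar> \<le> B * exp ((1 / 2) * x)" and x: "0 \<le> x"
  shows "\<bar>green r s p q (\<lambda>y. sech y * f y) x\<bar> \<le> 4 * A * B * K * exp ((1 / 2) * x)"
proof -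
  have A: "0 \<le> A" using order_trans[OF abs_ge_zero p(2)[of 0]] by simp
  have K: "0 \<le> K" by (rule half_decay_nonneg[OF f])
  have B: "0 \<le> B * exp ((1 / 2) * x)" using order_trans[OF abs_ge_zero assms(6)] .
  have "2 * A * K * exp (- x) \<le> 2 * A * K * 1" using A K x by (intro mult_left_mono) auto
  then have t: "\<bar>integral {x..} (\<lambda>y. p y * (sech y * f y))\<bar> \<le> 2 * A * K"
    using sech_weighted(2)[OF f p x] by linarith
  have "\<bar>green r s p q (\<lambda>y. sech y * f y) x\<bar> \<le> \<bar>r x\<bar> * \<bar>integral {0..x} (\<lambda>y. q y * (sech y * f y))\<bar>
      + \<bar>s x\<bar> * \<bar>integral {x..} (\<lambda>y. p y * (sech y * f y))\<bar>"
    unfolding green_def by (rule abs_sum_prod_le)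
  also have "\<dots> \<le> (B * exp ((1 / 2) * x)) * (2 * A * K) + (B * exp ((1 / 2) * x)) * (2 * A * K)"
    using sech_weighted(3)[OF f q x] t assms(6,7) A K B by (intro add_mono mult_mono) auto
  finally show ?thesis by (simp add: algebra_simps)
qed

definition exp_decaying :: "real \<Rightarrow> real \<Rightarrow> real" where "exp_decaying \<kappa> x = exp (- \<kappa> * x)"
definition cosh_growing :: "real \<Rightarrow> real \<Rightarrow> real" where "cosh_growing \<kappa> x = cosh (\<kappa> * x)"
definition exp_decaying' :: "real \<Rightarrow> real \<Rightarrow> real" where "exp_decaying' \<kappa> x = - \<kappa> * exp (- \<kappa> * x)"
definition cosh_growing' :: "real \<Rightarrow> real \<Rightarrow> real" where "cosh_growing' \<kappa> x = \<kappa> * sinh (\<kappa> * x)"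

text \<open>On the half-line this is the convolution of \<open>exp (- \<kappa> \<bar>x\<bar>)\<close> with the even extension of \<open>sech f\<close>.\<close>

definition nonlocal :: "real \<Rightarrow> (real \<Rightarrow> real) \<Rightarrow> real \<Rightarrow> real"
  where "nonlocal \<kappa> f x = 2 * green (exp_decaying \<kappa>) (cosh_growing \<kappa>) (exp_decaying \<kappa>) (cosh_growing \<kappa>) (\<lambda>y. sech y * f y) x"

definition nonlocal' :: "real \<Rightarrow> (real \<Rightarrow> real) \<Rightarrow> real \<Rightarrow> real"
  where "nonlocal' \<kappa> f x = 2 * green (exp_decaying' \<kappa>) (cosh_growing' \<kappa>) (exp_decaying \<kappa>) (cosh_growing \<kappa>) (\<lambda>y. sech y * f y) x"

text \<open>The Wronskian is \<kappa>, and the convolution is not normalised by it. This keeps all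
  bounds uniform down to \<open>\<kappa> = 0\<close>.\<close>

lemma exp_cosh_derivatives:
  "(exp_decaying \<kappa> has_real_derivative exp_decaying' \<kappa> x) (at x)" "(cosh_growing \<kappa> has_real_derivative cosh_growing' \<kappa> x) (at x)"
  "(exp_decaying' \<kappa> has_real_derivative \<kappa>\<^sup>2 * exp_decaying \<kappa> x) (at x)" "(cosh_growing' \<kappa> has_real_derivative \<kappa>\<^sup>2 * cosh_growing \<kappa> x) (at x)"
  "cosh_growing' \<kappa> x * exp_decaying \<kappa> x - exp_decaying' \<kappa> x * cosh_growing \<kappa> x = \<kappa>"
proof -
  show "(exp_decaying \<kappa> has_real_derivative exp_decaying' \<kappa> x) (at x)"
    unfolding exp_decaying_def[abs_def] exp_decaying'_def by (auto intro!: derivative_eq_intros)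
  show "(cosh_growing \<kappa> has_real_derivative cosh_growing' \<kappa> x) (at x)"
    unfolding cosh_growing_def[abs_def] cosh_growing'_def by (auto intro!: derivative_eq_intros)
  show "(exp_decaying' \<kappa> has_real_derivative \<kappa>\<^sup>2 * exp_decaying \<kappa> x) (at x)"
    unfolding exp_decaying_def exp_decaying'_def[abs_def] by (auto intro!: derivative_eq_intros simp: power2_eq_square)
  show "(cosh_growing' \<kappa> has_real_derivative \<kappa>\<^sup>2 * cosh_growing \<kappa> x) (at x)"
    unfolding cosh_growing_def cosh_growing'_def[abs_def] by (auto intro!: derivative_eq_intros simp: power2_eq_square)
  have "cosh_growing' \<kappa> x * exp_decaying \<kappa> x - exp_decaying' \<kappa> x * cosh_growing \<kappa> x = \<kappa> * ((cosh (\<kappa> * x) + sinh (\<kappa> * x)) * exp (- \<kappa> * x))"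
    unfolding exp_decaying_def exp_decaying'_def cosh_growing_def cosh_growing'_def by (simp add: algebra_simps)
  also have "\<dots> = \<kappa>" by (simp add: cosh_plus_sinh exp_minus)
  finally show "cosh_growing' \<kappa> x * exp_decaying \<kappa> x - exp_decaying' \<kappa> x * cosh_growing \<kappa> x = \<kappa>" .
qed

lemma exp_cosh_cont: "continuous_on S (exp_decaying \<kappa>)" "continuous_on S (cosh_growing \<kappa>)"
  unfolding exp_decaying_def[abs_def] cosh_growing_def[abs_def] by (intro continuous_intros)+

lemma exp_cosh_bound:
  assumes "0 \<le> \<kappa>" "\<kappa> \<le> 1 / 4" "0 \<le> x"
  shows "\<bar>exp_decaying \<kappa> x\<bar> \<le> 1 * exp ((1 / 2) * x)" "\<bar>cosh_growing \<kappa> x\<bar> \<le> 1 * exp ((1 / 2) * x)"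
proof -
  have k: "0 \<le> \<kappa> * x" "\<kappa> * x \<le> (1 / 2) * x" using assms mult_right_mono[of \<kappa> "1 / 2" x] by auto
  then have "- \<kappa> * x \<le> (1 / 2) * x" using assms(3) by linarith
  then show "\<bar>exp_decaying \<kappa> x\<bar> \<le> 1 * exp ((1 / 2) * x)" unfolding exp_decaying_def by simp
  have "\<bar>cosh_growing \<kappa> x\<bar> \<le> exp (\<kappa> * x)" using cosh_sinh_le(1)[OF k(1)] by (simp add: cosh_growing_def)
  also have "\<dots> \<le> 1 * exp ((1 / 2) * x)" using k by simp
  finally show "\<bar>cosh_growing \<kappa> x\<bar> \<le> 1 * exp ((1 / 2) * x)" .
qed

section \<open>Dependence of the convolution on the wave number\<close>

lemma exp_lipschitz: "\<bar>exp a - exp b\<bar> \<le> \<bar>a - b\<bar> * exp (max a b)" for a b :: real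
proof -
  have "exp a - exp b \<le> (a - b) * exp a" for a b :: real
  proof -
    have "1 - exp (b - a) \<le> a - b" using exp_ge_add_one_self[of "b - a"] by linarith
    then have "(1 - exp (b - a)) * exp a \<le> (a - b) * exp a" by (intro mult_right_mono) auto
    then show ?thesis by (simp add: left_diff_distrib flip: exp_add)
  qed
  from this[of a b] this[of b a] show ?thesis
    by (cases "a \<le> b") (auto simp: abs_if max_def)
qed

text \<open>Varying \<kappa> costs a factor \<open>x\<close>, bounded by
  \<open>4 * exp (x / 4)\<close>. This uses up the gap between the actual growth
  \<open>exp (x / 4)\<close> and the permitted \<open>exp (x / 2)\<close>, and explains the
  restriction of \<kappa> to at most 1/4.\<close>

lemma exp_cosh_lipschitz:
  assumes "0 \<le> \<kappa>" "\<kappa> \<le> 1 / 4" "0 \<le> \<mu>" "\<mu> \<le> 1 / 4" "0 \<le> x"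
  shows "\<bar>exp_decaying \<kappa> x - exp_decaying \<mu> x\<bar> \<le> 4 * \<bar>\<kappa> - \<mu>\<bar> * exp ((1 / 2) * x)"
    "\<bar>cosh_growing \<kappa> x - cosh_growing \<mu> x\<bar> \<le> 4 * \<bar>\<kappa> - \<mu>\<bar> * exp ((1 / 2) * x)"
proof -
  have lip: "\<bar>exp (c * \<kappa> * x) - exp (c * \<mu> * x)\<bar> \<le> 4 * \<bar>\<kappa> - \<mu>\<bar> * exp ((1 / 2) * x)" if c: "\<bar>c\<bar> = 1" for c
  proof -
    have "c * \<nu> * x \<le> (1 / 4) * x" if "0 \<le> \<nu>" "\<nu> \<le> 1 / 4" for \<nu>
      using assms c that by (intro mult_right_mono) (auto simp: abs_if split: if_splits)
    from this[of \<kappa>] this[of \<mu>] have m: "max (c * \<kappa> * x) (c * \<mu> * x) \<le> (1 / 4) * x"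
      using assms by simp
    have d: "\<bar>c * \<kappa> * x - c * \<mu> * x\<bar> = \<bar>\<kappa> - \<mu>\<bar> * x"
    proof -
      have "c * \<kappa> * x - c * \<mu> * x = c * ((\<kappa> - \<mu>) * x)" by (simp add: algebra_simps)
      then show ?thesis using c assms(5) by (simp add: abs_mult)
    qed
    have x4: "x \<le> 4 * exp ((1 / 4) * x)" using exp_ge_add_one_self[of "(1 / 4) * x"] by linarith
    have "\<bar>exp (c * \<kappa> * x) - exp (c * \<mu> * x)\<bar> \<le> \<bar>\<kappa> - \<mu>\<bar> * x * exp (max (c * \<kappa> * x) (c * \<mu> * x))"
      using exp_lipschitz[of "c * \<kappa> * x" "c * \<mu> * x"] unfolding d .
    also have "\<dots> \<le> (\<bar>\<kappa> - \<mu>\<bar> * (4 * exp ((1 / 4) * x))) * exp ((1 / 4) * x)"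
      using m x4 assms(5) by (intro mult_mono mult_left_mono) auto
    also have "\<dots> = ((4 * \<bar>\<kappa> - \<mu>\<bar>) * exp ((1 / 4) * x)) * (1 * exp ((1 / 4) * x))" by simp
    also have "\<dots> = (4 * \<bar>\<kappa> - \<mu>\<bar>) * 1 * exp ((1 / 2) * x)" by (rule exp_merge) simp
    finally show ?thesis by simp
  qed
  show "\<bar>exp_decaying \<kappa> x - exp_decaying \<mu> x\<bar> \<le> 4 * \<bar>\<kappa> - \<mu>\<bar> * exp ((1 / 2) * x)"
    using lip[of "- 1"] by (simp add: exp_decaying_def)
  have avg: "\<bar>d\<bar> \<le> B" if "d = a / 2 + b / 2" "\<bar>a\<bar> \<le> B" "\<bar>b\<bar> \<le> B" for a b d B :: real
    using that unfolding abs_le_iff by linarith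
  have "cosh_growing \<kappa> x - cosh_growing \<mu> x = (exp (1 * \<kappa> * x) - exp (1 * \<mu> * x)) / 2 + (exp (- 1 * \<kappa> * x) - exp (- 1 * \<mu> * x)) / 2"
    by (simp add: cosh_growing_def cosh_field_def field_simps)
  then show "\<bar>cosh_growing \<kappa> x - cosh_growing \<mu> x\<bar> \<le> 4 * \<bar>\<kappa> - \<mu>\<bar> * exp ((1 / 2) * x)"
    by (rule avg) (rule lip, simp)+
qed

context
  fixes \<kappa> :: real
  assumes \<kappa>: "0 \<le> \<kappa>" "\<kappa> \<le> 1 / 4"
begin

lemma exp_decaying_integrable:
  assumes "half_decay K f" "0 \<le> x"
  shows "(\<lambda>y. exp_decaying \<kappa> y * (sech y * f y)) integrable_on {x..}"
  by (rule sech_weighted(1)[OF assms(1) exp_cosh_cont(1) exp_cosh_bound(1)[OF \<kappa>] assms(2)])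

text \<open>The coefficient of the source is the factor 2 in \<open>nonlocal\<close> times the
  Wronskian \<kappa>.\<close>

lemma nonlocal_derivatives:
  assumes "half_decay K f" "0 \<le> x"
  shows "(nonlocal \<kappa> f has_real_derivative nonlocal' \<kappa> f x) (at x within {0..})"
    "(nonlocal' \<kappa> f has_real_derivative \<kappa>\<^sup>2 * nonlocal \<kappa> f x - 2 * \<kappa> * (sech x * f x)) (at x within {0..})"
proof -
  have c: "continuous_on {0..} (\<lambda>y. sech y * f y)"
    by (intro continuous_intros half_decay_cont[OF assms(1)])
  note g = green_has_derivative[OF assms(2) c exp_cosh_cont(1)[where \<kappa> = \<kappa>] exp_cosh_cont(2)[where \<kappa> = \<kappa>] exp_decaying_integrable[OF assms(1)]]
  have "(green (exp_decaying \<kappa>) (cosh_growing \<kappa>) (exp_decaying \<kappa>) (cosh_growing \<kappa>) (\<lambda>y. sech y * f y) has_real_derivative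
      green (exp_decaying' \<kappa>) (cosh_growing' \<kappa>) (exp_decaying \<kappa>) (cosh_growing \<kappa>) (\<lambda>y. sech y * f y) x) (at x within {0..})"
    by (rule DERIV_cong[OF g[where r' = "exp_decaying' \<kappa>" and s' = "cosh_growing' \<kappa>", OF _ exp_cosh_derivatives(1,2)]]) auto
  then show "(nonlocal \<kappa> f has_real_derivative nonlocal' \<kappa> f x) (at x within {0..})"
    unfolding nonlocal_def[abs_def] nonlocal'_def by (rule DERIV_cmult)
  let ?G = "green (exp_decaying \<kappa>) (cosh_growing \<kappa>) (exp_decaying \<kappa>) (cosh_growing \<kappa>) (\<lambda>y. sech y * f y) x"
  have "(green (exp_decaying' \<kappa>) (cosh_growing' \<kappa>) (exp_decaying \<kappa>) (cosh_growing \<kappa>) (\<lambda>y. sech y * f y) has_real_derivative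
      \<kappa>\<^sup>2 * ?G - \<kappa> * (sech x * f x)) (at x within {0..})"
  proof (rule DERIV_cong[OF g[where r' = "\<lambda>x. \<kappa>\<^sup>2 * exp_decaying \<kappa> x" and s' = "\<lambda>x. \<kappa>\<^sup>2 * cosh_growing \<kappa> x", OF _ exp_cosh_derivatives(3,4)]])
    have "exp_decaying' \<kappa> x * cosh_growing \<kappa> x - cosh_growing' \<kappa> x * exp_decaying \<kappa> x = - \<kappa>"
      using exp_cosh_derivatives(5)[of \<kappa> x] by simp
    then show "green (\<lambda>x. \<kappa>\<^sup>2 * exp_decaying \<kappa> x) (\<lambda>x. \<kappa>\<^sup>2 * cosh_growing \<kappa> x) (exp_decaying \<kappa>) (cosh_growing \<kappa>) (\<lambda>y. sech y * f y) x
      + (exp_decaying' \<kappa> x * cosh_growing \<kappa> x - cosh_growing' \<kappa> x * exp_decaying \<kappa> x) * (sech x * f x) = \<kappa>\<^sup>2 * ?G - \<kappa> * (sech x * f x)"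
      unfolding green_def by (simp only:) (simp add: algebra_simps)
  qed auto
  from DERIV_cmult[OF this, of 2]
  show "(nonlocal' \<kappa> f has_real_derivative \<kappa>\<^sup>2 * nonlocal \<kappa> f x - 2 * \<kappa> * (sech x * f x)) (at x within {0..})"
    unfolding nonlocal_def nonlocal'_def[abs_def] by (simp add: algebra_simps)
qed

text \<open>A crude bound of order \<open>exp (x / 2)\<close> on \<open>nonlocal\<close> is enough,
  since the outer \<open>sech\<close> supplies \<open>exp (- x)\<close>. The constant does not
  depend on \<kappa>.\<close>

lemma half_decay_sech_nonlocal:
  assumes "half_decay K f"
  shows "half_decay (16 * K) (\<lambda>x. sech x * nonlocal \<kappa> f x)"
  unfolding half_decay_def
proof (intro conjI allI impI)
  have "continuous_on {0..} (nonlocal \<kappa> f)"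
    by (rule DERIV_continuous_on[OF nonlocal_derivatives(1)[OF assms]]) simp
  then show "continuous_on {0..} (\<lambda>x. sech x * nonlocal \<kappa> f x)" by (intro continuous_intros)
  fix x :: real assume x: "0 \<le> x"
  have "\<bar>nonlocal \<kappa> f x\<bar> \<le> 2 * (4 * 1 * 1 * K * exp ((1 / 2) * x))"
    unfolding nonlocal_def abs_mult using x
    by (intro mult_mono green_sech_bound[OF assms] exp_cosh_cont exp_cosh_bound \<kappa>) auto
  then have "\<bar>sech x * nonlocal \<kappa> f x\<bar> \<le> (2 * exp (- x)) * (8 * K * exp ((1 / 2) * x))"
    unfolding abs_mult using x by (intro mult_mono k2.p_bound) auto
  also have "\<dots> = 2 * (8 * K) * exp (- (1 / 2) * x)" by (rule exp_merge) simp
  finally show "\<bar>sech x * nonlocal \<kappa> f x\<bar> \<le> 16 * K * exp (- (1 / 2) * x)" by simp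
qed

lemma nonlocal_linear:
  assumes "half_decay K f" "half_decay L g" "0 \<le> x"
  shows "nonlocal \<kappa> (\<lambda>x. a * f x + b * g x) x = a * nonlocal \<kappa> f x + b * nonlocal \<kappa> g x"
proof -
  have "(\<lambda>y. sech y * (a * f y + b * g y)) = (\<lambda>y. a * (sech y * f y) + b * (sech y * g y))"
    by (simp add: fun_eq_iff algebra_simps)
  moreover have "continuous_on {0..} (\<lambda>y. sech y * f y)" "continuous_on {0..} (\<lambda>y. sech y * g y)"
    by (intro continuous_intros half_decay_cont[OF assms(1)] half_decay_cont[OF assms(2)])+
  ultimately show ?thesis
    unfolding nonlocal_def
    using green_add[OF assms(3) _ _ exp_cosh_cont(2) exp_decaying_integrable[OF assms(1,3)] exp_decaying_integrable[OF assms(2,3)]]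
    by (simp add: algebra_simps)
qed

text \<open>Genuine decay is required here because \<phi> is a multiple of this derivative. The slow
  term pairs \<open>exp (- \<kappa> x)\<close> with a bounded head integral; in the other one the
  tail outweighs \<open>sinh (\<kappa> x)\<close>.\<close>

lemma nonlocal'_bound:
  assumes "half_decay K f" "0 \<le> x"
  shows "\<bar>nonlocal' \<kappa> f x\<bar> \<le> K * exp (- \<kappa> * x) + K * exp (- (1 / 2) * x)"
proof -
  note K = half_decay_nonneg[OF assms(1)]
  have k: "0 \<le> \<kappa> * x" "\<kappa> * x \<le> (1 / 2) * x" using assms \<kappa> mult_right_mono[of \<kappa> "1 / 2" x] by auto
  have "\<bar>sinh (\<kappa> * x)\<bar> \<le> exp (\<kappa> * x)" by (rule cosh_sinh_le(2)[OF k(1)])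
  also have "\<dots> \<le> exp ((1 / 2) * x)" using k by simp
  finally have s: "\<bar>cosh_growing' \<kappa> x\<bar> \<le> (1 / 4) * exp ((1 / 2) * x)"
    using \<kappa> unfolding cosh_growing'_def abs_mult by (intro mult_mono) auto
  have "\<bar>green (exp_decaying' \<kappa>) (cosh_growing' \<kappa>) (exp_decaying \<kappa>) (cosh_growing \<kappa>) (\<lambda>y. sech y * f y) x\<bar> \<le>
      \<bar>exp_decaying' \<kappa> x\<bar> * \<bar>integral {0..x} (\<lambda>y. cosh_growing \<kappa> y * (sech y * f y))\<bar>
      + \<bar>cosh_growing' \<kappa> x\<bar> * \<bar>integral {x..} (\<lambda>y. exp_decaying \<kappa> y * (sech y * f y))\<bar>"
    unfolding green_def by (rule abs_sum_prod_le)
  also have "\<dots> \<le> (1 / 4 * exp (- \<kappa> * x)) * (2 * 1 * K) + (1 / 4 * exp ((1 / 2) * x)) * (2 * 1 * K * exp (- x))"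
  proof (intro add_mono mult_mono)
    show "\<bar>exp_decaying' \<kappa> x\<bar> \<le> 1 / 4 * exp (- \<kappa> * x)" using \<kappa> by (simp add: exp_decaying'_def abs_mult)
    show "\<bar>integral {0..x} (\<lambda>y. cosh_growing \<kappa> y * (sech y * f y))\<bar> \<le> 2 * 1 * K"
      by (rule sech_weighted(3)[OF assms(1) exp_cosh_cont(2) exp_cosh_bound(2)[OF \<kappa>] assms(2)])
    show "\<bar>integral {x..} (\<lambda>y. exp_decaying \<kappa> y * (sech y * f y))\<bar> \<le> 2 * 1 * K * exp (- x)"
      by (rule sech_weighted(2)[OF assms(1) exp_cosh_cont(1) exp_cosh_bound(1)[OF \<kappa>] assms(2)])
  qed (use s K in auto)
  also have "(1 / 4 * exp ((1 / 2) * x)) * (2 * 1 * K * exp (- x)) = 1 / 4 * (2 * 1 * K) * exp (- (1 / 2) * x)"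
    by (rule exp_merge) simp
  finally show ?thesis unfolding nonlocal'_def abs_mult by (simp add: algebra_simps)
qed

end

text \<open>Supplies the continuity in \<kappa>, hence in \<sigma>, on which the intermediate value
  theorem relies. The difference is written with coefficients 1 and -1 to fit
  \<open>half_decay_add\<close> and \<open>undamp_linear\<close>.\<close>

lemma nonlocal_lipschitz:
  assumes f: "half_decay K f" and \<kappa>: "0 \<le> \<kappa>" "\<kappa> \<le> 1 / 4" and \<mu>: "0 \<le> \<mu>" "\<mu> \<le> 1 / 4"
  shows "half_decay (128 * \<bar>\<kappa> - \<mu>\<bar> * K) (\<lambda>x. 1 * (sech x * nonlocal \<kappa> f x) + (- 1) * (sech x * nonlocal \<mu> f x))"
  unfolding half_decay_def
proof (intro conjI allI impI)
  show "continuous_on {0..} (\<lambda>x. 1 * (sech x * nonlocal \<kappa> f x) + (- 1) * (sech x * nonlocal \<mu> f x))"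
    by (rule half_decay_cont[OF half_decay_add[OF half_decay_sech_nonlocal[OF \<kappa> f] half_decay_sech_nonlocal[OF \<mu> f]]])
  fix x :: real assume x: "0 \<le> x"
  define h where "h = (\<lambda>y. sech y * f y)"
  define \<Delta>p where "\<Delta>p y = 1 * exp_decaying \<kappa> y + (- 1) * exp_decaying \<mu> y" for y
  define \<Delta>q where "\<Delta>q y = 1 * cosh_growing \<kappa> y + (- 1) * cosh_growing \<mu> y" for y
  note lip = exp_cosh_lipschitz[OF \<kappa> \<mu>]
  have cont: "continuous_on {0..} \<Delta>p" "continuous_on {0..} \<Delta>q"
    unfolding \<Delta>p_def[abs_def] \<Delta>q_def[abs_def] by (intro continuous_intros exp_cosh_cont)+
  have tail: "integral {x..} (\<lambda>y. \<Delta>p y * h y) = integral {x..} (\<lambda>y. exp_decaying \<kappa> y * h y) - integral {x..} (\<lambda>y. exp_decaying \<mu> y * h y)"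
    using integral_diff[OF exp_decaying_integrable[OF \<kappa> f x] exp_decaying_integrable[OF \<mu> f x]]
    by (simp add: \<Delta>p_def h_def left_diff_distrib)
  have "continuous_on {0..x} (\<lambda>y. cosh_growing \<nu> y * h y)" for \<nu>
    unfolding h_def using half_decay_cont[OF f]
    by (intro continuous_intros exp_cosh_cont) (auto intro: continuous_on_subset)
  then have "(\<lambda>y. cosh_growing \<nu> y * h y) integrable_on {0..x}" for \<nu>
    by (rule integrable_continuous_real)
  from integral_diff[OF this this, of \<kappa> \<mu>]
  have head: "integral {0..x} (\<lambda>y. \<Delta>q y * h y) = integral {0..x} (\<lambda>y. cosh_growing \<kappa> y * h y) - integral {0..x} (\<lambda>y. cosh_growing \<mu> y * h y)"
    by (simp add: \<Delta>q_def left_diff_distrib)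
  \<comment> \<open>The operator is bilinear in the outer and the inner pair of functions: the outer
    pair is changed first, with \<kappa> inside, then the inner one, with \<mu> outside.\<close>
  have D: "nonlocal \<kappa> f x - nonlocal \<mu> f x = 2 * (green \<Delta>p \<Delta>q (exp_decaying \<kappa>) (cosh_growing \<kappa>) h x + green (exp_decaying \<mu>) (cosh_growing \<mu>) \<Delta>p \<Delta>q h x)"
    unfolding nonlocal_def green_def h_def[symmetric] head tail by (simp add: \<Delta>p_def \<Delta>q_def algebra_simps)
  define E where "E = \<bar>\<kappa> - \<mu>\<bar> * K * exp ((1 / 2) * x)"
  have "\<bar>green \<Delta>p \<Delta>q (exp_decaying \<kappa>) (cosh_growing \<kappa>) h x\<bar> \<le> 4 * 1 * (4 * \<bar>\<kappa> - \<mu>\<bar>) * K * exp ((1 / 2) * x)"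
    unfolding h_def using lip[OF x] by (intro green_sech_bound f exp_cosh_cont exp_cosh_bound \<kappa> x) (auto simp: \<Delta>p_def \<Delta>q_def)
  then have 1: "\<bar>green \<Delta>p \<Delta>q (exp_decaying \<kappa>) (cosh_growing \<kappa>) h x\<bar> \<le> 16 * E" by (simp add: E_def)
  have "\<bar>green (exp_decaying \<mu>) (cosh_growing \<mu>) \<Delta>p \<Delta>q h x\<bar> \<le> 4 * (4 * \<bar>\<kappa> - \<mu>\<bar>) * 1 * K * exp ((1 / 2) * x)"
    unfolding h_def using lip by (intro green_sech_bound f cont exp_cosh_bound \<mu> x) (auto simp: \<Delta>p_def \<Delta>q_def)
  then have 2: "\<bar>green (exp_decaying \<mu>) (cosh_growing \<mu>) \<Delta>p \<Delta>q h x\<bar> \<le> 16 * E" by (simp add: E_def)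
  have "\<bar>nonlocal \<kappa> f x - nonlocal \<mu> f x\<bar> \<le> 64 * E"
    unfolding D using 1 2 by (simp add: abs_le_iff)
  then have "\<bar>nonlocal \<kappa> f x - nonlocal \<mu> f x\<bar> \<le> 64 * \<bar>\<kappa> - \<mu>\<bar> * K * exp ((1 / 2) * x)"
    by (simp add: E_def)
  then have "\<bar>sech x * (nonlocal \<kappa> f x - nonlocal \<mu> f x)\<bar> \<le> (2 * exp (- x)) * (64 * \<bar>\<kappa> - \<mu>\<bar> * K * exp ((1 / 2) * x))"
    unfolding abs_mult[of "sech x"] using x by (intro mult_mono k2.p_bound) auto
  also have "\<dots> = 2 * (64 * \<bar>\<kappa> - \<mu>\<bar> * K) * exp (- (1 / 2) * x)" by (rule exp_merge) simp
  finally show "\<bar>1 * (sech x * nonlocal \<kappa> f x) + (- 1) * (sech x * nonlocal \<mu> f x)\<bar>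
      \<le> 128 * \<bar>\<kappa> - \<mu>\<bar> * K * exp (- (1 / 2) * x)"
    by (simp add: right_diff_distrib)
qed

section \<open>Construction of the profiles\<close>

text \<open>With Wronskian 1 the endpoint terms give \<open>- f\<close>, so \<open>green\<close>
  inverts \<open>V\<close> minus the second derivative. This is the source of the minus signs in
  front of it in the fixed-point equations.\<close>

lemma (in green_kernel) green_solves:
  assumes f: "half_decay K f" and x: "0 \<le> x"
    and d1: "\<And>x. (p has_real_derivative p' x) (at x)" "\<And>x. (q has_real_derivative q' x) (at x)"
    and d2: "\<And>x. (p' has_real_derivative V x * p x) (at x)" "\<And>x. (q' has_real_derivative V x * q x) (at x)"
    and wronskian: "q' x * p x - p' x * q x = 1"
  shows "(green p q p q f has_real_derivative green p' q' p q f x) (at x within {0..})"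
    "(green p' q' p q f has_real_derivative V x * green p q p q f x - f x) (at x within {0..})"
proof -
  note g = green_has_derivative[OF x half_decay_cont[OF f] p_cont q_cont pf_integrable(1)[OF f]]
  show "(green p q p q f has_real_derivative green p' q' p q f x) (at x within {0..})"
    by (rule DERIV_cong[OF g[where r' = p' and s' = q', OF _ d1]]) auto
  show "(green p' q' p q f has_real_derivative V x * green p q p q f x - f x) (at x within {0..})"
  proof (rule DERIV_cong[OF g[where r' = "\<lambda>x. V x * p x" and s' = "\<lambda>x. V x * q x", OF _ d2]])
    have "p' x * q x - q' x * p x = - 1" using wronskian by simp
    then show "green (\<lambda>x. V x * p x) (\<lambda>x. V x * q x) p q f x + (p' x * q x - q' x * p x) * f x
        = V x * green p q p q f x - f x"
      unfolding green_def by (simp only:) (simp add: algebra_simps)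
  qed auto
qed

text \<open>The head integral is empty at 0, so boundary values there are pairings with the decaying
  solution. Applied to \<open>growing2'\<close> this turns orthogonality to \<open>sech\<close> into
  a vanishing derivative.\<close>

lemma green_at_0: "green r s p q f 0 = s 0 * integral {0..} (\<lambda>y. p y * f y)"
  by (simp add: green_def)

lemma sech_pairing_bounded_linear: "bounded_linear (\<lambda>w. integral {0..} (\<lambda>x. sech x * damp w x))"
proof (rule bounded_linear_intro)
  note i = k2.pf_integrable[OF damp_half_decay order_refl]
  show "integral {0..} (\<lambda>x. sech x * damp (v + w) x)
      = integral {0..} (\<lambda>x. sech x * damp v x) + integral {0..} (\<lambda>x. sech x * damp w x)" for v w
    unfolding damp_linear distrib_left by (rule integral_add[OF i(1) i(1)])
  show "integral {0..} (\<lambda>x. sech x * damp (a *\<^sub>R w) x) = a *\<^sub>R integral {0..} (\<lambda>x. sech x * damp w x)" for a w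
    unfolding damp_linear by (simp add: mult.left_commute)
  show "norm (integral {0..} (\<lambda>x. sech x * damp w x)) \<le> norm w * 2" for w
    using i(2)[of w] by (simp add: mult.commute)
qed

text \<open>In the application \<open>d\<close> is \<open>1 / sqrt \<gamma>\<^sub>3\<close> and
  \<open>c\<close> is \<open>\<gamma>\<^sub>2 / sqrt \<gamma>\<^sub>3\<close>. The result is
  \<open>coupled_system_solvable\<close> for the three concrete operators, read back from bounded
  continuous functions to plain even ones.\<close>

lemma profile_fixed_point:
  fixes c d :: real
  assumes "0 < d"
  shows "\<exists>lam\<^sub>0>0. \<forall>lam. 0 < lam \<and> lam < lam\<^sub>0 \<longrightarrow> (\<exists>\<sigma> U Z N K.
      1 / 4 \<le> \<sigma> \<and> lam * \<sigma> * d \<le> 1 / 4 \<and> half_decay K U \<and> half_decay K Z \<and>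
      (\<forall>x. N x = nonlocal (lam * \<sigma> * d) U \<bar>x\<bar>) \<and>
      (\<forall>x. U x = profile\<^sub>0 \<bar>x\<bar> - lam * green decaying1 growing1 decaying1 growing1
        (\<lambda>y. Z y + lam * \<sigma>\<^sup>2 * U y + c * \<sigma> * (sech y * N y)) \<bar>x\<bar>) \<and>
      (\<forall>x. Z x = - lam * green sech growing2 sech growing2 (\<lambda>y. - U y + \<sigma>\<^sup>2 * (sech y + lam * Z y)) \<bar>x\<bar>) \<and>
      integral {0..} (\<lambda>x. sech x * (- U x + \<sigma>\<^sup>2 * (sech x + lam * Z x))) = 0)"
proof -
  define G where "G w = undamp (green decaying1 growing1 decaying1 growing1 (damp w))" for w
  define H where "H w = undamp (green sech growing2 sech growing2 (damp w))" for w
  define M where "M \<kappa> w = undamp ((\<lambda>f x. sech x * nonlocal \<kappa> f x) (damp w))" for \<kappa> w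
  define L where "L w = integral {0..} (\<lambda>x. sech x * damp w x)" for w
  have hd1: "half_decay (60 * K) (green decaying1 growing1 decaying1 growing1 f)" if "half_decay K f" for K f
    using k1.green_half_decay[OF that kernel1_derivatives(1,2)] by simp
  have hd2: "half_decay (60 * K) (green sech growing2 sech growing2 f)" if "half_decay K f" for K f
    using k2.green_half_decay[OF that kernel2_derivatives(1,2)] by simp
  have G: "bounded_linear G" "damp (G w) x = green decaying1 growing1 decaying1 growing1 (damp w) \<bar>x\<bar>" for w x
    unfolding G_def by (rule undamped_operator_linear(1,3)[OF hd1 k1.green_linear]; assumption)+
  have H: "bounded_linear H" "damp (H w) x = green sech growing2 sech growing2 (damp w) \<bar>x\<bar>" for w x
    unfolding H_def by (rule undamped_operator_linear(1,3)[OF hd2 k2.green_linear]; assumption)+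
  have M: "bounded_linear (M \<kappa>)" "norm (M \<kappa> w) \<le> 16 * norm w"
    "damp (M \<kappa> w) x = sech x * nonlocal \<kappa> (damp w) \<bar>x\<bar>" if "0 \<le> \<kappa>" "\<kappa> \<le> 1 / 4" for \<kappa> w x
  proof -
    have lin: "sech x * nonlocal \<kappa> (\<lambda>x. a * f x + b * g x) x
      = a * (sech x * nonlocal \<kappa> f x) + b * (sech x * nonlocal \<kappa> g x)"
      if "half_decay K f" "half_decay L g" "0 \<le> x" for K L f g a b x
      by (simp add: nonlocal_linear[OF \<open>0 \<le> \<kappa>\<close> \<open>\<kappa> \<le> 1 / 4\<close> that] algebra_simps)
    note op = undamped_operator_linear[where T = "\<lambda>f x. sech x * nonlocal \<kappa> f x", OF half_decay_sech_nonlocal[OF that] lin]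
    show "bounded_linear (M \<kappa>)" unfolding M_def by (rule op(1))
    show "norm (M \<kappa> w) \<le> 16 * norm w" unfolding M_def by (rule op(2))
    show "damp (M \<kappa> w) x = sech x * nonlocal \<kappa> (damp w) \<bar>x\<bar>" unfolding M_def using op(3)[where w = w and x = x] by simp
  qed
  have M_cont: "continuous_on {0..1 / 4} (\<lambda>\<kappa>. M \<kappa> w)" for w
  proof -
    have lip: "norm (M \<kappa> w - M \<mu> w) \<le> 128 * \<bar>\<kappa> - \<mu>\<bar> * norm w" if k: "\<kappa> \<in> {0..1 / 4}" "\<mu> \<in> {0..1 / 4}" for \<kappa> \<mu>
    proof -
      have k': "0 \<le> \<kappa>" "\<kappa> \<le> 1 / 4" "0 \<le> \<mu>" "\<mu> \<le> 1 / 4" using k by auto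
      note h = nonlocal_lipschitz[OF damp_half_decay[of w] k']
      have "undamp (\<lambda>x. 1 * (sech x * nonlocal \<kappa> (damp w) x) + (- 1) * (sech x * nonlocal \<mu> (damp w) x))
        = 1 *\<^sub>R M \<kappa> w + (- 1) *\<^sub>R M \<mu> w"
        unfolding M_def
        by (rule undamp_linear[OF half_decay_sech_nonlocal[OF k'(1,2) damp_half_decay]
          half_decay_sech_nonlocal[OF k'(3,4) damp_half_decay] h]) (rule refl)
      then show ?thesis using norm_undamp[OF h] by simp
    qed
    show ?thesis unfolding continuous_on_iff
    proof (intro ballI allI impI)
      fix \<kappa> e :: real assume \<kappa>: "\<kappa> \<in> {0..1 / 4}" and e: "0 < e"
      define \<delta> where "\<delta> = e / (128 * (norm w + 1))"
      have \<delta>: "0 < \<delta>" "128 * \<delta> * (norm w + 1) = e"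
        using e add_nonneg_pos[OF norm_ge_zero[of w] zero_less_one] unfolding \<delta>_def by (simp_all add: field_simps)
      have "dist (M \<mu> w) (M \<kappa> w) < e" if "\<mu> \<in> {0..1 / 4}" "dist \<mu> \<kappa> < \<delta>" for \<mu>
      proof -
        have "norm (M \<mu> w - M \<kappa> w) \<le> 128 * \<bar>\<mu> - \<kappa>\<bar> * norm w" by (rule lip[OF that(1) \<kappa>])
        also have "\<dots> \<le> 128 * \<delta> * norm w" using that by (intro mult_right_mono) (auto simp: dist_real_def)
        also have "\<dots> < 128 * \<delta> * (norm w + 1)" using \<delta>(1) by (intro mult_strict_left_mono) auto
        finally show ?thesis using \<delta>(2) by (simp add: dist_norm)
      qed
      then show "\<exists>d>0. \<forall>\<mu>\<in>{0..1 / 4}. dist \<mu> \<kappa> < d \<longrightarrow> dist (M \<mu> w) (M \<kappa> w) < e" using \<delta>(1) by blast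
    qed
  qed
  have s: "damp (undamp sech) x = sech x" for x
    using damp_undamp[OF half_decay_sech] by simp
  have L: "L (undamp sech) = 1" "L (undamp profile\<^sub>0) = 1 / 4"
  proof -
    show "L (undamp sech) = 1" unfolding L_def s by (rule sech_pairings)
    have "L (undamp profile\<^sub>0) = integral {0..} (\<lambda>x. sech x * profile\<^sub>0 x)"
      unfolding L_def damp_undamp[OF half_decay_profile\<^sub>0] by (intro integral_cong) simp
    then show "L (undamp profile\<^sub>0) = 1 / 4" by (simp add: sech_pairings)
  qed
  have "bounded_linear L" unfolding L_def by (rule sech_pairing_bounded_linear)
  note solve = coupled_system_solvable[OF G(1) H(1) this bounded_linear.linear[OF M(1)] M(2) M_cont _ assms L, of c]
  obtain lam\<^sub>0 where lam\<^sub>0: "0 < lam\<^sub>0" and ex: "\<And>lam. 0 < lam \<Longrightarrow> lam < lam\<^sub>0 \<Longrightarrow> \<exists>\<sigma> u z. 1 / 4 \<le> \<sigma> \<and> \<sigma> \<le> 1 \<and> lam * \<sigma> * d \<le> 1 / 4 \<and>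
      u = undamp profile\<^sub>0 - lam *\<^sub>R G (z + (lam * \<sigma>\<^sup>2) *\<^sub>R u + (c * \<sigma>) *\<^sub>R M (lam * \<sigma> * d) u) \<and>
      z = - lam *\<^sub>R H (- u + \<sigma>\<^sup>2 *\<^sub>R (undamp sech + lam *\<^sub>R z)) \<and>
      L (- u + \<sigma>\<^sup>2 *\<^sub>R (undamp sech + lam *\<^sub>R z)) = 0"
    by (rule exE[OF solve], assumption, assumption, assumption, assumption, simp, blast)
  have main: "\<exists>\<sigma> U Z N K. 1 / 4 \<le> \<sigma> \<and> lam * \<sigma> * d \<le> 1 / 4 \<and> half_decay K U \<and> half_decay K Z \<and>
      (\<forall>x. N x = nonlocal (lam * \<sigma> * d) U \<bar>x\<bar>) \<and>
      (\<forall>x. U x = profile\<^sub>0 \<bar>x\<bar> - lam * green decaying1 growing1 decaying1 growing1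
        (\<lambda>y. Z y + lam * \<sigma>\<^sup>2 * U y + c * \<sigma> * (sech y * N y)) \<bar>x\<bar>) \<and>
      (\<forall>x. Z x = - lam * green sech growing2 sech growing2 (\<lambda>y. - U y + \<sigma>\<^sup>2 * (sech y + lam * Z y)) \<bar>x\<bar>) \<and>
      integral {0..} (\<lambda>x. sech x * (- U x + \<sigma>\<^sup>2 * (sech x + lam * Z x))) = 0"
    if lam: "0 < lam \<and> lam < lam\<^sub>0" for lam
  proof -
    from lam obtain \<sigma> u z where \<sigma>: "1 / 4 \<le> \<sigma>" "lam * \<sigma> * d \<le> 1 / 4"
      and u: "u = undamp profile\<^sub>0 - lam *\<^sub>R G (z + (lam * \<sigma>\<^sup>2) *\<^sub>R u + (c * \<sigma>) *\<^sub>R M (lam * \<sigma> * d) u)"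
      and z: "z = - lam *\<^sub>R H (- u + \<sigma>\<^sup>2 *\<^sub>R (undamp sech + lam *\<^sub>R z))"
      and l: "L (- u + \<sigma>\<^sup>2 *\<^sub>R (undamp sech + lam *\<^sub>R z)) = 0"
      using ex[of lam] by blast
    define U where "U = damp u"
    define Z where "Z = damp z"
    define N where "N x = nonlocal (lam * \<sigma> * d) U \<bar>x\<bar>" for x
    define f where "f = z + (lam * \<sigma>\<^sup>2) *\<^sub>R u + (c * \<sigma>) *\<^sub>R M (lam * \<sigma> * d) u"
    define g where "g = - u + \<sigma>\<^sup>2 *\<^sub>R (undamp sech + lam *\<^sub>R z)"
    have "0 \<le> lam * \<sigma> * d" using lam \<sigma> assms by simp
    from M(3)[OF this \<sigma>(2)] have f: "damp f = (\<lambda>y. Z y + lam * \<sigma>\<^sup>2 * U y + c * \<sigma> * (sech y * N y))"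
      by (simp add: f_def fun_eq_iff damp_linear U_def Z_def N_def)
    have g: "damp g = (\<lambda>y. - U y + \<sigma>\<^sup>2 * (sech y + lam * Z y))"
      by (simp add: g_def fun_eq_iff damp_linear U_def Z_def s)
    have "U x = profile\<^sub>0 \<bar>x\<bar> - lam * green decaying1 growing1 decaying1 growing1 (damp f) \<bar>x\<bar>" for x
    proof -
      have "damp u x = damp (undamp profile\<^sub>0 - lam *\<^sub>R G f) x" using u unfolding f_def[symmetric] by simp
      then show ?thesis by (simp add: U_def damp_linear G(2) damp_undamp[OF half_decay_profile\<^sub>0])
    qed
    moreover have "Z x = - lam * green sech growing2 sech growing2 (damp g) \<bar>x\<bar>" for x
    proof -
      have "damp z x = damp (- lam *\<^sub>R H g) x" using z unfolding g_def[symmetric] by simp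
      then show ?thesis by (simp add: Z_def damp_linear H(2))
    qed
    moreover have "integral {0..} (\<lambda>x. sech x * damp g x) = 0"
      using l unfolding g_def[symmetric] L_def .
    moreover have "half_decay (max (norm u) (norm z)) U" "half_decay (max (norm u) (norm z)) Z"
      using damp_half_decay[of u] damp_half_decay[of z] unfolding U_def Z_def half_decay_def
      by (auto intro: order_trans mult_right_mono)
    ultimately show ?thesis
      using \<sigma> N_def unfolding f g by blast
  qed
  show ?thesis
    by (rule exI[of _ lam\<^sub>0], rule conjI, rule lam\<^sub>0, intro allI impI, rule main)
qed

section \<open>From integral equations on the half-line to differential equations on the
  line\<close>

lemma half_decay_cong: "half_decay K f \<Longrightarrow> (\<And>x. 0 \<le> x \<Longrightarrow> f x = g x) \<Longrightarrow> half_decay K g"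
  unfolding half_decay_def by (metis atLeast_iff continuous_on_cong)

lemma even_half_decay_bound: "half_decay K f \<Longrightarrow> f \<bar>x\<bar> = f x \<Longrightarrow> \<bar>f x\<bar> \<le> K * exp (- (1 / 2) * \<bar>x\<bar>)"
  using half_decay_bound[of K f "\<bar>x\<bar>"] by simp

text \<open>The integral equations determine the functions on the half-line, and reflection carries
  the differential equations to the whole line. \<open>Z 0 = 0\<close> is recorded because it later
  shows that the solution is nonzero at the origin.\<close>

lemma profile_equations:
  fixes c d :: real
  assumes d: "0 < d"
  shows "\<exists>lam\<^sub>0>0. \<forall>lam. 0 < lam \<and> lam < lam\<^sub>0 \<longrightarrow> (\<exists>\<sigma> U U' Z Z' N N' K.
      0 < \<sigma> \<and> Z 0 = 0 \<and>
      (\<forall>x. \<bar>U x\<bar> \<le> K * exp (- (1 / 2) * \<bar>x\<bar>) \<and> \<bar>Z x\<bar> \<le> K * exp (- (1 / 2) * \<bar>x\<bar>) \<and>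
        \<bar>N' x\<bar> \<le> K * exp (- (lam * \<sigma> * d) * \<bar>x\<bar>) + K * exp (- (1 / 2) * \<bar>x\<bar>)) \<and>
      (\<forall>x. (U has_real_derivative U' x) (at x) \<and> (Z has_real_derivative Z' x) (at x) \<and>
        (N has_real_derivative N' x) (at x) \<and>
        (U' has_real_derivative (1 - 6 * (sech x)\<^sup>2) * U x + sech x
          + lam * (Z x + lam * \<sigma>\<^sup>2 * U x + c * \<sigma> * (sech x * N x))) (at x) \<and>
        (Z' has_real_derivative (1 - 2 * (sech x)\<^sup>2) * Z x + lam * (- U x + \<sigma>\<^sup>2 * (sech x + lam * Z x))) (at x) \<and>
        (N' has_real_derivative (lam * \<sigma> * d)\<^sup>2 * N x - 2 * (lam * \<sigma> * d) * (sech x * U x)) (at x)))"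
proof -
  obtain lam\<^sub>0 where lam\<^sub>0: "0 < lam\<^sub>0" and ex: "\<And>lam. 0 < lam \<Longrightarrow> lam < lam\<^sub>0 \<Longrightarrow> \<exists>\<sigma> U Z N K.
      1 / 4 \<le> \<sigma> \<and> lam * \<sigma> * d \<le> 1 / 4 \<and> half_decay K U \<and> half_decay K Z \<and>
      (\<forall>x. N x = nonlocal (lam * \<sigma> * d) U \<bar>x\<bar>) \<and>
      (\<forall>x. U x = profile\<^sub>0 \<bar>x\<bar> - lam * green decaying1 growing1 decaying1 growing1
        (\<lambda>y. Z y + lam * \<sigma>\<^sup>2 * U y + c * \<sigma> * (sech y * N y)) \<bar>x\<bar>) \<and>
      (\<forall>x. Z x = - lam * green sech growing2 sech growing2 (\<lambda>y. - U y + \<sigma>\<^sup>2 * (sech y + lam * Z y)) \<bar>x\<bar>) \<and>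
      integral {0..} (\<lambda>x. sech x * (- U x + \<sigma>\<^sup>2 * (sech x + lam * Z x))) = 0"
    using profile_fixed_point[OF d, of c] by blast
  have main: "\<exists>\<sigma> U U' Z Z' N N' K.
      0 < \<sigma> \<and> Z 0 = 0 \<and>
      (\<forall>x. \<bar>U x\<bar> \<le> K * exp (- (1 / 2) * \<bar>x\<bar>) \<and> \<bar>Z x\<bar> \<le> K * exp (- (1 / 2) * \<bar>x\<bar>) \<and>
        \<bar>N' x\<bar> \<le> K * exp (- (lam * \<sigma> * d) * \<bar>x\<bar>) + K * exp (- (1 / 2) * \<bar>x\<bar>)) \<and>
      (\<forall>x. (U has_real_derivative U' x) (at x) \<and> (Z has_real_derivative Z' x) (at x) \<and>
        (N has_real_derivative N' x) (at x) \<and>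
        (U' has_real_derivative (1 - 6 * (sech x)\<^sup>2) * U x + sech x
          + lam * (Z x + lam * \<sigma>\<^sup>2 * U x + c * \<sigma> * (sech x * N x))) (at x) \<and>
        (Z' has_real_derivative (1 - 2 * (sech x)\<^sup>2) * Z x + lam * (- U x + \<sigma>\<^sup>2 * (sech x + lam * Z x))) (at x) \<and>
        (N' has_real_derivative (lam * \<sigma> * d)\<^sup>2 * N x - 2 * (lam * \<sigma> * d) * (sech x * U x)) (at x))"
    if lam: "0 < lam \<and> lam < lam\<^sub>0" for lam
  proof -
    from lam obtain \<sigma> U Z N K where \<sigma>: "1 / 4 \<le> \<sigma>" "lam * \<sigma> * d \<le> 1 / 4"
      and U: "half_decay K U" and Z: "half_decay K Z"
      and Neq: "\<And>x. N x = nonlocal (lam * \<sigma> * d) U \<bar>x\<bar>"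
      and Ueq: "\<And>x. U x = profile\<^sub>0 \<bar>x\<bar> - lam * green decaying1 growing1 decaying1 growing1
        (\<lambda>y. Z y + lam * \<sigma>\<^sup>2 * U y + c * \<sigma> * (sech y * N y)) \<bar>x\<bar>"
      and Zeq: "\<And>x. Z x = - lam * green sech growing2 sech growing2 (\<lambda>y. - U y + \<sigma>\<^sup>2 * (sech y + lam * Z y)) \<bar>x\<bar>"
      and I: "integral {0..} (\<lambda>x. sech x * (- U x + \<sigma>\<^sup>2 * (sech x + lam * Z x))) = 0"
      using ex[of lam] by blast
    define \<kappa> where "\<kappa> = lam * \<sigma> * d"
    have \<kappa>: "0 \<le> \<kappa>" "\<kappa> \<le> 1 / 4" using lam \<sigma> d by (simp_all add: \<kappa>_def)
    have even: "U \<bar>x\<bar> = U x" "Z \<bar>x\<bar> = Z x" "N \<bar>x\<bar> = N x" for x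
      by (simp only: Ueq[of "\<bar>x\<bar>"] Ueq[of x] abs_idempotent, simp only: Zeq[of "\<bar>x\<bar>"] Zeq[of x] abs_idempotent,
        simp only: Neq abs_idempotent)
    define f where "f y = Z y + lam * \<sigma>\<^sup>2 * U y + c * \<sigma> * (sech y * N y)" for y
    define g where "g y = - U y + \<sigma>\<^sup>2 * (sech y + lam * Z y)" for y
    have sN: "half_decay (16 * K) (\<lambda>x. sech x * N x)"
      by (rule half_decay_cong[OF half_decay_sech_nonlocal[OF \<kappa> U]]) (simp add: Neq \<kappa>_def)
    obtain Kf where f: "half_decay Kf f"
      using half_decay_add[OF half_decay_add[OF Z U, of 1 "lam * \<sigma>\<^sup>2"] sN, of 1 "c * \<sigma>"]
      unfolding f_def[abs_def] by simp
    obtain Kg where g: "half_decay Kg g"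
      using half_decay_add[OF U half_decay_add[OF half_decay_sech Z, of 1 lam], of "- 1" "\<sigma>\<^sup>2"]
      unfolding g_def[abs_def] by simp
    define F where "F x = profile\<^sub>0 x - lam * green decaying1 growing1 decaying1 growing1 f x" for x
    define F' where "F' x = profile\<^sub>0' x - lam * green decaying1' growing1' decaying1 growing1 f x" for x
    define J where "J x = - lam * green sech growing2 sech growing2 g x" for x
    define J' where "J' x = - lam * green decaying2' growing2' sech growing2 g x" for x
    have UF: "U = (\<lambda>x. F \<bar>x\<bar>)" and ZJ: "Z = (\<lambda>x. J \<bar>x\<bar>)" and NN: "N = (\<lambda>x. nonlocal \<kappa> U \<bar>x\<bar>)"
      unfolding F_def J_def f_def[abs_def] g_def[abs_def] \<kappa>_def
      by (rule ext, rule Ueq, rule ext, rule Zeq, rule ext, rule Neq)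
    have F: "(F has_real_derivative F' x) (at x within {0..})"
      "(F' has_real_derivative (1 - 6 * (sech x)\<^sup>2) * F x + sech x + lam * f x) (at x within {0..})" if "0 \<le> x" for x
    proof -
      note s = k1.green_solves[where V = "\<lambda>x. 1 - 6 * (sech x)\<^sup>2", OF f that kernel1_derivatives(1-5)]
      note p = has_field_derivative_at_within[OF profile\<^sub>0_derivatives(1)] has_field_derivative_at_within[OF profile\<^sub>0_derivatives(2)]
      show "(F has_real_derivative F' x) (at x within {0..})"
        unfolding F_def[abs_def] F'_def by (rule DERIV_diff[OF p(1) DERIV_cmult[OF s(1)]])
      show "(F' has_real_derivative (1 - 6 * (sech x)\<^sup>2) * F x + sech x + lam * f x) (at x within {0..})"
        unfolding F'_def[abs_def] F_def
        by (rule DERIV_cong[OF DERIV_diff[OF p(2) DERIV_cmult[OF s(2)]]]) (simp add: algebra_simps)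
    qed
    have J: "(J has_real_derivative J' x) (at x within {0..})"
      "(J' has_real_derivative (1 - 2 * (sech x)\<^sup>2) * J x + lam * g x) (at x within {0..})" if "0 \<le> x" for x
    proof -
      note s = k2.green_solves[where V = "\<lambda>x. 1 - 2 * (sech x)\<^sup>2", OF g that kernel2_derivatives(1-5)]
      show "(J has_real_derivative J' x) (at x within {0..})"
        unfolding J_def[abs_def] J'_def by (rule DERIV_cmult[OF s(1)])
      show "(J' has_real_derivative (1 - 2 * (sech x)\<^sup>2) * J x + lam * g x) (at x within {0..})"
        unfolding J'_def[abs_def] J_def
        by (rule DERIV_cong[OF DERIV_cmult[OF s(2)]]) (simp add: algebra_simps)
    qed
    \<comment> \<open>The derivative at 0 vanishes for three different reasons: \<open>F'\<close>
      because \<open>growing1\<close> is even, \<open>J'\<close> because \<sigma> was chosen to make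
      the pairing with \<open>sech\<close> vanish, and \<open>nonlocal'\<close> because
      \<open>sinh 0 = 0\<close>.\<close>
    have F'0: "F' 0 = 0" by (simp add: F'_def green_at_0 profile\<^sub>0_derivatives(3) kernel1_derivatives(6))
    have J'0: "J' 0 = 0" using I by (simp add: J'_def green_at_0 g_def)
    have N'0: "nonlocal' \<kappa> U 0 = 0" by (simp add: nonlocal'_def green_at_0 cosh_growing'_def)
    have h1: "Z 0 = 0" unfolding ZJ by (simp add: J_def green_at_0 kernel2_derivatives(6))
    have h2: "0 < \<sigma>" using \<sigma> by simp
    have h3: "\<bar>U x\<bar> \<le> K * exp (- (1 / 2) * \<bar>x\<bar>)" "\<bar>Z x\<bar> \<le> K * exp (- (1 / 2) * \<bar>x\<bar>)" for x
      by (rule even_half_decay_bound[OF U even(1)], rule even_half_decay_bound[OF Z even(2)])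
    have h4: "\<bar>sgn x * nonlocal' \<kappa> U \<bar>x\<bar>\<bar> \<le> K * exp (- (lam * \<sigma> * d) * \<bar>x\<bar>) + K * exp (- (1 / 2) * \<bar>x\<bar>)" for x
    proof -
      have "\<bar>sgn x * nonlocal' \<kappa> U \<bar>x\<bar>\<bar> \<le> \<bar>nonlocal' \<kappa> U \<bar>x\<bar>\<bar>" by (simp add: abs_mult abs_sgn_eq)
      also have "\<dots> \<le> K * exp (- \<kappa> * \<bar>x\<bar>) + K * exp (- (1 / 2) * \<bar>x\<bar>)"
        by (rule nonlocal'_bound[OF \<kappa> U abs_ge_zero])
      finally show ?thesis unfolding \<kappa>_def .
    qed
    have h5: "(U has_real_derivative sgn x * F' \<bar>x\<bar>) (at x)" "(Z has_real_derivative sgn x * J' \<bar>x\<bar>) (at x)"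
      "(N has_real_derivative sgn x * nonlocal' \<kappa> U \<bar>x\<bar>) (at x)" for x
      using has_derivative_even_extension(1)[OF F F'0] has_derivative_even_extension(1)[OF J J'0]
        has_derivative_even_extension(1)[OF nonlocal_derivatives[OF \<kappa> U] N'0] UF ZJ NN by metis+
    have h6: "((\<lambda>x. sgn x * F' \<bar>x\<bar>) has_real_derivative (1 - 6 * (sech x)\<^sup>2) * U x + sech x
          + lam * (Z x + lam * \<sigma>\<^sup>2 * U x + c * \<sigma> * (sech x * N x))) (at x)" for x
      by (rule DERIV_cong[OF has_derivative_even_extension(2)[OF F F'0]])
        (simp_all add: f_def even fun_cong[OF UF, symmetric])
    have h7: "((\<lambda>x. sgn x * J' \<bar>x\<bar>) has_real_derivative
        (1 - 2 * (sech x)\<^sup>2) * Z x + lam * (- U x + \<sigma>\<^sup>2 * (sech x + lam * Z x))) (at x)" for x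
      by (rule DERIV_cong[OF has_derivative_even_extension(2)[OF J J'0]])
        (simp_all add: g_def even fun_cong[OF ZJ, symmetric])
    have h8: "((\<lambda>x. sgn x * nonlocal' \<kappa> U \<bar>x\<bar>) has_real_derivative
        (lam * \<sigma> * d)\<^sup>2 * N x - 2 * (lam * \<sigma> * d) * (sech x * U x)) (at x)" for x
      by (rule DERIV_cong[OF has_derivative_even_extension(2)[OF nonlocal_derivatives[OF \<kappa> U] N'0]])
        (simp_all add: even fun_cong[OF NN, symmetric] \<kappa>_def Neq)
    show ?thesis
      by (intro exI[of _ \<sigma>] exI[of _ U] exI[of _ "\<lambda>x. sgn x * F' \<bar>x\<bar>"] exI[of _ Z] exI[of _ "\<lambda>x. sgn x * J' \<bar>x\<bar>"]
        exI[of _ N] exI[of _ "\<lambda>x. sgn x * nonlocal' \<kappa> U \<bar>x\<bar>"] exI[of _ K] conjI allI) (rule h1 h2 h3 h4 h5 h6 h7 h8)+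
  qed
  show ?thesis
    by (rule exI[of _ lam\<^sub>0], rule conjI, rule lam\<^sub>0, intro allI impI, rule main)
qed

section \<open>Separated solutions\<close>

text \<open>The \<open>y\<close>-factor is real and the other two lie in a normed field, so that one
  notion covers the complex component and the real one. Partial derivatives stay in this form, which
  reduces membership in \<open>class_C2\<close> to one-variable facts.\<close>

definition separable :: "(real \<Rightarrow> 'a) \<Rightarrow> (real \<Rightarrow> real) \<Rightarrow> (real \<Rightarrow> 'a) \<Rightarrow> real \<Rightarrow> real \<Rightarrow> real \<Rightarrow> 'a::real_normed_field"
  where "separable a b c x y t = b y *\<^sub>R (c t * a x)"

lemma separable_has_derivatives:
  shows "(a has_vector_derivative a') (at x) \<Longrightarrow>
      ((\<lambda>s. separable a b c s y t) has_vector_derivative b y *\<^sub>R (c t * a')) (at x)"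
    and "(b has_vector_derivative b') (at y) \<Longrightarrow>
      ((\<lambda>s. separable a b c x s t) has_vector_derivative b' *\<^sub>R (c t * a x)) (at y)"
    and "(c has_vector_derivative c') (at t) \<Longrightarrow>
      ((\<lambda>s. separable a b c x y s) has_vector_derivative b y *\<^sub>R (c' * a x)) (at t)"
  unfolding separable_def
  by (auto intro!: derivative_eq_intros simp: has_real_derivative_iff_has_vector_derivative)

lemma
  assumes a: "\<And>x. (a has_vector_derivative a' x) (at x)"
    and b: "\<And>x. (b has_vector_derivative b' x) (at x)"
    and c: "\<And>x. (c has_vector_derivative c' x) (at x)"
  shows partial_separable: "partial_x (separable a b c) = separable a' b c"
      "partial_y (separable a b c) = separable a b' c" "partial_t (separable a b c) = separable a b c'"
    and class_C1_separable: "continuous_on UNIV a' \<Longrightarrow> continuous_on UNIV b' \<Longrightarrow> continuous_on UNIV c' \<Longrightarrow>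
      class_C1 (separable a b c)"
proof -
  note d = separable_has_derivatives(1)[OF a] separable_has_derivatives(2)[OF b] separable_has_derivatives(3)[OF c]
  show p: "partial_x (separable a b c) = separable a' b c"
    "partial_y (separable a b c) = separable a b' c" "partial_t (separable a b c) = separable a b c'"
    by (intro ext, simp add: separable_def partial_x_eq[OF d(1)] partial_y_eq[OF d(2)] partial_t_eq[OF d(3)])+
  have cont: "continuous_on UNIV a" "continuous_on UNIV b" "continuous_on UNIV c"
    using a b c by (auto intro!: continuous_at_imp_continuous_on has_vector_derivative_continuous)
  have sep: "continuous_on UNIV (\<lambda>(x, y, t). separable f g h x y t)"
    if "continuous_on UNIV f" "continuous_on UNIV g" "continuous_on UNIV h" for f h :: "real \<Rightarrow> 'a" and g
    unfolding separable_def split_beta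
    by (intro continuous_intros continuous_on_compose2[OF that(1)] continuous_on_compose2[OF that(2)]
      continuous_on_compose2[OF that(3)]) auto
  show "class_C1 (separable a b c)"
    if "continuous_on UNIV a'" "continuous_on UNIV b'" "continuous_on UNIV c'"
    unfolding class_C1_def partially_differentiable_def p
    by (intro conjI allI sep cont that differentiableI_vector[OF d(1)] differentiableI_vector[OF d(2)]
      differentiableI_vector[OF d(3)])
qed

lemma class_C2_separable:
  assumes a: "\<And>x. (a has_vector_derivative a' x) (at x)" "\<And>x. (a' has_vector_derivative a'' x) (at x)" "continuous_on UNIV a''"
    and b: "\<And>x. (b has_vector_derivative b' x) (at x)" "\<And>x. (b' has_vector_derivative b'' x) (at x)" "continuous_on UNIV b''"
    and c: "\<And>x. (c has_vector_derivative c' x) (at x)" "\<And>x. (c' has_vector_derivative c'' x) (at x)" "continuous_on UNIV c''"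
  shows "class_C2 (separable a b c)"
proof -
  have "continuous_on UNIV a'" "continuous_on UNIV b'" "continuous_on UNIV c'"
    using a b c by (auto intro!: continuous_at_imp_continuous_on has_vector_derivative_continuous)
  then show ?thesis
    unfolding class_C2_def partial_separable[OF a(1) b(1) c(1)]
    using class_C1_separable[OF a(1) b(1) c(1)] class_C1_separable[OF a(2) b(1) c(1)]
      class_C1_separable[OF a(1) b(2) c(1)] class_C1_separable[OF a(1) b(1) c(2)] assms by blast
qed

text \<open>Two rates are allowed for the sake of \<phi>, whose bound mixes \<kappa> and 1/2. The
  limit is uniform because the bound is free of \<open>y\<close>.\<close>

lemma decays_in_x_exp:
  fixes f :: "real \<Rightarrow> real \<Rightarrow> 'a::real_normed_vector"
  assumes "0 < a" "0 < b" "\<And>x y. norm (f x y) \<le> K * exp (- a * \<bar>x\<bar>) + M * exp (- b * \<bar>x\<bar>)"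
  shows "decays_in_x f"
proof -
  define h where "h x = K * exp (- a * \<bar>x\<bar>) + M * exp (- b * \<bar>x\<bar>)" for x :: real
  have e: "((\<lambda>x. k * exp (- c * x)) \<longlongrightarrow> 0) at_top" if "0 < c" for k c :: real
    using that by real_asymp
  have "((\<lambda>x. K * exp (- a * x) + M * exp (- b * x)) \<longlongrightarrow> 0) at_top"
    using tendsto_add[OF e[OF assms(1)] e[OF assms(2)]] by simp
  then have top: "(h \<longlongrightarrow> 0) at_top"
    by (rule Lim_transform_eventually) (rule eventually_at_top_linorderI[of 0], simp add: h_def)
  have "((\<lambda>x. h (- x)) \<longlongrightarrow> 0) at_bot"
    by (rule filterlim_compose[OF top filterlim_uminus_at_top_at_bot])
  then have bot: "(h \<longlongrightarrow> 0) at_bot" by (simp add: h_def[abs_def])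
  have "uniform_limit UNIV f (\<lambda>y. 0) F" if h: "(h \<longlongrightarrow> 0) F" for F
  proof (rule uniform_limitI)
    fix e :: real assume "0 < e"
    with h have "\<forall>\<^sub>F x in F. h x < e" by (rule order_tendstoD(2))
    then show "\<forall>\<^sub>F x in F. \<forall>y\<in>UNIV. dist (f x y) 0 < e"
      by eventually_elim (use assms(3) in \<open>auto simp: h_def intro: le_less_trans\<close>)
  qed
  with top bot show ?thesis unfolding decays_in_x_def by blast
qed

lemma has_vector_derivative_Complex:
  assumes "(u has_real_derivative u') F" "(v has_real_derivative v') F"
  shows "((\<lambda>x. Complex (u x) (v x)) has_vector_derivative Complex u' v') F"
proof -
  have "((\<lambda>x. complex_of_real (u x) + \<i> * complex_of_real (v x)) has_vector_derivative of_real u' + \<i> * of_real v') F"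
    using assms by (intro has_vector_derivative_add has_vector_derivative_mult_right has_vector_derivative_of_real)
  then show ?thesis unfolding Complex_eq .
qed

text \<open>The phase \<open>exp (\<i> t)\<close> cancels inside \<open>Re\<close>, which therefore
  sees only \<open>u\<close>. Factoring \<open>exp ((lam + \<i>) t) cos (\<omega> y)\<close> out of
  the first equation leaves \<open>eq1\<close> as its real and \<open>eq2\<close> as its imaginary
  part.\<close>

lemma linDS_solution_separated:
  fixes u v P :: "real \<Rightarrow> real" and lam \<omega> :: real
  defines "B \<equiv> \<lambda>x y t. exp (of_real (lam * t) + \<i> * of_real t) * (of_real (cos (\<omega> * y)) * Complex (u x) (v x))"
    and "\<phi> \<equiv> \<lambda>x y t. exp (lam * t) * (cos (\<omega> * y) * P x)"
  assumes u: "\<And>x. (u has_real_derivative u' x) (at x)" "\<And>x. (u' has_real_derivative u'' x) (at x)" "continuous_on UNIV u''"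
    and v: "\<And>x. (v has_real_derivative v' x) (at x)" "\<And>x. (v' has_real_derivative v'' x) (at x)" "continuous_on UNIV v''"
    and P: "\<And>x. (P has_real_derivative P' x) (at x)" "\<And>x. (P' has_real_derivative P'' x) (at x)" "continuous_on UNIV P''"
    and eq1: "\<And>x. u'' x - (1 + \<omega>\<^sup>2) * u x + (2 + 2 * \<gamma>\<^sub>1) * (sech x)\<^sup>2 * u x + \<gamma>\<^sub>2 * sech x * P' x = lam * v x"
    and eq2: "\<And>x. v'' x - (1 + \<omega>\<^sup>2) * v x + 2 * (sech x)\<^sup>2 * v x = - lam * u x"
    and eq3: "\<And>x. \<gamma>\<^sub>3 * P'' x - \<omega>\<^sup>2 * P x = 2 * \<gamma>\<^sub>3 * (sech x * u' x - sech x * tanh x * u x)"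
  shows "linDS_solution \<gamma>\<^sub>1 \<gamma>\<^sub>2 \<gamma>\<^sub>3 B \<phi>"
proof -
  define C C' C'' where "C y = cos (\<omega> * y)" and "C' y = - \<omega> * sin (\<omega> * y)" and "C'' y = - \<omega>\<^sup>2 * cos (\<omega> * y)" for y
  have C: "(C has_vector_derivative C' y) (at y)" "(C' has_vector_derivative C'' y) (at y)" "continuous_on UNIV C''" for y
  proof -
    show "(C has_vector_derivative C' y) (at y)" "(C' has_vector_derivative C'' y) (at y)"
      unfolding C_def[abs_def] C'_def[abs_def] C''_def has_real_derivative_iff_has_vector_derivative[symmetric]
      by (auto intro!: derivative_eq_intros simp: power2_eq_square)
    show "continuous_on UNIV C''" unfolding C''_def[abs_def] by (intro continuous_intros)
  qed
  define z where "z = Complex lam 1"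
  define E where "E t = exp (of_real (lam * t) + \<i> * of_real t)" for t
  have Ez: "E t = exp (of_real t * z)" for t
    unfolding E_def z_def Complex_eq by (simp add: algebra_simps)
  have E: "((\<lambda>t. k * E t) has_vector_derivative (k * z) * E t) (at t)" for k t
    unfolding Ez by (auto intro!: derivative_eq_intros has_vector_derivative_real_field simp: mult_ac)
  have E': "(E has_vector_derivative z * E t) (at t)" for t using E[of 1] by simp
  have E_cont: "continuous_on UNIV (\<lambda>t. (z * z) * E t)"
    unfolding Ez by (intro continuous_intros)
  have X: "((\<lambda>t. k * exp (lam * t)) has_vector_derivative (k * lam) * exp (lam * t)) (at t)" for k t
    unfolding has_real_derivative_iff_has_vector_derivative[symmetric]
    by (auto intro!: derivative_eq_intros)
  have X': "((\<lambda>t. exp (lam * t)) has_vector_derivative lam * exp (lam * t)) (at t)" for t using X[of 1] by simp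
  have X_cont: "continuous_on UNIV (\<lambda>t. (lam * lam) * exp (lam * t))"
    by (intro continuous_intros)
  define a a' a'' where "a x = Complex (u x) (v x)" and "a' x = Complex (u' x) (v' x)" and "a'' x = Complex (u'' x) (v'' x)" for x
  have a: "(a has_vector_derivative a' x) (at x)" "(a' has_vector_derivative a'' x) (at x)" "continuous_on UNIV a''" for x
  proof -
    show "(a has_vector_derivative a' x) (at x)" "(a' has_vector_derivative a'' x) (at x)"
      unfolding a_def[abs_def] a'_def[abs_def] a''_def by (intro has_vector_derivative_Complex u v)+
    show "continuous_on UNIV a''" unfolding a''_def[abs_def] Complex_eq by (intro continuous_intros u v)
  qed
  note P' = P[unfolded has_real_derivative_iff_has_vector_derivative]
  have B: "B = separable a C E"
    by (simp add: B_def separable_def fun_eq_iff a_def C_def E_def scaleR_conv_of_real mult_ac)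
  have \<phi>: "\<phi> = separable P C (\<lambda>t. exp (lam * t))"
    by (simp add: \<phi>_def separable_def fun_eq_iff C_def mult_ac)
  have "class_C2 B" unfolding B by (rule class_C2_separable[OF a C E' E E_cont])
  moreover have "class_C2 \<phi>" unfolding \<phi> by (rule class_C2_separable[OF P' C X' X X_cont])
  moreover have ReB: "Re (exp (- \<i> * of_real t) * B x y t) = exp (lam * t) * (C y * u x)" for x y t
  proof -
    have "exp (- \<i> * of_real t) * B x y t = (exp (- \<i> * of_real t) * E t) * (of_real (C y) * Complex (u x) (v x))"
      unfolding B_def C_def E_def by (simp add: mult_ac)
    also have "exp (- \<i> * of_real t) * E t = of_real (exp (lam * t))"
      unfolding E_def by (simp flip: exp_add exp_of_real)
    finally show ?thesis by simp
  qed
  moreover have "linDS1 \<gamma>\<^sub>1 \<gamma>\<^sub>2 B \<phi> x y t = 0" for x y t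
  proof -
    have e: "exp (\<i> * of_real t) * of_real (exp (lam * t)) = E t"
      unfolding E_def by (simp add: add.commute flip: exp_add exp_of_real)
    have "linDS1 \<gamma>\<^sub>1 \<gamma>\<^sub>2 B \<phi> x y t = of_real (C y) * E t * (\<i> * z * a x + a'' x - of_real (\<omega>\<^sup>2) * a x
        + 2 * of_real ((sech x)\<^sup>2) * a x) + (exp (\<i> * of_real t) * of_real (exp (lam * t))) * of_real (C y)
        * of_real (2 * \<gamma>\<^sub>1 * (sech x)\<^sup>2 * u x + \<gamma>\<^sub>2 * sech x * P' x)"
      unfolding linDS1_def ReB unfolding B \<phi> partial_separable[OF a(1) C(1) E'] partial_separable[OF a(2) C(1) E']
        partial_separable[OF a(1) C(2) E'] partial_separable[OF P'(1) C(1) X']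
      by (simp add: separable_def scaleR_conv_of_real C_def C''_def algebra_simps)
    also have "\<dots> = of_real (C y) * E t * (\<i> * z * a x + a'' x - of_real (\<omega>\<^sup>2) * a x
        + 2 * of_real ((sech x)\<^sup>2) * a x + of_real (2 * \<gamma>\<^sub>1 * (sech x)\<^sup>2 * u x + \<gamma>\<^sub>2 * sech x * P' x))"
      unfolding e by (simp add: algebra_simps)
    also have "\<i> * z * a x + a'' x - of_real (\<omega>\<^sup>2) * a x + 2 * of_real ((sech x)\<^sup>2) * a x
        + of_real (2 * \<gamma>\<^sub>1 * (sech x)\<^sup>2 * u x + \<gamma>\<^sub>2 * sech x * P' x) = 0"
      using eq1[of x] eq2[of x] unfolding z_def a_def a''_def
      by (simp add: complex_eq_iff algebra_simps)
    finally show ?thesis by simp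
  qed
  moreover have "linDS2 \<gamma>\<^sub>3 B \<phi> x y t = 0" for x y t
  proof -
    have "((\<lambda>x. sech x * u x) has_vector_derivative sech x * u' x - sech x * tanh x * u x) (at x)" for x
      unfolding has_real_derivative_iff_has_vector_derivative[symmetric]
      by (rule DERIV_cong[OF DERIV_mult[OF sech_deriv u(1)]]) (simp add: algebra_simps)
    note s = partial_separable(1)[OF this C(1) X']
    have "(\<lambda>x y t. sech x * Re (exp (- \<i> * of_real t) * B x y t)) = separable (\<lambda>x. sech x * u x) C (\<lambda>t. exp (lam * t))"
      unfolding ReB by (simp add: separable_def fun_eq_iff mult_ac)
    then have "linDS2 \<gamma>\<^sub>3 B \<phi> x y t = exp (lam * t) * C y * (\<gamma>\<^sub>3 * P'' x - \<omega>\<^sup>2 * P x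
        - 2 * \<gamma>\<^sub>3 * (sech x * u' x - sech x * tanh x * u x))"
      unfolding linDS2_def \<phi> partial_separable[OF P'(1) C(1) X'] partial_separable[OF P'(2) C(1) X']
        partial_separable[OF P'(1) C(2) X']
      by (simp only: s) (simp add: separable_def C_def C''_def algebra_simps)
    then show ?thesis using eq3[of x] by simp
  qed
  ultimately show ?thesis unfolding linDS_solution_def by blast
qed

theorem theorem1p2:
  fixes \<gamma>\<^sub>1 \<gamma>\<^sub>2 \<gamma>\<^sub>3 :: real
  assumes "\<gamma>\<^sub>1 \<noteq> 0" and "\<gamma>\<^sub>2 \<noteq> 0" and "\<gamma>\<^sub>3 \<noteq> 0"
    and "\<gamma>\<^sub>1 + \<gamma>\<^sub>2 = 2" and "\<gamma>\<^sub>2 > 0" and "\<gamma>\<^sub>3 > 0"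
  shows "\<exists>lam\<^sub>0>0. \<forall>lam::real. 0 < lam \<and> lam < lam\<^sub>0 \<longrightarrow>
    (\<exists>(A :: real \<Rightarrow> real \<Rightarrow> complex) (\<phi> :: real \<Rightarrow> real \<Rightarrow> real).
      (\<exists>x y. (A x y, \<phi> x y) \<noteq> (0, 0)) \<and>
      periodic_in_y A \<phi> \<and> decays_in_x A \<and> decays_in_x \<phi> \<and>
      linDS_solution \<gamma>\<^sub>1 \<gamma>\<^sub>2 \<gamma>\<^sub>3
        (\<lambda>x y t. exp (of_real (lam * t) + \<i> * of_real t) * A x y)
        (\<lambda>x y t. exp (lam * t) * \<phi> x y))"
proof -
  \<comment> \<open>Chosen so that \<open>\<kappa> = \<omega> * d\<close> satisfies
    \<open>\<omega>\<^sup>2 = \<gamma>\<^sub>3 * \<kappa>\<^sup>2\<close>. Then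
    \<open>c * \<sigma>\<close> is the coefficient \<open>\<gamma>\<^sub>2 * \<kappa> / lam\<close>
    of the nonlocal correction.\<close>
  define d where "d = 1 / sqrt \<gamma>\<^sub>3"
  define c where "c = \<gamma>\<^sub>2 * d"
  have d: "0 < d" "\<gamma>\<^sub>3 * d\<^sup>2 = 1" using assms(6) by (simp_all add: d_def power_divide)
  obtain lam\<^sub>0 where lam\<^sub>0: "0 < lam\<^sub>0" and ex: "\<forall>lam. 0 < lam \<and> lam < lam\<^sub>0 \<longrightarrow> (\<exists>\<sigma> U U' Z Z' N N' K.
      0 < \<sigma> \<and> Z 0 = 0 \<and>
      (\<forall>x. \<bar>U x\<bar> \<le> K * exp (- (1 / 2) * \<bar>x\<bar>) \<and> \<bar>Z x\<bar> \<le> K * exp (- (1 / 2) * \<bar>x\<bar>) \<and>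
        \<bar>N' x\<bar> \<le> K * exp (- (lam * \<sigma> * d) * \<bar>x\<bar>) + K * exp (- (1 / 2) * \<bar>x\<bar>)) \<and>
      (\<forall>x. (U has_real_derivative U' x) (at x) \<and> (Z has_real_derivative Z' x) (at x) \<and>
        (N has_real_derivative N' x) (at x) \<and>
        (U' has_real_derivative (1 - 6 * (sech x)\<^sup>2) * U x + sech x
          + lam * (Z x + lam * \<sigma>\<^sup>2 * U x + c * \<sigma> * (sech x * N x))) (at x) \<and>
        (Z' has_real_derivative (1 - 2 * (sech x)\<^sup>2) * Z x + lam * (- U x + \<sigma>\<^sup>2 * (sech x + lam * Z x))) (at x) \<and>
        (N' has_real_derivative (lam * \<sigma> * d)\<^sup>2 * N x - 2 * (lam * \<sigma> * d) * (sech x * U x)) (at x)))"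
    using profile_equations[OF d(1), of c] by blast
  have main: "\<exists>A \<phi>. (\<exists>x y. (A x y, \<phi> x y) \<noteq> (0, 0)) \<and>
      periodic_in_y A \<phi> \<and> decays_in_x A \<and> decays_in_x \<phi> \<and>
      linDS_solution \<gamma>\<^sub>1 \<gamma>\<^sub>2 \<gamma>\<^sub>3
        (\<lambda>x y t. exp (of_real (lam * t) + \<i> * of_real t) * A x y)
        (\<lambda>x y t. exp (lam * t) * \<phi> x y)" if lam: "0 < lam \<and> lam < lam\<^sub>0" for lam
  proof -
    obtain \<sigma> U U' Z Z' N N' K where \<sigma>: "0 < \<sigma>" and Z0: "Z 0 = 0"
      and b: "\<forall>x. \<bar>U x\<bar> \<le> K * exp (- (1 / 2) * \<bar>x\<bar>) \<and> \<bar>Z x\<bar> \<le> K * exp (- (1 / 2) * \<bar>x\<bar>) \<and>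
        \<bar>N' x\<bar> \<le> K * exp (- (lam * \<sigma> * d) * \<bar>x\<bar>) + K * exp (- (1 / 2) * \<bar>x\<bar>)"
      and D: "\<forall>x. (U has_real_derivative U' x) (at x) \<and> (Z has_real_derivative Z' x) (at x) \<and>
        (N has_real_derivative N' x) (at x) \<and>
        (U' has_real_derivative (1 - 6 * (sech x)\<^sup>2) * U x + sech x
          + lam * (Z x + lam * \<sigma>\<^sup>2 * U x + c * \<sigma> * (sech x * N x))) (at x) \<and>
        (Z' has_real_derivative (1 - 2 * (sech x)\<^sup>2) * Z x + lam * (- U x + \<sigma>\<^sup>2 * (sech x + lam * Z x))) (at x) \<and>
        (N' has_real_derivative (lam * \<sigma> * d)\<^sup>2 * N x - 2 * (lam * \<sigma> * d) * (sech x * U x)) (at x)"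
      using ex[rule_format, OF lam] by (elim exE conjE) (rule that)
    note bound = b[rule_format, THEN conjunct1] b[rule_format, THEN conjunct2, THEN conjunct1]
      b[rule_format, THEN conjunct2, THEN conjunct2]
    note D' = D[rule_format, THEN conjunct2, THEN conjunct2]
    note U = D[rule_format, THEN conjunct1] and Z = D[rule_format, THEN conjunct2, THEN conjunct1]
    note N = D'[THEN conjunct1] and U' = D'[THEN conjunct2, THEN conjunct1]
    note Z' = D'[THEN conjunct2, THEN conjunct2, THEN conjunct1] and N' = D'[THEN conjunct2, THEN conjunct2, THEN conjunct2]
    define \<kappa> where "\<kappa> = lam * \<sigma> * d"
    define \<omega> where "\<omega> = lam * \<sigma>"
    have \<kappa>: "0 < \<kappa>" and \<omega>: "0 < \<omega>" using lam \<sigma> d by (simp_all add: \<kappa>_def \<omega>_def)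
    have \<omega>\<kappa>: "\<omega>\<^sup>2 = \<gamma>\<^sub>3 * \<kappa>\<^sup>2"
      using d(2) by (simp add: \<omega>_def \<kappa>_def power_mult_distrib)
    have cont: "continuous_on UNIV U" "continuous_on UNIV Z" "continuous_on UNIV N" "continuous_on UNIV N'" "continuous_on UNIV U'"
      using U Z N N' U' by (auto intro!: continuous_at_imp_continuous_on DERIV_isCont)
    have tanh_cont: "continuous_on UNIV (tanh :: real \<Rightarrow> real)"
      using tanh_deriv by (auto intro!: continuous_at_imp_continuous_on DERIV_isCont)
    define u where "u x = lam * U x" for x
    define v where "v x = sech x + lam * Z x" for x
    \<comment> \<open>The equation for \<open>P\<close> is
      \<open>P'' - \<kappa>\<^sup>2 P = 2 (sech u)'\<close>. Convolution with the Green function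
      \<open>- exp (- \<kappa> \<bar>x\<bar>) / (2 \<kappa>)\<close>, with the derivative moved onto
      the result, gives \<open>- (lam / \<kappa>) N'\<close>. In \<open>P'\<close> below, the
      equation for \<open>N\<close> has removed the factor \<open>1 / \<kappa>\<close>.\<close>
    define P where "P x = - (lam / \<kappa>) * N' x" for x
    define A where "A x y = complex_of_real (cos (\<omega> * y)) * Complex (u x) (v x)" for x y
    define \<phi> where "\<phi> x y = cos (\<omega> * y) * P x" for x y
    define P' where "P' x = 2 * lam * (sech x * U x) - lam * \<kappa> * N x" for x
    define P'' where "P'' x = 2 * lam * (sech x * U' x - sech x * tanh x * U x) - lam * \<kappa> * N' x" for x
    define u'' where "u'' x = lam * ((1 - 6 * (sech x)\<^sup>2) * U x + sech x
          + lam * (Z x + lam * \<sigma>\<^sup>2 * U x + c * \<sigma> * (sech x * N x)))" for x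
    define v'' where "v'' x = (1 - 2 * (sech x)\<^sup>2) * sech x
          + lam * ((1 - 2 * (sech x)\<^sup>2) * Z x + lam * (- U x + \<sigma>\<^sup>2 * (sech x + lam * Z x)))" for x
    have "linDS_solution \<gamma>\<^sub>1 \<gamma>\<^sub>2 \<gamma>\<^sub>3
        (\<lambda>x y t. exp (of_real (lam * t) + \<i> * of_real t) * (of_real (cos (\<omega> * y)) * Complex (u x) (v x)))
        (\<lambda>x y t. exp (lam * t) * (cos (\<omega> * y) * P x))"
    proof (rule linDS_solution_separated)
      show "(u has_real_derivative lam * U' x) (at x)" for x
        unfolding u_def[abs_def] by (rule DERIV_cmult[OF U])
      show "((\<lambda>x. lam * U' x) has_real_derivative u'' x) (at x)" for x
        unfolding u''_def by (rule DERIV_cmult[OF U'])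
      show "(v has_real_derivative decaying2' x + lam * Z' x) (at x)" for x
        unfolding v_def[abs_def] by (rule DERIV_add[OF kernel2_derivatives(1) DERIV_cmult[OF Z]])
      show "((\<lambda>x. decaying2' x + lam * Z' x) has_real_derivative v'' x) (at x)" for x
        unfolding v''_def by (rule DERIV_add[OF kernel2_derivatives(3) DERIV_cmult[OF Z']])
      show "(P has_real_derivative P' x) (at x)" for x
        unfolding P_def[abs_def] P'_def
        by (rule DERIV_cong[OF DERIV_cmult[OF N'[folded \<kappa>_def]]]) (use \<kappa> in \<open>simp add: field_simps power2_eq_square\<close>)
      show "(P' has_real_derivative P'' x) (at x)" for x
        unfolding P'_def[abs_def] P''_def
        by (rule DERIV_cong[OF DERIV_diff[OF DERIV_cmult[OF DERIV_mult[OF sech_deriv U]] DERIV_cmult[OF N]]])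
          (simp add: algebra_simps)
      show "continuous_on UNIV u''" "continuous_on UNIV v''" "continuous_on UNIV P''"
        unfolding u''_def[abs_def] v''_def[abs_def] P''_def[abs_def]
        by (intro continuous_intros cont continuous_on_compose2[OF tanh_cont] | simp)+
      show "u'' x - (1 + \<omega>\<^sup>2) * u x + (2 + 2 * \<gamma>\<^sub>1) * (sech x)\<^sup>2 * u x + \<gamma>\<^sub>2 * sech x * P' x = lam * v x" for x
      proof -
        \<comment> \<open>The local part of \<open>P'\<close> adds
          \<open>2 * \<gamma>\<^sub>2\<close> to the coefficient of
          \<open>(sech x)\<^sup>2 * u x\<close>; with this relation the sum is 6, as in the equation
          for \<open>U\<close>.\<close>
        have g: "\<gamma>\<^sub>1 = 2 - \<gamma>\<^sub>2" using assms(4) by simp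
        show ?thesis unfolding u''_def u_def v_def P'_def \<omega>_def \<kappa>_def c_def g
          by (simp add: algebra_simps power2_eq_square)
      qed
      show "v'' x - (1 + \<omega>\<^sup>2) * v x + 2 * (sech x)\<^sup>2 * v x = - lam * u x" for x
        unfolding v''_def u_def v_def \<omega>_def by (simp add: algebra_simps power2_eq_square)
      show "\<gamma>\<^sub>3 * P'' x - \<omega>\<^sup>2 * P x = 2 * \<gamma>\<^sub>3 * (sech x * (lam * U' x) - sech x * tanh x * u x)" for x
        unfolding P''_def P_def \<omega>\<kappa> u_def using \<kappa> by (simp add: field_simps power2_eq_square)
    qed
    then have "linDS_solution \<gamma>\<^sub>1 \<gamma>\<^sub>2 \<gamma>\<^sub>3 (\<lambda>x y t. exp (of_real (lam * t) + \<i> * of_real t) * A x y)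
        (\<lambda>x y t. exp (lam * t) * \<phi> x y)"
      unfolding A_def \<phi>_def .
    \<comment> \<open>Since \<open>Z 0 = 0\<close>, the imaginary part at the origin is
      \<open>sech 0 = 1\<close> for every \<open>lam\<close>.\<close>
    moreover have "A 0 0 \<noteq> 0" by (simp add: A_def v_def Z0 sech_def complex_eq_iff)
    then have "\<exists>x y. (A x y, \<phi> x y) \<noteq> (0, 0)" by auto
    moreover have "periodic_in_y A \<phi>"
      unfolding periodic_in_y_def
    proof (intro exI[of _ "2 * pi / \<omega>"] conjI allI)
      have "cos (\<omega> * (y + 2 * pi / \<omega>)) = cos (\<omega> * y)" for y
      proof -
        have "\<omega> * (y + 2 * pi / \<omega>) = \<omega> * y + 2 * pi" using \<omega> by (simp add: field_simps)
        then show ?thesis by simp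
      qed
      then show "A x (y + 2 * pi / \<omega>) = A x y" "\<phi> x (y + 2 * pi / \<omega>) = \<phi> x y" for x y
        unfolding A_def \<phi>_def by simp_all
    qed (use \<omega> in simp)
    moreover have "decays_in_x A"
    proof (rule decays_in_x_exp)
      fix x y
      have "cmod (A x y) \<le> 1 * cmod (Complex (u x) (v x))"
        unfolding A_def norm_mult norm_of_real by (intro mult_right_mono) auto
      also have "\<dots> \<le> \<bar>u x\<bar> + \<bar>v x\<bar>" using cmod_le[of "Complex (u x) (v x)"] by simp
      also have "\<dots> \<le> lam * \<bar>U x\<bar> + (\<bar>sech x\<bar> + lam * \<bar>Z x\<bar>)"
        using lam abs_triangle_ineq[of "sech x" "lam * Z x"] by (simp add: u_def v_def abs_mult)
      also have "\<dots> \<le> lam * (K * exp (- (1 / 2) * \<bar>x\<bar>)) + (2 * exp (- (1 / 2) * \<bar>x\<bar>) + lam * (K * exp (- (1 / 2) * \<bar>x\<bar>)))"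
        using lam bound by (intro add_mono mult_left_mono even_half_decay_bound[OF half_decay_sech]) auto
      finally show "cmod (A x y) \<le> (lam * K + 2) * exp (- (1 / 2) * \<bar>x\<bar>) + (lam * K) * exp (- (1 / 2) * \<bar>x\<bar>)"
        by (simp add: algebra_simps)
    qed simp_all
    moreover have "decays_in_x \<phi>"
    proof (rule decays_in_x_exp)
      fix x y
      have "norm (\<phi> x y) \<le> 1 * \<bar>P x\<bar>"
        unfolding \<phi>_def real_norm_def abs_mult by (intro mult_right_mono) auto
      also have "\<dots> = (lam / \<kappa>) * \<bar>N' x\<bar>" using lam \<kappa> by (simp add: P_def abs_mult)
      also have "\<dots> \<le> (lam / \<kappa>) * (K * exp (- \<kappa> * \<bar>x\<bar>) + K * exp (- (1 / 2) * \<bar>x\<bar>))"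
        using bound(3)[of x] lam \<kappa> unfolding \<kappa>_def[symmetric] by (intro mult_left_mono) auto
      finally show "norm (\<phi> x y) \<le> (lam / \<kappa> * K) * exp (- \<kappa> * \<bar>x\<bar>) + (lam / \<kappa> * K) * exp (- (1 / 2) * \<bar>x\<bar>)"
        by (simp add: distrib_left mult.assoc)
    qed (use \<kappa> in simp_all)
    ultimately show ?thesis by blast
  qed
  show ?thesis
    by (rule exI[of _ lam\<^sub>0], rule conjI, rule lam\<^sub>0, intro allI impI, rule main)
qed

end
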